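(* Let $K$ be an uncountable compact metric space and let $d\in\mathbb{N}^+$. Then for the prevalent $f\in C(K,\mathbb{R}^d)$ we have $$\dim_H\operatorname{graph}(f)=\dim_H K+d.$$
   Context: Prevalence: for an abelian Polish group $G$, a set $A\subset G$ is shy if there exist a Borel set $B\supset A$ in $G$ and a Borel probability measure $\nu$ on $G$ with $\nu(B+x)=0$ for all $x\in G$; complements of shy sets are prevalent. "For the prevalent $f\in G$ property $P$ holds" means that $\{f\in G: P(f)\}$ is prevalent. For compact metric $K$, $C(K,\mathbb{R}^d)$ is the Banach space of continuous maps $K\to\mathbb{R}^d$ with the maximum norm (an abelian Polish group under addition). $\dim_H$ is Hausdorff dimension (possibly $\infty$). $\operatorname{graph}(f)=\{(x,f(x)): x\in K\}\subset K\times\mathbb{R}^d$, where products of metric spaces carry the $\ell^2$-product metric $d((x_1,y_1),(x_2,y_2))=\sqrt{d_X(x_1,x_2)^2+d_Y(y_1,y_2)^2}$. *)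

theory Defs
  imports "HOL-Analysis.Analysis" "HOL-Probability.Probability"
begin

text \<open>
  For a compact metric space, i.e. a type \<open>'a\<close> of class \<^class>\<open>metric_space\<close> with
  \<open>compact (UNIV :: 'a set)\<close>, the Banach space of continuous maps into \<open>'b\<close> with the
  maximum norm is the type \<open>'a \<Rightarrow>\<^sub>C 'b\<close>, because boundedness is then automatic.
\<close>

lemma bcontfun_compact_UNIV:
  assumes "compact (UNIV :: 'a::metric_space set)"
  shows "(bcontfun :: ('a \<Rightarrow> 'b::metric_space) set) = {f. continuous_on UNIV f}"
  using assms
  by (auto simp: bcontfun_def intro: compact_imp_bounded compact_continuous_image)

text \<open>
  The notions below are meant for groups whose topology is moreover Polish. Translates of Borel
  sets are Borel, so \<^const>\<open>emeasure\<close> is only applied to measurable sets here.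
\<close>

definition shy :: "'g::topological_ab_group_add set \<Rightarrow> bool" where
  "shy A \<longleftrightarrow> (\<exists>B \<nu>. B \<in> sets borel \<and> A \<subseteq> B \<and>
     prob_space \<nu> \<and> sets \<nu> = sets borel \<and>
     (\<forall>x. emeasure \<nu> ((\<lambda>b. b + x) ` B) = 0))"

definition prevalent :: "'g::topological_ab_group_add set \<Rightarrow> bool" where
  "prevalent A \<longleftrightarrow> shy (- A)"

text \<open>
  The \<open>s\<close>-th power of the diameter of a bounded set, with the convention that it is \<open>0\<close> for the
  empty set and that \<open>0\<close> to the power \<open>0\<close> is \<open>1\<close> for nonempty sets (unlike \<open>powr\<close>).
\<close>

definition diam_pow :: "real \<Rightarrow> 'a::metric_space set \<Rightarrow> ennreal" where
  "diam_pow s U = (if U = {} then 0 else if s = 0 then 1 else ennreal (diameter U powr s))"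

text \<open>Boundedness is required because \<^const>\<open>diameter\<close> is a real number, unspecified for
  unbounded sets.\<close>

definition hausdorff_pre_measure :: "real \<Rightarrow> real \<Rightarrow> 'a::metric_space set \<Rightarrow> ennreal" where
  "hausdorff_pre_measure s \<delta> A =
     Inf {(\<Sum>i. diam_pow s (U i)) | U :: nat \<Rightarrow> 'a set.
            A \<subseteq> (\<Union>i. U i) \<and> (\<forall>i. bounded (U i) \<and> diameter (U i) \<le> \<delta>)}"

definition hausdorff_measure :: "real \<Rightarrow> 'a::metric_space set \<Rightarrow> ennreal" where
  "hausdorff_measure s A = (SUP \<delta>\<in>{0<..}. hausdorff_pre_measure s \<delta> A)"

text \<open>The infimum of the empty set is \<open>\<infinity>\<close> in \<^typ>\<open>ennreal\<close>.\<close>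

definition hausdorff_dim :: "'a::metric_space set \<Rightarrow> ennreal" where
  "hausdorff_dim A = Inf {ennreal s | s. 0 \<le> s \<and> hausdorff_measure s A = 0}"

text \<open>The library metric on \<open>'a \<times> 'b\<close> is the \<open>\<ell>\<^sup>2\<close>-product metric (\<open>dist_prod_def\<close>).\<close>

definition function_graph :: "('a \<Rightarrow> 'b) \<Rightarrow> ('a \<times> 'b) set" where
  "function_graph f = {(x, f x) | x. x \<in> UNIV}"

end

theory Submission
  imports Defs
begin

text \<open>
  Upper bound: a cover of \<open>K\<close> by sets of diameter at most \<open>r\<close> turns into a cover of the graph when each
  set is multiplied with the about \<open>r\<^sup>-\<^sup>d\<close> cells of size \<open>r\<close> meeting the bounded range of \<open>f\<close>.

  Lower bound: the probe is a random series \<open>\<Phi> = \<Sum>\<^sub>q c\<^sub>q \<Sum>\<^sub>i \<psi>\<^sub>q\<^sub>,\<^sub>i U\<^sub>q\<^sub>,\<^sub>i\<close> with independent \<open>U\<^sub>q\<^sub>,\<^sub>i\<close>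
  uniform in the unit cube, where \<open>\<psi>\<^sub>q\<^sub>,\<^sub>i\<close> equals 1 on the \<open>i\<close>-th of finitely many disjoint closed pieces and
  vanishes on the others, and \<open>c\<^sub>q\<close> decays polynomially. If \<open>x\<close> and \<open>z\<close> lie in different pieces of layer
  \<open>q\<close>, then for every \<open>g\<close> the increment of \<open>\<Phi> + g\<close> between them has density at most \<open>c\<^sub>q\<^sup>-\<^sup>d\<close>. The pieces cover
  most of a Frostman measure \<open>\<mu>\<close> of exponent \<open>s < dim K\<close> (for \<open>s = 0\<close>: of the natural measure on a Cantor
  scheme), so the expected \<open>t\<close>-energy of \<open>\<mu>\<close> lifted to the graph of \<open>\<Phi> + g\<close> is finite for \<open>t < s + d\<close>.
  It suffices to keep finitely supported approximations of \<open>\<mu>\<close> with bounded energies, so that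
  \<open>\<mu>\<close> itself need only be finitely additive; it comes from the Hahn-Banach theorem applied to the
  fractional covering cost, which is comparable to the Hausdorff content by Vitali's covering lemma.
\<close>

section \<open>Hausdorff measures and the upper bound\<close>

text \<open>Shyness asks for one Borel set and one measure, while the exponent \<open>t\<close>
  ranges over all values below \<open>dim K + d\<close>. Both are therefore built for countably many
  exponents at once: the levels of all mass systems are interleaved into the layers of a single
  series. Level \<open>l\<close> of system \<open>k\<close> becomes layer
  \<open>prod_encode (k, l)\<close>, an index quadratic in \<open>l\<close>. Separating two points
  there costs the factor \<open>c\<^sub>q\<close> to the power \<open>- d\<close>; polynomial
  weights keep this below the geometric gain in \<open>l\<close> drawn from the small mass of the
  pieces. The functions whose graph has large dimension do not obviously form a Borel set. The
  exceptional set is enlarged to those \<open>f\<close> for which the lower limit of truncated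
  energies is infinite at some exponent; every truncated energy is a finite combination of
  indicators of closed sets of functions. If \<open>dim K = 0\<close>, no Frostman bound of positive
  exponent exists, although every \<open>t < d\<close> must still be reached. Separation is then all
  that is available, so pieces are controlled by mass rather than by diameter, and an uncountable
  compact space supplies them by repeated splitting.\<close>

lemma hausdorff_pre_measure_less_obtain:
  assumes "hausdorff_pre_measure s \<delta> A < c"
  obtains U :: "nat \<Rightarrow> 'a::metric_space set"
  where "A \<subseteq> (\<Union>i. U i)" "\<And>i. bounded (U i)" "\<And>i. diameter (U i) \<le> \<delta>"
    "(\<Sum>i. diam_pow s (U i)) < c"
  using assms unfolding hausdorff_pre_measure_def Inf_less_iff by blast

lemma hausdorff_pre_measure_le:
  assumes "A \<subseteq> (\<Union>i. U i)" "\<And>i. bounded (U i)" "\<And>i. diameter (U i) \<le> \<delta>"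
  shows "hausdorff_pre_measure s \<delta> A \<le> (\<Sum>i. diam_pow s (U i))"
  unfolding hausdorff_pre_measure_def by (rule Inf_lower) (use assms in blast)

lemma diameter_le_dist:
  fixes S :: "'a::metric_space set"
  assumes "\<And>x y. x \<in> S \<Longrightarrow> y \<in> S \<Longrightarrow> dist x y \<le> b" "0 \<le> b"
  shows "diameter S \<le> b"
  using assms by (auto simp: diameter_def intro!: cSUP_least)

lemma diam_pow_empty [simp]: "diam_pow s {} = 0"
  by (simp add: diam_pow_def)

lemma hausdorff_pre_measure_le_finite:
  fixes U :: "nat \<Rightarrow> 'a::metric_space set"
  assumes "A \<subseteq> (\<Union>i<n. U i)" "\<And>i. i < n \<Longrightarrow> bounded (U i)" "\<And>i. i < n \<Longrightarrow> diameter (U i) \<le> \<delta>" "0 \<le> \<delta>"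
  shows "hausdorff_pre_measure s \<delta> A \<le> (\<Sum>i<n. diam_pow s (U i))"
proof -
  define V where "V i = (if i < n then U i else {})" for i
  have "hausdorff_pre_measure s \<delta> A \<le> (\<Sum>i. diam_pow s (V i))"
    by (rule hausdorff_pre_measure_le) (use assms in \<open>auto simp: V_def split: if_splits\<close>)
  also have "\<dots> = (\<Sum>i<n. diam_pow s (V i))"
    by (rule suminf_finite) (auto simp: V_def)
  also have "\<dots> = (\<Sum>i<n. diam_pow s (U i))"
    by (rule sum.cong) (auto simp: V_def)
  finally show ?thesis .
qed

lemma hausdorff_pre_measure_le_sum:
  fixes U :: "'i \<Rightarrow> 'a::metric_space set"
  assumes "finite I" "A \<subseteq> (\<Union>i\<in>I. U i)" "\<And>i. i \<in> I \<Longrightarrow> bounded (U i)" "\<And>i. i \<in> I \<Longrightarrow> diameter (U i) \<le> \<delta>" "0 \<le> \<delta>"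
  shows "hausdorff_pre_measure s \<delta> A \<le> (\<Sum>i\<in>I. diam_pow s (U i))"
proof -
  obtain h where h: "bij_betw h {0..<card I} I" using ex_bij_betw_nat_finite[OF assms(1)] by blast
  then have hI: "h j \<in> I" if "j < card I" for j using that by (auto simp: bij_betw_def)
  have "hausdorff_pre_measure s \<delta> A \<le> (\<Sum>j<card I. diam_pow s (U (h j)))"
  proof (rule hausdorff_pre_measure_le_finite)
    have "I = h ` {..<card I}" using h by (simp add: bij_betw_def lessThan_atLeast0)
    then show "A \<subseteq> (\<Union>j<card I. U (h j))" using assms(2) by (metis image_image)
  qed (use hI assms in auto)
  also have "\<dots> = (\<Sum>i\<in>I. diam_pow s (U i))"
    using sum.reindex_bij_betw[OF h] by (simp add: lessThan_atLeast0)
  finally show ?thesis .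
qed

lemma diam_pow_le:
  assumes "bounded U" "diameter U \<le> r" "0 < s"
  shows "diam_pow s U \<le> ennreal (r powr s)"
  using assms diameter_ge_0[OF assms(1)]
  by (auto simp: diam_pow_def intro!: ennreal_leI powr_mono2)

lemma diam_pow_antimono:
  assumes "bounded U" "diameter U \<le> 1" "0 \<le> s" "s \<le> t"
  shows "diam_pow t U \<le> diam_pow s U"
  using assms diameter_ge_0[OF assms(1)]
  by (auto simp: diam_pow_def ennreal_le_1 powr_le1 intro!: ennreal_leI powr_mono')

text \<open>Diameters at most 1 make each summand decrease in the exponent, so a nonzero pre-measure
  at exponent \<open>t\<close> and scale 1 already excludes a null Hausdorff measure at every
  smaller exponent. The lower bound is used in this form.\<close>

lemma hausdorff_pre_measure_antimono:
  assumes "0 \<le> s" "s \<le> t"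
  shows "hausdorff_pre_measure t 1 A \<le> hausdorff_pre_measure s 1 A"
  unfolding hausdorff_pre_measure_def
proof (rule Inf_mono)
  fix b assume "b \<in> {(\<Sum>i. diam_pow s (U i)) |U::nat\<Rightarrow>_. A \<subseteq> (\<Union>i. U i) \<and> (\<forall>i. bounded (U i) \<and> diameter (U i) \<le> 1)}"
  then obtain U :: "nat \<Rightarrow> _" where U: "A \<subseteq> (\<Union>i. U i)" "\<forall>i. bounded (U i) \<and> diameter (U i) \<le> 1"
    "b = (\<Sum>i. diam_pow s (U i))" by blast
  have "(\<Sum>i. diam_pow t (U i)) \<le> b"
    unfolding U(3) by (intro suminf_le diam_pow_antimono summableI) (use U(2) assms in auto)
  with U show "\<exists>a\<in>{(\<Sum>i. diam_pow t (U i)) |U::nat\<Rightarrow>_. A \<subseteq> (\<Union>i. U i) \<and> (\<forall>i. bounded (U i) \<and> diameter (U i) \<le> 1)}. a \<le> b"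
    by blast
qed

lemma hausdorff_pre_measure_le_measure:
  "0 < \<delta> \<Longrightarrow> hausdorff_pre_measure s \<delta> A \<le> hausdorff_measure s A"
  unfolding hausdorff_measure_def by (rule SUP_upper) auto

text \<open>Rests on the convention that \<open>diam_pow 0\<close> counts nonempty sets: one
  nonempty covering set already costs 1. Consequently every exponent at which a nonempty set is null
  is positive, as the upper bound requires.\<close>

lemma hausdorff_measure_zero_exponent:
  assumes "A \<noteq> {}"
  shows "hausdorff_measure 0 A \<noteq> 0"
proof
  assume "hausdorff_measure 0 A = 0"
  then have "hausdorff_pre_measure 0 1 A < 1"
    using hausdorff_pre_measure_le_measure[of 1 0 A] by simp
  then obtain U where U: "A \<subseteq> (\<Union>i. U i)" "(\<Sum>i. diam_pow 0 (U i)) < 1"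
    by (rule hausdorff_pre_measure_less_obtain)
  from U(1) assms obtain i where i: "U i \<noteq> {}" by blast
  have "1 = (\<Sum>j\<in>{i}. diam_pow 0 (U j))" using i by (simp add: diam_pow_def)
  also have "\<dots> \<le> (\<Sum>i. diam_pow 0 (U i))" by (rule sum_le_suminf) auto
  finally show False using U(2) by simp
qed

lemma small_powr_obtain:
  assumes "0 < (e::real)" "0 < s"
  obtains r where "0 < r" "r powr s \<le> e"
proof
  show "0 < e powr (1/s)" using assms by simp
  show "(e powr (1/s)) powr s \<le> e" using assms by (simp add: powr_powr)
qed

text \<open>A set of diameter 0 offers no scale at which to subdivide the range; it receives a small
  positive radius whose \<open>s\<close>-th power stays within the error \<open>e\<close>. With
  geometric errors the cost of a whole countable cover remains under control.\<close>

lemma diam_pow_radius: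
  assumes "bounded U" "diameter U \<le> b" "0 < s" "0 < (e::real)" "0 < b"
  obtains r where "0 < r" "r \<le> b" "diameter U \<le> r" "ennreal (r powr s) \<le> diam_pow s U + ennreal e"
proof (cases "U = {} \<or> diameter U = 0")
  case True
  obtain r where r: "0 < r" "r powr s \<le> e"
    using small_powr_obtain[OF assms(4,3)] by metis
  show ?thesis
  proof (rule that[of "min r b"])
    have "min r b powr s \<le> r powr s" using r assms by (intro powr_mono2) auto
    then have "ennreal (min r b powr s) \<le> ennreal e" using r(2) by (intro ennreal_leI) linarith
    then show "ennreal (min r b powr s) \<le> diam_pow s U + ennreal e" by (simp add: add_increasing)
  qed (use r assms True in auto)
next
  case False
  with diameter_ge_0[OF assms(1)] have "0 < diameter U" by (simp add: less_le)
  then show ?thesis using False assms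
    by (intro that[of "diameter U"]) (auto simp: diam_pow_def)
qed

text \<open>The assumption \<open>r \<le> 1\<close> absorbs the rounding of \<open>2 * R / r\<close>
  into \<open>(2 * R + 1) / r\<close>. The factor \<open>CARD('d)\<close> in the cell size comes
  from bounding the Euclidean norm by the sum of the coordinates.\<close>

lemma grid_cover:
  fixes R r :: real
  assumes "0 < r" "r \<le> 1" "0 < R"
  obtains n and W :: "nat \<Rightarrow> (real ^ 'd) set"
  where "cball 0 R \<subseteq> (\<Union>j<n. W j)"
    "\<And>j x y. x \<in> W j \<Longrightarrow> y \<in> W j \<Longrightarrow> dist x y \<le> CARD('d) * r"
    "real n \<le> ((2 * R + 1) / r) ^ CARD('d)"
proof -
  define m where "m = nat \<lceil>2 * R / r\<rceil>"
  have "real m \<le> 2 * R / r + 1" using assms unfolding m_def by (simp add: of_nat_ceiling)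
  also have "\<dots> \<le> (2 * R + 1) / r" using assms by (simp add: field_simps)
  finally have m: "real m \<le> (2 * R + 1) / r" .
  have m0: "2 * R / r \<le> m" unfolding m_def by linarith
  then have "m > 0" using assms by (smt (verit, best) divide_pos_pos gr0I of_nat_0)
  define F where "F = (UNIV \<rightarrow>\<^sub>E {..<m} :: ('d \<Rightarrow> nat) set)"
  have F: "finite F" "card F = m ^ CARD('d)"
    unfolding F_def by (auto simp: card_PiE intro!: finite_PiE)
  obtain h where h: "bij_betw h {0..<card F} F" using ex_bij_betw_nat_finite[OF F(1)] by blast
  define cell where "cell k = {y::real^'d. \<forall>i. -R + k i * r \<le> y $ i \<and> y $ i \<le> -R + (real (k i) + 1) * r}" for k :: "'d \<Rightarrow> nat"
  show ?thesis
  proof (rule that[of "\<lambda>j. cell (h j)" "card F"])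
    show "cball 0 R \<subseteq> (\<Union>j<card F. cell (h j))"
    proof
      fix y :: "real ^ 'd" assume "y \<in> cball 0 R"
      then have y: "\<bar>y $ i\<bar> \<le> R" for i
        using component_le_norm_cart[of y i] by (simp add: dist_norm)
      \<comment> \<open>The minimum with \<open>m - 1\<close> puts a coordinate on the upper
        boundary into the last closed cell.\<close>
      define k where "k i = min (nat \<lfloor>(y $ i + R) / r\<rfloor>) (m - 1)" for i
      have "k \<in> F" using \<open>m > 0\<close> by (auto simp: F_def k_def)
      then obtain j where j: "j < card F" "h j = k" using h unfolding bij_betw_def by force
      have "y \<in> cell k" unfolding cell_def
      proof (intro CollectI allI conjI)
        fix i
        have nn: "(y $ i + R) / r \<ge> 0" using y[of i] assms by simp
        have "real (k i) \<le> (y $ i + R) / r"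
          using nn by (auto simp: k_def min_def) linarith+
        then show "-R + k i * r \<le> y $ i" using assms by (simp add: field_simps)
        have "(y $ i + R) / r \<le> 2 * R / r" using y[of i] assms by (intro divide_right_mono) auto
        then have "(y $ i + R) / r \<le> real (k i) + 1"
          using nn m0 \<open>m > 0\<close> by (auto simp: k_def min_def of_nat_diff)
        then show "y $ i \<le> -R + (real (k i) + 1) * r" using assms by (simp add: field_simps)
      qed
      then show "y \<in> (\<Union>j<card F. cell (h j))" using j by auto
    qed
    fix j and x y :: "real^'d" assume xy: "x \<in> cell (h j)" "y \<in> cell (h j)"
    have "dist x y \<le> (\<Sum>i\<in>UNIV. \<bar>(x - y) $ i\<bar>)"
      unfolding dist_norm by (rule norm_le_l1_cart)
    also have "\<dots> \<le> (\<Sum>i\<in>(UNIV::'d set). r)"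
    proof (rule sum_mono)
      fix i show "\<bar>(x - y) $ i\<bar> \<le> r"
      proof -
        have "-R + h j i * r \<le> x $ i" "x $ i \<le> -R + h j i * r + r"
          "-R + h j i * r \<le> y $ i" "y $ i \<le> -R + h j i * r + r"
          using xy[unfolded cell_def mem_Collect_eq, THEN spec, of i] unfolding distrib_right by linarith+
        then show ?thesis by (simp add: abs_le_iff)
      qed
    qed
    finally show "dist x y \<le> CARD('d) * r" by simp
  next
    show "real (card F) \<le> ((2 * R + 1) / r) ^ CARD('d)"
      using m by (simp add: F power_mono)
  qed
qed

lemma hausdorff_measure_graph_zero:
  fixes f :: "'a::metric_space \<Rightarrow> real ^ 'd"
  assumes "bounded (range f)" "0 < s" "hausdorff_measure s (UNIV :: 'a set) = 0"
  shows "hausdorff_measure (s + CARD('d)) (function_graph f) = 0"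
proof -
  let ?d = "CARD('d)"
  obtain R where R: "0 < R" "\<And>x. norm (f x) \<le> R"
    using assms(1) unfolding bounded_pos by auto
  \<comment> \<open>A set of size \<open>r\<close> yields at most
    \<open>((2 * R + 1) / r) ^ ?d\<close> products of diameter at most \<open>(?d + 1) * r\<close>;
    at exponent \<open>s + ?d\<close> their costs add up to at most
    \<open>K * r powr s\<close>.\<close>
  define K where "K = (2 * R + 1) ^ ?d * (real ?d + 1) powr (s + ?d)"
  have K0: "K > 0" using R by (simp add: K_def)
  have "hausdorff_pre_measure (s + ?d) \<delta> (function_graph f) = 0" if "\<delta> > 0" for \<delta>
  proof -
    have "hausdorff_pre_measure (s + ?d) \<delta> (function_graph f) \<le> ennreal e" if "e > 0" for e
    proof -
      define b where "b = min 1 (\<delta> / (real ?d + 1))"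
      have b: "0 < b" "b \<le> 1"
        using \<open>\<delta> > 0\<close> by (auto simp: b_def)
      have "(real ?d + 1) * b \<le> (real ?d + 1) * (\<delta> / (real ?d + 1))"
        unfolding b_def by (intro mult_left_mono min.cobounded2) simp
      then have bd: "(real ?d + 1) * b \<le> \<delta>" by simp
      \<comment> \<open>One share \<open>e'\<close> pays for the cover, two shares for the geometric
        errors made when diameters are replaced by positive radii.\<close>
      define e' where "e' = e / (K * 3)"
      have e': "e' > 0" using that K0 by (simp add: e'_def)
      have "hausdorff_pre_measure s b (UNIV :: 'a set) < ennreal e'"
        using hausdorff_pre_measure_le_measure[of b s "UNIV::'a set"] b e' assms(3) by simp
      then obtain U :: "nat \<Rightarrow> 'a set" where U: "UNIV \<subseteq> (\<Union>i. U i)" "\<And>i. bounded (U i)" "\<And>i. diameter (U i) \<le> b"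
        "(\<Sum>i. diam_pow s (U i)) < ennreal e'"
        using hausdorff_pre_measure_less_obtain by metis
      have "\<exists>r. 0 < r \<and> r \<le> b \<and> diameter (U i) \<le> r \<and> ennreal (r powr s) \<le> diam_pow s (U i) + ennreal (e' * (1/2)^i)" for i
      proof -
        have "0 < e' * (1/2)^i" using e' by simp
        from diam_pow_radius[OF U(2)[of i] U(3)[of i] assms(2) this b(1)] show ?thesis by blast
      qed
      then obtain r where r: "\<And>i. 0 < r i" "\<And>i. r i \<le> b" "\<And>i. diameter (U i) \<le> r i"
        "\<And>i. ennreal (r i powr s) \<le> diam_pow s (U i) + ennreal (e' * (1/2)^i)" by metis
      have "\<exists>n W. cball (0::real^'d) R \<subseteq> (\<Union>j<n. W j) \<and>
         (\<forall>j x y. x \<in> W j \<longrightarrow> y \<in> W j \<longrightarrow> dist x y \<le> ?d * r i) \<and> real n \<le> ((2 * R + 1) / r i) ^ ?d" for i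
      proof -
        have "r i \<le> 1" using r(2)[of i] b by linarith
        from grid_cover[OF r(1)[of i] this R(1), where 'd='d] show ?thesis by (metis (no_types))
      qed
      then have "\<forall>i. \<exists>n W. cball (0::real^'d) R \<subseteq> (\<Union>j<n. W j) \<and>
         (\<forall>j x y. x \<in> W j \<longrightarrow> y \<in> W j \<longrightarrow> dist x y \<le> ?d * r i) \<and> real n \<le> ((2 * R + 1) / r i) ^ ?d"
        by blast
      from choice[OF this] obtain n where "\<forall>i. \<exists>W. cball (0::real^'d) R \<subseteq> (\<Union>j<n i. W j) \<and>
         (\<forall>j x y. x \<in> W j \<longrightarrow> y \<in> W j \<longrightarrow> dist x y \<le> ?d * r i) \<and> real (n i) \<le> ((2 * R + 1) / r i) ^ ?d"
        by blast
      from choice[OF this] obtain W :: "nat \<Rightarrow> nat \<Rightarrow> (real^'d) set" where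
        W: "\<And>i. cball 0 R \<subseteq> (\<Union>j<n i. W i j)" "\<And>i j x y. x \<in> W i j \<Longrightarrow> y \<in> W i j \<Longrightarrow> dist x y \<le> ?d * r i"
        "\<And>i. real (n i) \<le> ((2 * R + 1) / r i) ^ ?d" by blast
      define V where "V = (\<lambda>(i,j). if j < n i then U i \<times> W i j else {})"
      have dV: "dist p q \<le> (real ?d + 1) * r i" if "p \<in> V (i,j)" "q \<in> V (i,j)" for p q i j
      proof -
        have "dist p q \<le> dist (fst p) (fst q) + dist (snd p) (snd q)"
          by (simp add: dist_prod_def sqrt_sum_squares_le_sum)
        also have "dist (fst p) (fst q) \<le> r i"
          using that diameter_bounded_bound[OF U(2)[of i], of "fst p" "fst q"] r(3)[of i]
          by (auto simp: V_def split: if_splits)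
        also have "dist (snd p) (snd q) \<le> ?d * r i"
          using that W(2) by (auto simp: V_def split: if_splits)
        finally show ?thesis by (simp add: algebra_simps)
      qed
      have bV: "bounded (V p)" for p
        using dV unfolding bounded_two_points by (cases p) blast
      have diV: "diameter (V (i,j)) \<le> (real ?d + 1) * r i" for i j
        using dV[of _ i j] r(1)[of i] by (intro diameter_le_dist) auto
      have "(\<Sum>i. ennreal (r i powr s)) \<le> (\<Sum>i. diam_pow s (U i) + ennreal (e' * (1/2)^i))"
        by (intro suminf_le summableI r(4))
      also have "\<dots> = (\<Sum>i. diam_pow s (U i)) + (\<Sum>i. ennreal (e' * (1/2)^i))"
        by (rule suminf_add[symmetric]) auto
      also have "(\<Sum>i. ennreal (e' * (1/2)^i)) = ennreal (e' * 2)"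
        using e' geometric_sums[of "1/2::real"] by (intro suminf_ennreal_eq sums_mult) auto
      also have "(\<Sum>i. diam_pow s (U i)) + ennreal (e' * 2) \<le> ennreal e' + ennreal (e' * 2)"
        using U(4) by (intro add_right_mono) auto
      also have "\<dots> = ennreal (e' * 3)" using e' by (simp flip: ennreal_plus)
      finally have rs: "(\<Sum>i. ennreal (r i powr s)) \<le> ennreal (e' * 3)" .
      have "hausdorff_pre_measure (s + ?d) \<delta> (function_graph f) \<le> (\<Sum>k. diam_pow (s + ?d) (V (prod_decode k)))"
      proof (rule hausdorff_pre_measure_le)
        show "function_graph f \<subseteq> (\<Union>k. V (prod_decode k))"
        proof
          fix p assume "p \<in> function_graph f"
          then obtain x where p: "p = (x, f x)" unfolding function_graph_def by auto
          obtain i where "x \<in> U i" using U(1) by blast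
          moreover have "f x \<in> cball 0 R" using R by simp
          then obtain j where "j < n i" "f x \<in> W i j" using W(1)[of i] by auto
          ultimately have "p \<in> V (prod_decode (prod_encode (i,j)))" by (simp add: V_def p)
          then show "p \<in> (\<Union>k. V (prod_decode k))" by blast
        qed
        show "bounded (V (prod_decode k))" for k by (rule bV)
        show "diameter (V (prod_decode k)) \<le> \<delta>" for k
        proof -
          obtain i j where ij: "prod_decode k = (i,j)" by fastforce
          have "(real ?d + 1) * r i \<le> (real ?d + 1) * b" using r(2)[of i] by (intro mult_left_mono) auto
          then show ?thesis using diV[of i j] bd unfolding ij by linarith
        qed
      qed
      also have "\<dots> = (\<Sum>i. \<Sum>j. diam_pow (s + ?d) (V (i,j)))"
        by (rule suminf_ennreal_2dimen) simp
      also have "\<dots> \<le> (\<Sum>i. ennreal K * ennreal (r i powr s))"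
      proof (intro suminf_le summableI)
        fix i
        have "(\<Sum>j. diam_pow (s + ?d) (V (i,j))) = (\<Sum>j<n i. diam_pow (s + ?d) (V (i,j)))"
          by (rule suminf_finite) (auto simp: V_def)
        also have "\<dots> \<le> (\<Sum>j<n i. ennreal (((real ?d + 1) * r i) powr (s + ?d)))"
          by (intro sum_mono diam_pow_le bV diV) (use assms in auto)
        also have "\<dots> = ennreal (n i * ((real ?d + 1) * r i) powr (s + ?d))"
          by (subst sum_ennreal) auto
        also have "\<dots> \<le> ennreal (K * r i powr s)"
        proof (rule ennreal_leI)
          have "n i * ((real ?d + 1) * r i) powr (s + ?d) \<le> ((2 * R + 1) / r i) ^ ?d * ((real ?d + 1) * r i) powr (s + ?d)"
            using W(3)[of i] by (intro mult_right_mono) auto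
          also have "\<dots> = K * r i powr s"
          proof -
            have "((real ?d + 1) * r i) powr (s + ?d) = (real ?d + 1) powr (s + ?d) * (r i powr s * r i ^ ?d)"
              using r(1)[of i] by (simp only: powr_mult powr_add[of "r i"] powr_realpow)
            moreover have "(2 * R + 1) ^ ?d = ((2 * R + 1) / r i) ^ ?d * r i ^ ?d"
              using r(1)[of i] by (simp flip: power_mult_distrib)
            ultimately show ?thesis unfolding K_def by (simp only: mult_ac)
          qed
          finally show "n i * ((real ?d + 1) * r i) powr (s + ?d) \<le> K * r i powr s" .
        qed
        finally show "(\<Sum>j. diam_pow (s + ?d) (V (i,j))) \<le> ennreal K * ennreal (r i powr s)"
          using K0 by (simp add: ennreal_mult)
      qed
      also have "\<dots> = ennreal K * (\<Sum>i. ennreal (r i powr s))"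
        by (rule ennreal_suminf_cmult)
      also have "\<dots> \<le> ennreal K * ennreal (e' * 3)"
        by (intro mult_left_mono rs) simp
      also have "\<dots> = ennreal e"
        using K0 e' by (subst ennreal_mult[symmetric]) (auto simp: e'_def)
      finally show ?thesis .
    qed
    note le = this
    have "hausdorff_pre_measure (s + ?d) \<delta> (function_graph f) \<le> 0"
    proof (rule ennreal_le_epsilon)
      fix e :: real assume "0 < e"
      from le[OF this] show "hausdorff_pre_measure (s + ?d) \<delta> (function_graph f) \<le> 0 + ennreal e" by simp
    qed
    then show ?thesis by simp
  qed
  then show ?thesis by (simp add: hausdorff_measure_def)
qed

lemma hausdorff_dim_graph_le:
  fixes f :: "'a::metric_space \<Rightarrow> real ^ 'd"
  assumes "bounded (range f)"
  shows "hausdorff_dim (function_graph f) \<le> hausdorff_dim (UNIV :: 'a set) + of_nat CARD('d)"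
proof -
  \<comment> \<open>Truncated subtraction moves \<open>CARD('d)\<close> to the left, so that the
    infimum on the right can be treated as a greatest lower bound, also when it is infinite.\<close>
  have "hausdorff_dim (function_graph f) - of_nat CARD('d) \<le> hausdorff_dim (UNIV :: 'a set)"
    unfolding hausdorff_dim_def[of UNIV]
  proof (rule Inf_greatest)
    fix b assume "b \<in> {ennreal s |s. 0 \<le> s \<and> hausdorff_measure s (UNIV::'a set) = 0}"
    then obtain s where s: "b = ennreal s" "0 \<le> s" "hausdorff_measure s (UNIV::'a set) = 0" by blast
    with hausdorff_measure_zero_exponent[of "UNIV::'a set"] have "0 < s" by (cases "s = 0") auto
    then have "hausdorff_measure (s + CARD('d)) (function_graph f) = 0"
      by (intro hausdorff_measure_graph_zero assms s)
    then have "hausdorff_dim (function_graph f) \<le> ennreal (s + CARD('d))"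
      unfolding hausdorff_dim_def using s(2) by (intro Inf_lower CollectI exI[of _ "s + CARD('d)"]) simp
    also have "\<dots> = b + of_nat CARD('d)" using s by (simp add: ennreal_plus ennreal_of_nat_eq_real_of_nat)
    finally show "hausdorff_dim (function_graph f) - of_nat CARD('d) \<le> b"
      by (simp add: ennreal_minus_le_iff add.commute)
  qed
  then show ?thesis by (simp add: ennreal_minus_le_iff add.commute)
qed

section \<open>Sublinear functionals and weighted covers\<close>

definition sublinear :: "('v::real_vector \<Rightarrow> real) \<Rightarrow> bool" where
  "sublinear q \<longleftrightarrow> (\<forall>x y. q (x + y) \<le> q x + q y) \<and> (\<forall>c>0. \<forall>x. q (c *\<^sub>R x) = c * q x)"

lemma sublinear_add: "sublinear q \<Longrightarrow> q (x + y) \<le> q x + q y"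
  and sublinear_scale: "sublinear q \<Longrightarrow> 0 < c \<Longrightarrow> q (c *\<^sub>R x) = c * q x"
  by (auto simp: sublinear_def)

lemma sublinear_0: "sublinear q \<Longrightarrow> q 0 = 0"
  using sublinear_scale[of q 2 0] by simp

lemma sublinear_neg: "sublinear q \<Longrightarrow> - q (- x) \<le> q x"
  using sublinear_add[of q x "-x"] sublinear_0[of q] by simp

text \<open>The auxiliary functional in the proof of the Hahn-Banach theorem by minimal sublinear
  functionals: the choice \<open>t = 0\<close> shows that it lies below \<open>q\<close>, and
  \<open>t = 1\<close> that its value at \<open>- y\<close> is at most \<open>- q y\<close>.\<close>

definition lower_shift :: "('v::real_vector \<Rightarrow> real) \<Rightarrow> 'v \<Rightarrow> 'v \<Rightarrow> real" where
  "lower_shift q y x = (INF t\<in>{0..}. q (x + t *\<^sub>R y) - t * q y)"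

lemma lower_shift_bdd:
  assumes "sublinear q" "0 \<le> t"
  shows "- q (- x) \<le> q (x + t *\<^sub>R y) - t * q y"
proof (cases "t = 0")
  case True then show ?thesis using sublinear_neg[OF assms(1)] by simp
next
  case False
  then have "t * q y = q (t *\<^sub>R y)" using assms by (simp add: sublinear_scale)
  also have "\<dots> \<le> q (x + t *\<^sub>R y) + q (- x)"
    using sublinear_add[OF assms(1), of "x + t *\<^sub>R y" "- x"] by simp
  finally show ?thesis by simp
qed

lemma lower_shift_le:
  assumes "sublinear q" "0 \<le> t"
  shows "lower_shift q y x \<le> q (x + t *\<^sub>R y) - t * q y"
  unfolding lower_shift_def
  by (rule cINF_lower) (use assms lower_shift_bdd[OF assms(1)] in \<open>auto intro!: bdd_belowI2\<close>)

lemma lower_shift_greatest: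
  assumes "\<And>t. 0 \<le> t \<Longrightarrow> b \<le> q (x + t *\<^sub>R y) - t * q y"
  shows "b \<le> lower_shift q y x"
  unfolding lower_shift_def by (rule cINF_greatest) (use assms in auto)

lemma sublinear_lower_shift:
  assumes q: "sublinear q"
  shows "sublinear (lower_shift q y)"
  unfolding sublinear_def
proof (intro conjI allI impI)
  fix x x'
  have "lower_shift q y (x + x') - lower_shift q y x' \<le> lower_shift q y x"
  proof (rule lower_shift_greatest)
    fix t :: real assume t: "0 \<le> t"
    have "lower_shift q y (x + x') - (q (x + t *\<^sub>R y) - t * q y) \<le> lower_shift q y x'"
    proof (rule lower_shift_greatest)
      fix t' :: real assume t': "0 \<le> t'"
      have "lower_shift q y (x + x') \<le> q ((x + x') + (t + t') *\<^sub>R y) - (t + t') * q y"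
        using t t' by (intro lower_shift_le q) auto
      also have "(x + x') + (t + t') *\<^sub>R y = (x + t *\<^sub>R y) + (x' + t' *\<^sub>R y)"
        by (simp add: algebra_simps)
      also have "q \<dots> \<le> q (x + t *\<^sub>R y) + q (x' + t' *\<^sub>R y)" by (rule sublinear_add[OF q])
      finally show "lower_shift q y (x + x') - (q (x + t *\<^sub>R y) - t * q y) \<le> q (x' + t' *\<^sub>R y) - t' * q y"
        by (simp add: algebra_simps)
    qed
    then show "lower_shift q y (x + x') - lower_shift q y x' \<le> q (x + t *\<^sub>R y) - t * q y" by simp
  qed
  then show "lower_shift q y (x + x') \<le> lower_shift q y x + lower_shift q y x'" by simp
next
  fix c :: real and x assume c: "0 < c"
  have le: "lower_shift q y (c *\<^sub>R x) \<le> c * lower_shift q y x" if "0 < c" for c x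
  proof -
    have "lower_shift q y (c *\<^sub>R x) / c \<le> lower_shift q y x"
    proof (rule lower_shift_greatest)
      fix t :: real assume t: "0 \<le> t"
      have "lower_shift q y (c *\<^sub>R x) \<le> q (c *\<^sub>R x + (c * t) *\<^sub>R y) - (c * t) * q y"
        using t that by (intro lower_shift_le q) auto
      also have "c *\<^sub>R x + (c * t) *\<^sub>R y = c *\<^sub>R (x + t *\<^sub>R y)" by (simp add: scaleR_add_right)
      also have "q \<dots> = c * q (x + t *\<^sub>R y)" by (rule sublinear_scale[OF q that])
      finally show "lower_shift q y (c *\<^sub>R x) / c \<le> q (x + t *\<^sub>R y) - t * q y"
        using that by (simp add: field_simps)
    qed
    then show ?thesis using that by (simp add: field_simps)
  qed
  have "lower_shift q y (inverse c *\<^sub>R (c *\<^sub>R x)) \<le> inverse c * lower_shift q y (c *\<^sub>R x)"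
    using c by (intro le) auto
  then have "c * lower_shift q y x \<le> lower_shift q y (c *\<^sub>R x)"
    using c by (simp add: field_simps)
  with le[OF c, of x] show "lower_shift q y (c *\<^sub>R x) = c * lower_shift q y x" by simp
qed

text \<open>Zorn's lemma for the reversed order. The pointwise infimum of a chain below
  \<open>p\<close> is finite because every sublinear \<open>q \<le> p\<close> satisfies
  \<open>- p (- x) \<le> q x\<close>.\<close>

lemma sublinear_minimal:
  assumes p: "sublinear p"
  obtains q where "sublinear q" "q \<le> p" "\<And>q'. sublinear q' \<Longrightarrow> q' \<le> q \<Longrightarrow> q' = q"
proof -
  define Q where "Q = {q. sublinear q \<and> q \<le> p}"
  have lb: "- p (- x) \<le> q x" if "q \<in> Q" for q x
    using that sublinear_neg[of q x] unfolding Q_def le_fun_def by (smt (verit) mem_Collect_eq)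
  have "\<exists>m\<in>Q. \<forall>q\<in>Q. m \<ge> q \<longrightarrow> q = m"
  proof (rule predicate_Zorn[of Q "\<lambda>a b. a \<ge> b"])
    show "partial_order_on Q (relation_of (\<lambda>a b. a \<ge> b) Q)"
      by (rule partial_order_on_relation_ofI) auto
    fix C assume C: "C \<in> Chains (relation_of (\<lambda>a b. a \<ge> b) Q)"
    then have CQ: "C \<subseteq> Q" and tot: "\<And>a b. a \<in> C \<Longrightarrow> b \<in> C \<Longrightarrow> a \<ge> b \<or> b \<ge> a"
      by (auto simp: Chains_def relation_of_def)
    show "\<exists>u\<in>Q. \<forall>a\<in>C. a \<ge> u"
    proof (cases "C = {}")
      case True then show ?thesis using p by (auto simp: Q_def)
    next
      case False
      define u where "u x = (INF q\<in>C. q x)" for x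
      have bdd: "bdd_below ((\<lambda>q. q x) ` C)" for x
        using lb CQ by (intro bdd_belowI2[of _ "- p (- x)"]) auto
      have ule: "u x \<le> q x" if "q \<in> C" for q x
        unfolding u_def by (rule cINF_lower[OF bdd that])
      have ugr: "b \<le> u x" if "\<And>q. q \<in> C \<Longrightarrow> b \<le> q x" for b x
        unfolding u_def by (rule cINF_greatest[OF False that])
      have "sublinear u"
        unfolding sublinear_def
      proof (intro conjI allI impI)
        fix x y
        have "u (x + y) - u y \<le> u x"
        proof (rule ugr)
          fix q assume q: "q \<in> C"
          have "u (x + y) - q x \<le> u y"
          proof (rule ugr)
            fix r assume r: "r \<in> C"
            \<comment> \<open>Subadditivity passes to the infimum because the smaller of the two
              chain members can serve in both summands.\<close>
            obtain m where m: "m \<in> C" "m \<le> q" "m \<le> r" using tot[OF q r] q r by blast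
            have "u (x + y) \<le> m (x + y)" by (rule ule[OF m(1)])
            also have "\<dots> \<le> m x + m y" using m(1) CQ by (auto simp: Q_def sublinear_add)
            also have "\<dots> \<le> q x + r y" using m by (intro add_mono) (auto simp: le_fun_def)
            finally show "u (x + y) - q x \<le> r y" by simp
          qed
          then show "u (x + y) - u y \<le> q x" by simp
        qed
        then show "u (x + y) \<le> u x + u y" by simp
      next
        fix c :: real and x assume c: "0 < c"
        have sc: "q (c *\<^sub>R x) = c * q x" if "q \<in> C" for q
          using that CQ c by (auto simp: Q_def sublinear_scale)
        have "c * u x \<le> u (c *\<^sub>R x)"
        proof (rule ugr)
          fix q assume "q \<in> C"
          then show "c * u x \<le> q (c *\<^sub>R x)" using ule[of q x] c by (simp only: sc mult_left_mono less_imp_le)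
        qed
        moreover have "u (c *\<^sub>R x) / c \<le> u x"
        proof (rule ugr)
          fix q assume "q \<in> C"
          then show "u (c *\<^sub>R x) / c \<le> q x" using ule[of q "c *\<^sub>R x"] sc c by (simp add: field_simps)
        qed
        ultimately show "u (c *\<^sub>R x) = c * u x" using c by (simp add: field_simps)
      qed
      moreover obtain q0 where "q0 \<in> C" using False by blast
      then have "u \<le> p" using ule CQ unfolding Q_def le_fun_def
        by (smt (verit, del_insts) mem_Collect_eq subsetD)
      ultimately have "u \<in> Q" by (simp add: Q_def)
      then show ?thesis using ule by (auto simp: le_fun_def)
    qed
  qed
  then obtain m where "m \<in> Q" "\<And>q. q \<in> Q \<Longrightarrow> q \<le> m \<Longrightarrow> q = m" by blast
  then show ?thesis by (intro that[of m]) (auto simp: Q_def)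
qed

text \<open>A minimal sublinear functional \<open>q\<close> is linear: it coincides with \<open>lower_shift q y\<close>, so
  \<open>q x + q y \<le> q (x + y)\<close>.\<close>

lemma hahn_banach_sublinear:
  assumes p: "sublinear p"
  obtains L where "linear L" "L \<le> p" "L y = p y"
proof -
  have ls: "lower_shift q z \<le> q" if "sublinear q" for q :: "'a \<Rightarrow> real" and z
    using lower_shift_le[OF that, of 0 z] by (simp add: le_fun_def)
  \<comment> \<open>Starting below \<open>lower_shift p y\<close> instead of \<open>p\<close> forces
    \<open>L (- y) \<le> - p y\<close>, hence equality at \<open>y\<close>.\<close>
  obtain L where L: "sublinear L" "L \<le> lower_shift p y" "\<And>q'. sublinear q' \<Longrightarrow> q' \<le> L \<Longrightarrow> q' = L"
    using sublinear_minimal[OF sublinear_lower_shift[OF p]] by blast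
  have "L (x + z) = L x + L z" for x z
  proof -
    have "lower_shift L z = L" by (intro L(3) sublinear_lower_shift L(1) ls)
    then have "L x + L z \<le> L (x + z)" using lower_shift_le[OF L(1), of 1 z x] by simp
    with sublinear_add[OF L(1), of x z] show ?thesis by simp
  qed note add = this
  have neg: "L (- x) = - L x" for x
    using add[of x "-x"] sublinear_0[OF L(1)] by simp
  have "linear L"
  proof (rule linearI)
    show "L (c *\<^sub>R x) = c *\<^sub>R L x" for c x
    proof -
      consider "c > 0" | "c = 0" | "c < 0" by linarith
      then show ?thesis
      proof cases
        case 3
        then have "L ((- c) *\<^sub>R (- x)) = (- c) * L (- x)" by (intro sublinear_scale L(1)) auto
        then show ?thesis by (simp add: neg)
      qed (auto simp: sublinear_scale[OF L(1)] sublinear_0[OF L(1)])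
    qed
  qed (rule add)
  moreover have "L \<le> p" using L(2) ls[OF p] by (rule order_trans)
  moreover have "L y = p y"
  proof (rule antisym)
    show "L y \<le> p y" using \<open>L \<le> p\<close> by (simp add: le_fun_def)
    have "L (- y) \<le> lower_shift p y (- y)" using L(2) by (simp add: le_fun_def)
    also have "\<dots> \<le> p (- y + 1 *\<^sub>R y) - 1 * p y" by (rule lower_shift_le[OF p]) simp
    finally show "p y \<le> L y" by (simp add: sublinear_0[OF p] neg)
  qed
  ultimately show ?thesis by (rule that)
qed

section \<open>Vitali covering and fractional covers\<close>

text \<open>Greedy choice: the threefold enlargement of a ball of largest radius contains every ball
  that meets it, and induction handles the balls that miss it.\<close>

lemma finite_Vitali:
  fixes x :: "'i \<Rightarrow> 'a::metric_space" and r :: "'i \<Rightarrow> real"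
  assumes "finite I"
  obtains J where "J \<subseteq> I" "\<And>i j. i \<in> J \<Longrightarrow> j \<in> J \<Longrightarrow> i \<noteq> j \<Longrightarrow> cball (x i) (r i) \<inter> cball (x j) (r j) = {}"
    "(\<Union>i\<in>I. cball (x i) (r i)) \<subseteq> (\<Union>j\<in>J. cball (x j) (3 * r j))"
  using assms
proof (induction "card I" arbitrary: I thesis rule: less_induct)
  case less
  show ?case
  proof (cases "I = {}")
    case True
    show ?thesis by (rule less.prems(1)[of "{}"]) (use True in auto)
  next
    case False
    then have "Max (r ` I) \<in> r ` I" using less.prems(2) by (intro Max_in) auto
    then obtain k where "k \<in> I" "r k = Max (r ` I)" by auto
    then have k: "k \<in> I" "\<And>i. i \<in> I \<Longrightarrow> r i \<le> r k" using less.prems(2) by auto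
    define I' where "I' = {i \<in> I. i \<noteq> k \<and> cball (x i) (r i) \<inter> cball (x k) (r k) = {}}"
    have I': "finite I'" "card I' < card I" "I' \<subseteq> I"
      using less.prems(2) k(1) by (auto simp: I'_def intro!: psubset_card_mono)
    obtain J where J: "J \<subseteq> I'" "\<And>i j. i \<in> J \<Longrightarrow> j \<in> J \<Longrightarrow> i \<noteq> j \<Longrightarrow> cball (x i) (r i) \<inter> cball (x j) (r j) = {}"
      "(\<Union>i\<in>I'. cball (x i) (r i)) \<subseteq> (\<Union>j\<in>J. cball (x j) (3 * r j))"
      using less.hyps[OF I'(2) _ I'(1)] by blast
    show ?thesis
    proof (rule less.prems(1)[of "insert k J"])
      show "insert k J \<subseteq> I" using J(1) I'(3) k(1) by auto
      show "cball (x i) (r i) \<inter> cball (x j) (r j) = {}" if "i \<in> insert k J" "j \<in> insert k J" "i \<noteq> j" for i j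
        using that J(1,2) unfolding I'_def by blast
      show "(\<Union>i\<in>I. cball (x i) (r i)) \<subseteq> (\<Union>j\<in>insert k J. cball (x j) (3 * r j))"
      proof
        fix z assume "z \<in> (\<Union>i\<in>I. cball (x i) (r i))"
        then obtain i where i: "i \<in> I" "dist (x i) z \<le> r i" by auto
        show "z \<in> (\<Union>j\<in>insert k J. cball (x j) (3 * r j))"
        proof (cases "i \<in> I'")
          case True
          then have "z \<in> (\<Union>i\<in>I'. cball (x i) (r i))" using i by auto
          then show ?thesis using J(3) by blast
        next
          case False
          have "\<exists>v. dist (x i) v \<le> r i \<and> dist (x k) v \<le> r k"
            using False i unfolding I'_def by (cases "i = k") auto
          then obtain v where v: "dist (x i) v \<le> r i" "dist (x k) v \<le> r k" by blast
          have "dist (x k) z \<le> dist (x k) v + (dist (x i) v + dist (x i) z)"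
            by (metis dist_commute dist_triangle_le dist_triangle add_left_mono)
          also have "\<dots> \<le> 3 * r k" using v i k(2)[OF i(1)] by linarith
          finally show ?thesis by auto
        qed
      qed
    qed
  qed
qed

text \<open>A disjoint Vitali subfamily lowers the multiplicity at each point by at most one, so an
  \<open>N\<close>-fold cover contains \<open>N\<close> successive such subfamilies.\<close>

lemma integer_weighted_cover:
  fixes x :: "'i \<Rightarrow> 'a::metric_space" and n :: "'i \<Rightarrow> nat" and h :: "'i \<Rightarrow> real"
  assumes "finite I" and "\<And>i. i \<in> I \<Longrightarrow> 0 \<le> h i"
    and T: "\<And>J. J \<subseteq> I \<Longrightarrow> (UNIV :: 'a set) \<subseteq> (\<Union>j\<in>J. cball (x j) (3 * r j)) \<Longrightarrow> T \<le> (\<Sum>j\<in>J. h j)"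
    and "\<And>z. N \<le> (\<Sum>i\<in>I. if z \<in> cball (x i) (r i) then n i else 0)"
  shows "N * T \<le> (\<Sum>i\<in>I. n i * h i)"
  using assms(4)
proof (induction N arbitrary: n)
  case 0
  then show ?case using assms(2) by (auto intro!: sum_nonneg)
next
  case (Suc N)
  define I' where "I' = {i\<in>I. n i > 0}"
  have "finite I'" using assms(1) by (simp add: I'_def)
  then obtain J where J: "J \<subseteq> I'" "\<And>i j. i \<in> J \<Longrightarrow> j \<in> J \<Longrightarrow> i \<noteq> j \<Longrightarrow> cball (x i) (r i) \<inter> cball (x j) (r j) = {}"
    "(\<Union>i\<in>I'. cball (x i) (r i)) \<subseteq> (\<Union>j\<in>J. cball (x j) (3 * r j))"
    using finite_Vitali[where x=x and r=r] by blast
  have JI: "J \<subseteq> I" "finite J" using J(1) \<open>finite I'\<close> by (auto simp: I'_def intro: finite_subset)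
  have "UNIV \<subseteq> (\<Union>i\<in>I'. cball (x i) (r i))"
  proof
    fix z
    have "0 < (\<Sum>i\<in>I. if z \<in> cball (x i) (r i) then n i else 0)" using Suc.prems[of z] by linarith
    then obtain i where "i \<in> I" "0 < (if z \<in> cball (x i) (r i) then n i else 0)"
      by (metis (no_types, lifting) gr0I less_not_refl sum.neutral)
    then show "z \<in> (\<Union>i\<in>I'. cball (x i) (r i))" by (auto simp: I'_def split: if_splits)
  qed
  then have TJ: "T \<le> (\<Sum>j\<in>J. h j)" using T[OF JI(1)] J(3) by (metis order_trans)
  define n' where "n' i = (if i \<in> J then n i - 1 else n i)" for i
  have nn: "n i = n' i + (if i \<in> J then 1 else 0)" if "i \<in> I" for i
    using J(1) that by (auto simp: n'_def I'_def)
  have "N \<le> (\<Sum>i\<in>I. if z \<in> cball (x i) (r i) then n' i else 0)" for z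
  proof -
    have "Suc N \<le> (\<Sum>i\<in>I. (if z \<in> cball (x i) (r i) then n' i else 0) + (if i \<in> J \<and> z \<in> cball (x i) (r i) then 1 else 0))"
      by (rule order_trans[OF Suc.prems[of z]]) (intro sum_mono, use nn in auto)
    also have "\<dots> = (\<Sum>i\<in>I. if z \<in> cball (x i) (r i) then n' i else 0) + card {i\<in>I. i \<in> J \<and> z \<in> cball (x i) (r i)}"
      using assms(1) by (simp add: sum.distrib sum.If_cases Int_def)
    also have "card {i\<in>I. i \<in> J \<and> z \<in> cball (x i) (r i)} \<le> 1"
      unfolding One_nat_def
      by (subst card_le_Suc0_iff_eq) (use J(2) assms(1) in \<open>auto simp: disjoint_iff\<close>)
    finally show ?thesis by simp
  qed
  from Suc.IH[OF this] have "N * T \<le> (\<Sum>i\<in>I. n' i * h i)" .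
  then have "Suc N * T \<le> (\<Sum>i\<in>I. n' i * h i) + (\<Sum>j\<in>J. h j)" using TJ by (simp add: algebra_simps)
  also have "(\<Sum>j\<in>J. h j) = (\<Sum>i\<in>I. (if i \<in> J then 1 else 0) * h i)"
    using JI assms(1) by (simp add: if_distrib[of "\<lambda>a. a * _"] sum.If_cases Int_absorb1 Int_commute cong: if_cong)
  also have "(\<Sum>i\<in>I. n' i * h i) + \<dots> = (\<Sum>i\<in>I. n i * h i)"
    unfolding sum.distrib[symmetric] by (rule sum.cong) (auto simp: nn algebra_simps)
  finally show ?case .
qed

text \<open>Rounding \<open>N * c i\<close> up reduces to integer multiplicities. The excess cost is
  at most the sum of all \<open>h i\<close>, which becomes negligible after division by
  \<open>N\<close>.\<close>

lemma weighted_cover: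
  fixes x :: "'i \<Rightarrow> 'a::metric_space" and c :: "'i \<Rightarrow> real"
  assumes "finite I" and h: "\<And>i. i \<in> I \<Longrightarrow> 0 \<le> h i" and c: "\<And>i. i \<in> I \<Longrightarrow> 0 \<le> c i"
    and T: "\<And>J. J \<subseteq> I \<Longrightarrow> (UNIV :: 'a set) \<subseteq> (\<Union>j\<in>J. cball (x j) (3 * r j)) \<Longrightarrow> T \<le> (\<Sum>j\<in>J. h j)"
    and cov: "\<And>z. 1 \<le> (\<Sum>i\<in>I. if z \<in> cball (x i) (r i) then c i else 0)"
  shows "T \<le> (\<Sum>i\<in>I. c i * h i)"
proof (rule field_le_epsilon)
  fix e :: real assume "0 < e"
  let ?S = "\<Sum>i\<in>I. h i"
  obtain N :: nat where N: "N > 0" "?S / N < e"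
  proof -
    obtain N :: nat where "?S / e < N" using reals_Archimedean2 by blast
    moreover have "0 \<le> ?S" using h by (rule sum_nonneg)
    ultimately show ?thesis using \<open>0 < e\<close> that[of "Suc N"] by (simp add: field_simps)
  qed
  define n where "n i = nat \<lceil>N * c i\<rceil>" for i
  have n: "N * c i \<le> n i" "n i \<le> N * c i + 1" if "i \<in> I" for i
    using c[OF that] N(1) unfolding n_def by (auto simp: of_nat_ceiling)
  have "real N * T \<le> (\<Sum>i\<in>I. n i * h i)"
  proof (rule integer_weighted_cover[where h=h and x=x and r=r, OF assms(1) h T])
    fix z
    have "real N \<le> N * (\<Sum>i\<in>I. if z \<in> cball (x i) (r i) then c i else 0)"
      using cov[of z] N(1) by simp
    also have "\<dots> \<le> (\<Sum>i\<in>I. real (if z \<in> cball (x i) (r i) then n i else 0))"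
      unfolding sum_distrib_left by (rule sum_mono) (use n in auto)
    finally show "N \<le> (\<Sum>i\<in>I. if z \<in> cball (x i) (r i) then n i else 0)"
      by (simp flip: of_nat_sum)
  qed auto
  also have "\<dots> \<le> (\<Sum>i\<in>I. (N * c i + 1) * h i)"
    by (intro sum_mono mult_right_mono n h)
  also have "\<dots> = N * (\<Sum>i\<in>I. c i * h i) + ?S"
    by (simp add: algebra_simps sum.distrib sum_distrib_left)
  finally have "T \<le> (\<Sum>i\<in>I. c i * h i) + ?S / N" using N(1) by (simp add: field_simps)
  then show "T \<le> (\<Sum>i\<in>I. c i * h i) + e" using N(2) by linarith
qed

section \<open>A finitely additive Frostman measure\<close>

text \<open>Covers by balls of arbitrary size are still expensive: a ball too large for the scale
  \<open>\<delta>\<close> costs more than \<open>(\<delta> / 2) powr s\<close> by itself, and a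
  cover by smaller balls is admissible for the pre-measure, up to \<open>2 powr s\<close> for
  passing from radii to diameters.\<close>

lemma ball_cover_content_pos:
  assumes "0 < s" "hausdorff_measure s (UNIV :: 'a::metric_space set) \<noteq> 0"
  obtains c :: real where "0 < c"
    "\<And>J (x :: 'i \<Rightarrow> 'a) r. finite J \<Longrightarrow> (\<And>j. j \<in> J \<Longrightarrow> 0 < r j) \<Longrightarrow> UNIV \<subseteq> (\<Union>j\<in>J. cball (x j) (r j)) \<Longrightarrow> c \<le> (\<Sum>j\<in>J. r j powr s)"
proof -
  obtain \<delta> where \<delta>: "0 < \<delta>" "hausdorff_pre_measure s \<delta> (UNIV :: 'a set) \<noteq> 0"
  proof (rule ccontr)
    assume "\<not> thesis"
    then have "\<And>\<delta>. 0 < \<delta> \<Longrightarrow> hausdorff_pre_measure s \<delta> (UNIV :: 'a set) = 0" using that by blast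
    then show False using assms(2) by (simp add: hausdorff_measure_def)
  qed
  obtain e :: real where e: "0 < e" "ennreal e \<le> hausdorff_pre_measure s \<delta> (UNIV :: 'a set)"
  proof (cases "hausdorff_pre_measure s \<delta> (UNIV :: 'a set) = top")
    case True
    then show ?thesis using that[of 1] by simp
  next
    case False
    then show ?thesis using that[of "enn2real (hausdorff_pre_measure s \<delta> (UNIV :: 'a set))"] \<delta>(2)
      by (simp add: enn2real_positive_iff less_top zero_less_iff_neq_zero)
  qed
  define c where "c = min ((\<delta> / 2) powr s) (e / 2 powr s)"
  show ?thesis
  proof (rule that[of c])
    show "0 < c" using \<delta> e by (simp add: c_def)
    fix J and x :: "'i \<Rightarrow> 'a" and r
    assume J: "finite J" "\<And>j. j \<in> J \<Longrightarrow> 0 < r j" "UNIV \<subseteq> (\<Union>j\<in>J. cball (x j) (r j))"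
    show "c \<le> (\<Sum>j\<in>J. r j powr s)"
    proof (rule ccontr)
      assume "\<not> c \<le> (\<Sum>j\<in>J. r j powr s)"
      then have lt: "(\<Sum>j\<in>J. r j powr s) < (\<delta> / 2) powr s" "(\<Sum>j\<in>J. r j powr s) < e / 2 powr s"
        by (auto simp: c_def)
      have r2: "2 * r j \<le> \<delta>" if "j \<in> J" for j
      proof (rule ccontr)
        assume "\<not> 2 * r j \<le> \<delta>"
        then have "(\<delta> / 2) powr s \<le> r j powr s" using \<delta>(1) assms(1) by (intro powr_mono2) auto
        also have "\<dots> \<le> (\<Sum>j\<in>J. r j powr s)" by (rule member_le_sum[OF that _ J(1)]) simp
        finally show False using lt(1) by simp
      qed
      have dc: "diameter (cball (x j) (r j)) \<le> 2 * r j" if "j \<in> J" for j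
      proof (rule diameter_le_dist)
        fix u v assume "u \<in> cball (x j) (r j)" "v \<in> cball (x j) (r j)"
        then show "dist u v \<le> 2 * r j" using dist_triangle2[of u v "x j"] by (simp add: dist_commute)
      qed (use J(2)[OF that] in simp)
      have dd: "diameter (cball (x j) (r j)) \<le> \<delta>" if "j \<in> J" for j
        using dc[OF that] r2[OF that] by linarith
      have "ennreal e \<le> (\<Sum>j\<in>J. diam_pow s (cball (x j) (r j)))"
        by (rule order_trans[OF e(2) hausdorff_pre_measure_le_sum])
           (use J \<delta> dd in auto)
      also have "\<dots> \<le> (\<Sum>j\<in>J. ennreal ((2 * r j) powr s))"
        by (intro sum_mono diam_pow_le dc assms) auto
      also have "\<dots> = ennreal (\<Sum>j\<in>J. (2 * r j) powr s)" by (rule sum_ennreal) simp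
      finally have "e \<le> (\<Sum>j\<in>J. (2 * r j) powr s)"
        by (subst (asm) ennreal_le_iff) (auto intro: sum_nonneg)
      also have "\<dots> = 2 powr s * (\<Sum>j\<in>J. r j powr s)"
        unfolding sum_distrib_left by (rule sum.cong) (auto simp: powr_mult less_imp_le[OF J(2)])
      finally show False using lt(2) by (simp add: field_simps)
    qed
  qed
qed

text \<open>\<^typ>\<open>'a discrete \<Rightarrow>\<^sub>C real\<close> is the space of all bounded functions on \<open>'a\<close>.\<close>

definition bounded_indicator :: "'a set \<Rightarrow> ('a discrete \<Rightarrow>\<^sub>C real)" where
  "bounded_indicator A = Bcontfun (\<lambda>z. indicator A (of_discrete z))"

lemma bounded_indicator_apply [simp]: "apply_bcontfun (bounded_indicator A) z = indicator A (of_discrete z)"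
proof -
  have "(\<lambda>z. indicator A (of_discrete z) :: real) \<in> bcontfun"
  proof (rule bcontfun_normI)
    show "continuous_on UNIV (\<lambda>z. indicator A (of_discrete z) :: real)"
      by (simp add: continuous_on_open_vimage open_discrete)
  qed (auto simp: indicator_def)
  then show ?thesis by (simp add: bounded_indicator_def Bcontfun_inverse)
qed

text \<open>Linear programming duality between measures with a growth bound and weighted ball
  covers. A linear \<open>L\<close> below the covering cost \<open>p\<close> obeys the growth bound
  because one ball of weight 1 covers its own indicator, and it is positive because the empty cover
  dominates \<open>- bounded_indicator A\<close>. Equality at the constant 1 allows normalization
  once \<open>p\<close> is positive there.\<close>

lemma frostman_finitely_additive:
  assumes K: "compact (UNIV :: 'a::metric_space set)"
    and s: "0 < s" "hausdorff_measure s (UNIV :: 'a set) \<noteq> 0"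
  obtains m :: "'a::metric_space set \<Rightarrow> real" and C where "m UNIV = 1" "\<And>A. 0 \<le> m A"
    "\<And>A B. A \<inter> B = {} \<Longrightarrow> m (A \<union> B) = m A + m B"
    "\<And>x r. 0 < r \<Longrightarrow> m (cball x r) \<le> C * r powr s"
proof -
  \<comment> \<open>Weights vanish off the index set, so two weighted covers can be added over the
    union of their index sets.\<close>
  define adm where "adm I c \<longleftrightarrow> finite I \<and> (\<forall>i\<in>I. 0 < snd i) \<and> (\<forall>i. 0 \<le> c i) \<and> (\<forall>i. i \<notin> I \<longrightarrow> c i = 0)"
    for I and c :: "'a \<times> real \<Rightarrow> real"
  define w where "w I c z = (\<Sum>i\<in>I. if z \<in> cball (fst i) (snd i) then c i else 0)"
    for I and c :: "'a \<times> real \<Rightarrow> real" and z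
  define cost where "cost I c = (\<Sum>i\<in>I. c i * snd i powr s)" for I and c :: "'a \<times> real \<Rightarrow> real"
  define S where "S f = {cost I c | I c. adm I c \<and> (\<forall>z. f z \<le> w I c (of_discrete z))}"
    for f :: "'a discrete \<Rightarrow>\<^sub>C real"
  define p where "p f = Inf (S f)" for f
  have cost0: "0 \<le> cost I c" if "adm I c" for I c
    using that by (auto simp: cost_def adm_def intro!: sum_nonneg)
  have pl: "p f \<le> cost I c" if "adm I c" "\<And>z. f z \<le> w I c (of_discrete z)" for f :: "'a discrete \<Rightarrow>\<^sub>C real" and I c
    unfolding p_def by (rule cInf_lower) (use that cost0 in \<open>auto simp: S_def intro!: bdd_belowI[of _ 0]\<close>)
  obtain X where X: "finite X" "UNIV \<subseteq> (\<Union>x\<in>X. ball (x::'a) 1)"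
    using K unfolding compact_eq_totally_bounded by (metis zero_less_one)
  have ne: "S f \<noteq> {}" for f
  proof -
    define c where "c i = (if i \<in> X \<times> {1} then norm f else 0)" for i :: "'a \<times> real"
    have "adm (X \<times> {1}) c" using X(1) by (auto simp: adm_def c_def)
    moreover have "f z \<le> w (X \<times> {1}) c (of_discrete z)" for z
    proof -
      obtain x where x: "x \<in> X" "of_discrete z \<in> ball x 1" using X(2) by blast
      have "f z \<le> norm f" using norm_bounded[of f z] by simp
      also have "\<dots> = (if of_discrete z \<in> cball (fst (x,1::real)) (snd (x,1::real)) then c (x,1) else 0)"
        using x by (simp add: c_def)
      also have "\<dots> \<le> w (X \<times> {1}) c (of_discrete z)"
        unfolding w_def by (rule member_le_sum) (use x X in \<open>auto simp: c_def\<close>)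
      finally show ?thesis .
    qed
    ultimately show ?thesis by (auto simp: S_def)
  qed
  have pg: "b \<le> p f" if "\<And>I c. adm I c \<Longrightarrow> (\<And>z. f z \<le> w I c (of_discrete z)) \<Longrightarrow> b \<le> cost I c" for b and f :: "'a discrete \<Rightarrow>\<^sub>C real"
    unfolding p_def by (rule cInf_greatest[OF ne]) (use that in \<open>auto simp: S_def\<close>)
  have "sublinear p"
    unfolding sublinear_def
  proof (intro conjI allI impI)
    fix f g
    have "p (f + g) - p g \<le> p f"
    proof (rule pg)
      fix I c assume I: "adm I c" "\<And>z. f z \<le> w I c (of_discrete z)"
      have "p (f + g) - cost I c \<le> p g"
      proof (rule pg)
        fix I' c' assume I': "adm I' c'" "\<And>z. g z \<le> w I' c' (of_discrete z)"
        let ?c = "\<lambda>i. c i + c' i"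
        have w: "w (I \<union> I') ?c z = w I c z + w I' c' z" for z
        proof -
          have "w (I \<union> I') ?c z = w (I \<union> I') c z + w (I \<union> I') c' z"
            unfolding w_def sum.distrib[symmetric] by (rule sum.cong) auto
          also have "w (I \<union> I') c z = w I c z"
            unfolding w_def by (rule sum.mono_neutral_right) (use I(1) I'(1) in \<open>auto simp: adm_def\<close>)
          also have "w (I \<union> I') c' z = w I' c' z"
            unfolding w_def by (rule sum.mono_neutral_right) (use I(1) I'(1) in \<open>auto simp: adm_def\<close>)
          finally show ?thesis .
        qed
        have cost: "cost (I \<union> I') ?c = cost I c + cost I' c'"
        proof -
          have "cost (I \<union> I') ?c = cost (I \<union> I') c + cost (I \<union> I') c'"
            unfolding cost_def sum.distrib[symmetric] by (rule sum.cong) (auto simp: distrib_right)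
          also have "cost (I \<union> I') c = cost I c"
            unfolding cost_def by (rule sum.mono_neutral_right) (use I(1) I'(1) in \<open>auto simp: adm_def\<close>)
          also have "cost (I \<union> I') c' = cost I' c'"
            unfolding cost_def by (rule sum.mono_neutral_right) (use I(1) I'(1) in \<open>auto simp: adm_def\<close>)
          finally show ?thesis .
        qed
        have "p (f + g) \<le> cost (I \<union> I') ?c"
          by (rule pl) (use I I' in \<open>auto simp: adm_def w intro: add_mono\<close>)
        then show "p (f + g) - cost I c \<le> cost I' c'" by (simp add: cost)
      qed
      then show "p (f + g) - p g \<le> cost I c" by simp
    qed
    then show "p (f + g) \<le> p f + p g" by simp
  next
    fix a :: real and f assume a: "0 < a"
    have le: "p (a *\<^sub>R f) \<le> a * p f" if "0 < a" for a f
    proof -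
      have "p (a *\<^sub>R f) / a \<le> p f"
      proof (rule pg)
        fix I c assume I: "adm I c" "\<And>z. f z \<le> w I c (of_discrete z)"
        have w: "w I (\<lambda>i. a * c i) z = a * w I c z" for z
          unfolding w_def sum_distrib_left by (rule sum.cong) auto
        have "p (a *\<^sub>R f) \<le> cost I (\<lambda>i. a * c i)"
          by (rule pl) (use I that in \<open>auto simp: adm_def w\<close>)
        also have "\<dots> = a * cost I c" by (simp add: cost_def sum_distrib_left mult.assoc)
        finally show "p (a *\<^sub>R f) / a \<le> cost I c" using that by (simp add: field_simps)
      qed
      then show ?thesis using that by (simp add: field_simps)
    qed
    have "p (inverse a *\<^sub>R (a *\<^sub>R f)) \<le> inverse a * p (a *\<^sub>R f)" using a by (intro le) auto
    then have "a * p f \<le> p (a *\<^sub>R f)" using a by (simp add: field_simps)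
    with le[OF a, of f] show "p (a *\<^sub>R f) = a * p f" by simp
  qed
  then obtain L where L: "linear L" "L \<le> p" "L (bounded_indicator UNIV) = p (bounded_indicator UNIV)"
    by (rule hahn_banach_sublinear)
  obtain c where c: "0 < c" "\<And>J (x :: 'a \<times> real \<Rightarrow> 'a) r. finite J \<Longrightarrow> (\<And>j. j \<in> J \<Longrightarrow> 0 < r j) \<Longrightarrow> UNIV \<subseteq> (\<Union>j\<in>J. cball (x j) (r j)) \<Longrightarrow> c \<le> (\<Sum>j\<in>J. r j powr s)"
    by (rule ball_cover_content_pos[OF s, where 'i="'a \<times> real"]) (erule that, blast)
  \<comment> \<open>The tripled radii of the Vitali subfamilies cost the factor
    \<open>3 powr s\<close>.\<close>
  have "c / 3 powr s \<le> p (bounded_indicator UNIV)"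
  proof (rule pg)
    fix I d assume I: "adm I d" "\<And>z. bounded_indicator UNIV z \<le> w I d (of_discrete z)"
    show "c / 3 powr s \<le> cost I d"
      unfolding cost_def
    proof (rule weighted_cover[where x=fst and r=snd])
      fix J assume J: "J \<subseteq> I" "UNIV \<subseteq> (\<Union>j\<in>J. cball (fst j :: 'a) (3 * snd j))"
      have pos: "0 < snd j" if "j \<in> J" for j using that J I by (auto simp: adm_def)
      have "c \<le> (\<Sum>j\<in>J. (3 * snd j) powr s)"
        by (rule c(2)[OF _ _ J(2)]) (use J I pos in \<open>auto simp: adm_def intro: finite_subset\<close>)
      also have "\<dots> = 3 powr s * (\<Sum>j\<in>J. snd j powr s)"
        unfolding sum_distrib_left by (rule sum.cong) (auto simp: powr_mult less_imp_le[OF pos])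
      finally show "c / 3 powr s \<le> (\<Sum>j\<in>J. snd j powr s)" by (simp add: field_simps)
    next
      fix z show "1 \<le> (\<Sum>i\<in>I. if z \<in> cball (fst i) (snd i) then d i else 0)"
        using I(2)[of "discrete z"] by (simp add: w_def discrete_inverse)
    qed (use I in \<open>auto simp: adm_def\<close>)
  qed
  moreover have "0 < c / 3 powr s" using c by simp
  ultimately have p1: "0 < p (bounded_indicator UNIV)" by linarith
  define P where "P = p (bounded_indicator UNIV)"
  have P: "0 < P" using p1 by (simp add: P_def)
  show ?thesis
  proof (rule that[of "\<lambda>A. L (bounded_indicator A) / P" "1 / P"])
    show "L (bounded_indicator UNIV) / P = 1" using P L(3) by (simp add: P_def)
    show "0 \<le> L (bounded_indicator A) / P" for A
    proof -
      have "L (- bounded_indicator A) \<le> p (- bounded_indicator A)" using L(2) by (simp add: le_fun_def)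
      also have "\<dots> \<le> cost {} (\<lambda>_. 0)" by (rule pl) (auto simp: adm_def w_def)
      finally have "0 \<le> L (bounded_indicator A)" using L(1) by (simp add: linear_neg cost_def)
      then show ?thesis using P by simp
    qed
    show "L (bounded_indicator (A \<union> B)) / P = L (bounded_indicator A) / P + L (bounded_indicator B) / P" if "A \<inter> B = {}" for A B
    proof -
      have "bounded_indicator (A \<union> B) = bounded_indicator A + bounded_indicator B"
        by (rule bcontfun_eqI) (use that in \<open>auto simp: indicator_def\<close>)
      then show ?thesis using L(1) by (simp add: linear_add add_divide_distrib)
    qed
    show "L (bounded_indicator (cball x r)) / P \<le> 1 / P * r powr s" if "0 < r" for x r
    proof -
      define c where "c i = (if i = (x,r) then 1 else 0::real)" for i
      have "L (bounded_indicator (cball x r)) \<le> p (bounded_indicator (cball x r))" using L(2) by (simp add: le_fun_def)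
      also have "\<dots> \<le> cost {(x,r)} c"
        by (rule pl) (use that in \<open>auto simp: adm_def w_def c_def indicator_def\<close>)
      finally show ?thesis using P by (simp add: cost_def c_def divide_right_mono)
    qed
  qed
qed

section \<open>Discrete mass systems\<close>

locale finitely_additive =
  fixes m :: "'a set \<Rightarrow> real"
  assumes nonneg: "0 \<le> m A"
    and add: "A \<inter> B = {} \<Longrightarrow> m (A \<union> B) = m A + m B"
begin

lemma empty: "m {} = 0"
  using add[of "{}" "{}"] by simp

lemma mono: "A \<subseteq> B \<Longrightarrow> m A \<le> m B"
  using add[of A "B - A"] nonneg[of "B - A"] by (simp add: Un_absorb1)

lemma subadd: "m (A \<union> B) \<le> m A + m B"
  using add[of A "B - A"] mono[of "B - A" B] by simp

lemma subadd_UN: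
  assumes "finite I"
  shows "m (\<Union>i\<in>I. A i) \<le> (\<Sum>i\<in>I. m (A i))"
  using assms
proof induction
  case (insert i I)
  then show ?case using subadd[of "A i" "\<Union>i\<in>I. A i"] by simp
qed (simp add: empty)

lemma add_UN:
  assumes "finite I" "\<And>i j. i \<in> I \<Longrightarrow> j \<in> I \<Longrightarrow> i \<noteq> j \<Longrightarrow> A i \<inter> A j = {}"
  shows "m (\<Union>i\<in>I. A i) = (\<Sum>i\<in>I. m (A i))"
  using assms
proof induction
  case (insert i I)
  then have "A i \<inter> (\<Union>i\<in>I. A i) = {}" by fastforce
  then have "m (A i \<union> (\<Union>i\<in>I. A i)) = m (A i) + m (\<Union>i\<in>I. A i)" by (rule add)
  with insert show ?case by simp
qed (simp add: empty)

end

section \<open>From finitely additive measures to pieces and point masses\<close>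

lemma compact_enumerated_net:
  assumes "compact (UNIV :: 'a::metric_space set)" "0 < (e::real)"
  obtains x :: "nat \<Rightarrow> 'a::metric_space" and N where "\<And>z. \<exists>i<N. dist (x i) z < e"
proof -
  obtain X where X: "finite X" "UNIV \<subseteq> (\<Union>x\<in>X. ball (x::'a) e)"
    using assms unfolding compact_eq_totally_bounded by metis
  obtain x where x: "bij_betw x {0..<card X} X" using ex_bij_betw_nat_finite[OF X(1)] by blast
  show ?thesis
  proof (rule that[of "card X" x])
    fix z
    obtain y where "y \<in> X" "dist y z < e" using X(2) by force
    then show "\<exists>i<card X. dist (x i) z < e" using x unfolding bij_betw_def by force
  qed
qed

text \<open>Balls of a common radius become disjoint when slightly larger open balls of smaller
  index are removed from them, and they stay closed. What is lost lies in thin annuli around the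
  centres, so the radius is chosen where these carry little mass.\<close>

lemma disjoint_closed_pieces:
  fixes R \<epsilon> :: real and m :: "'a::metric_space set \<Rightarrow> real"
  assumes K: "compact (UNIV :: 'a set)" and R: "0 < R" "0 < \<epsilon>" and "finitely_additive m"
  shows "\<exists>(P :: nat \<Rightarrow> 'a set) N x. (\<forall>i. closed (P i)) \<and> (\<forall>i j. i \<noteq> j \<longrightarrow> P i \<inter> P j = {}) \<and>
    (\<forall>i. P i \<subseteq> cball (x i) R) \<and> m (- (\<Union>i<N. P i)) \<le> \<epsilon>"
proof -
  interpret finitely_additive m by fact
  obtain x :: "nat \<Rightarrow> 'a" and N where x: "\<And>z. \<exists>i<N. dist (x i) z < R / 2"
    using compact_enumerated_net[OF K, of "R / 2"] R by (metis half_gt_zero)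
  obtain L :: nat where L: "N * m UNIV / \<epsilon> < L" using reals_Archimedean2 by blast
  moreover have "0 \<le> N * m UNIV / \<epsilon>" using nonneg R by simp
  ultimately have L0: "0 < real L" by linarith
  define h where "h = R / (2 * L)"
  have h: "0 < h" "L * h = R / 2" using L0 R by (auto simp: h_def)
  define a where "a k = R / 2 + real k * h" for k
  define A where "A i k = {z. a k < dist (x i) z \<and> dist (x i) z < a (Suc k)}" for i k
  \<comment> \<open>For each \<open>i\<close> the \<open>L\<close> annuli are disjoint, so some radius has annuli of small total mass.\<close>
  have "\<exists>k<L. m (\<Union>i<N. A i k) \<le> \<epsilon>"
  proof (rule ccontr)
    assume "\<not> ?thesis"
    then have "(\<Sum>k<L. \<epsilon>) \<le> (\<Sum>k<L. m (\<Union>i<N. A i k))" by (intro sum_mono) (auto simp: not_le less_imp_le)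
    also have "\<dots> \<le> (\<Sum>k<L. \<Sum>i<N. m (A i k))" by (intro sum_mono subadd_UN) auto
    also have "\<dots> = (\<Sum>i<N. \<Sum>k<L. m (A i k))" by (rule sum.swap)
    also have "\<dots> = (\<Sum>i<N. m (\<Union>k<L. A i k))"
    proof (intro sum.cong refl add_UN[symmetric])
      fix i k k' :: nat assume "k \<noteq> k'"
      have "A i k \<inter> A i k' = {}" if "k < k'" for k k'
      proof -
        have "real (Suc k) * h \<le> real k' * h" using that h(1) by (intro mult_right_mono) auto
        then have "a (Suc k) \<le> a k'" unfolding a_def by simp
        then show ?thesis by (force simp: A_def)
      qed
      then show "A i k \<inter> A i k' = {}" using \<open>k \<noteq> k'\<close> by (metis Int_commute nat_neq_iff)
    qed auto
    also have "\<dots> \<le> (\<Sum>i<N. m UNIV)" by (intro sum_mono mono) auto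
    finally show False using L R by (simp add: field_simps)
  qed
  then obtain k where k: "k < L" "m (\<Union>i<N. A i k) \<le> \<epsilon>" by blast
  have "real (Suc k) * h \<le> L * h" using k h by (intro mult_right_mono) auto
  then have ak: "R / 2 \<le> a k" "a k < a (Suc k)" "a k \<le> R" using h by (auto simp: a_def distrib_right)
  define P where "P i = cball (x i) (a k) \<inter> (\<Inter>j<i. - ball (x j) (a (Suc k)))" for i
  show ?thesis
  proof (intro exI[of _ P] exI[of _ N] exI[of _ x] conjI allI impI)
    show "closed (P i)" for i unfolding P_def by (intro closed_Int closed_cball closed_INT ballI) (simp add: closed_Compl)
    have "P i \<inter> P j = {}" if "i < j" for i j
    proof (rule equals0I)
      fix z assume "z \<in> P i \<inter> P j"
      then have "dist (x i) z \<le> a k" "\<not> dist (x i) z < a (Suc k)" using that by (auto simp: P_def)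
      then show False using ak by linarith
    qed
    then show "P i \<inter> P j = {}" if "i \<noteq> j" for i j using that by (metis Int_commute nat_neq_iff)
    show "P i \<subseteq> cball (x i) R" for i using ak by (auto simp: P_def)
    have "- (\<Union>i<N. P i) \<subseteq> (\<Union>i<N. A i k)"
    proof
      fix z assume z: "z \<in> - (\<Union>i<N. P i)"
      obtain i0 where i0: "i0 < N" "dist (x i0) z < R / 2" using x by blast
      then have Q: "dist (x i0) z < a (Suc k)" using ak by linarith
      \<comment> \<open>At the first centre whose enlarged ball contains \<open>z\<close> nothing
        has been removed at \<open>z\<close>, so \<open>z\<close> can be missing from
        \<open>P i\<close> only by lying in the annulus.\<close>
      define i where "i = (LEAST i. dist (x i) z < a (Suc k))"
      have i: "dist (x i) z < a (Suc k)" unfolding i_def by (rule LeastI[of "\<lambda>i. dist (x i) z < a (Suc k)", OF Q])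
      have "i \<le> i0" unfolding i_def by (rule Least_le[of "\<lambda>i. dist (x i) z < a (Suc k)", OF Q])
      then have "i < N" using i0 by linarith
      have "\<not> dist (x j) z < a (Suc k)" if "j < i" for j
        using that unfolding i_def by (rule not_less_Least)
      moreover have "z \<notin> P i" using z \<open>i < N\<close> by blast
      ultimately have "\<not> dist (x i) z \<le> a k" by (auto simp: P_def)
      then show "z \<in> (\<Union>i<N. A i k)" using i \<open>i < N\<close> by (auto simp: A_def intro!: bexI[of _ i])
    qed
    then show "m (- (\<Union>i<N. P i)) \<le> \<epsilon>" using mono k(2) by (metis order_trans)
  qed
qed

text \<open>The weights \<open>w n\<close> on \<open>F n\<close> approximate a measure on \<open>K\<close> down to scale \<open>2\<^sup>-\<^sup>n\<close> and live on the
  pieces \<open>P l i\<close> of the levels \<open>l \<le> n\<close>. The pieces of level \<open>l\<close> have mass \<open>O(2\<^sup>-\<^sup>l)\<close> but no prescribed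
  diameter, which lets the case \<open>s = 0\<close> include Cantor schemes.\<close>

definition mass_system ::
  "real \<Rightarrow> (nat \<Rightarrow> nat \<Rightarrow> 'a::metric_space set) \<Rightarrow> (nat \<Rightarrow> nat) \<Rightarrow> (nat \<Rightarrow> 'a set) \<Rightarrow> (nat \<Rightarrow> 'a \<Rightarrow> real) \<Rightarrow> real \<Rightarrow> bool" where
  "mass_system s P N F w C \<longleftrightarrow>
    (\<forall>l i. i < N l \<longrightarrow> closed (P l i)) \<and>
    (\<forall>l i j. i < N l \<longrightarrow> j < N l \<longrightarrow> i \<noteq> j \<longrightarrow> P l i \<inter> P l j = {}) \<and>
    (\<forall>n. finite (F n) \<and> (\<forall>z. 0 \<le> w n z) \<and> 1 / 2 \<le> sum (w n) (F n) \<and> sum (w n) (F n) \<le> 1 \<and>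
      (\<forall>z\<in>F n. \<forall>l\<le>n. \<exists>i<N l. z \<in> P l i) \<and>
      (\<forall>l\<le>n. \<forall>i<N l. sum (w n) (F n \<inter> P l i) \<le> C * (1/2) ^ l) \<and>
      (\<forall>x r. (1/2) ^ n \<le> r \<longrightarrow> sum (w n) (F n \<inter> cball x r) \<le> C * r powr s))"

text \<open>The mass of each cell of a partition of \<open>E\<close> is placed at a point of that
  cell. Points of one cell are less than \<open>2 * \<delta>\<close> apart, whence the radius
  \<open>3 * r\<close> for \<open>r \<ge> \<delta>\<close>.\<close>

lemma finitely_additive_discretization:
  fixes m :: "'a::metric_space set \<Rightarrow> real"
  assumes K: "compact (UNIV :: 'a set)" and "0 < (\<delta>::real)" and "finitely_additive m"
  shows "\<exists>F w. finite F \<and> F \<subseteq> E \<and> (\<forall>z. 0 \<le> w z) \<and> sum w F = m E \<and>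
    (\<forall>x r. \<delta> \<le> r \<longrightarrow> sum w (F \<inter> cball x r) \<le> m (cball x (3 * r)))"
proof -
  interpret finitely_additive m by fact
  obtain y :: "nat \<Rightarrow> 'a" and M where y: "\<And>z. \<exists>i<M. dist (y i) z < \<delta>"
    using compact_enumerated_net[OF assms(1,2)] by metis
  define lab where "lab z = (LEAST i. dist (y i) z < \<delta>)" for z
  have lab: "lab z < M" "dist (y (lab z)) z < \<delta>" for z
  proof -
    obtain i where "i < M" "dist (y i) z < \<delta>" using y by blast
    then show "lab z < M" "dist (y (lab z)) z < \<delta>"
      unfolding lab_def by (auto intro: LeastI Least_le[THEN le_less_trans])
  qed
  define rep where "rep i = (SOME z. z \<in> E \<and> lab z = i)" for i
  have rep: "rep i \<in> E" "lab (rep i) = i" if "i \<in> lab ` E" for i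
    using someI_ex[of "\<lambda>z. z \<in> E \<and> lab z = i"] that unfolding rep_def by blast+
  define F where "F = rep ` lab ` E"
  define Q where "Q z = {z'\<in>E. lab z' = lab z}" for z
  have finF: "finite F" unfolding F_def using lab(1)
    by (intro finite_imageI finite_subset[of "lab ` E" "{..<M}"]) auto
  have disj: "Q z \<inter> Q z' = {}" if "z \<in> F" "z' \<in> F" "z \<noteq> z'" for z z'
    using that rep by (auto simp: F_def Q_def)
  have sumw: "sum (\<lambda>z. m (Q z)) G = m (\<Union>z\<in>G. Q z)" if "G \<subseteq> F" for G
    by (rule add_UN[symmetric]) (use that finF disj in \<open>auto intro: finite_subset\<close>)
  show ?thesis
  proof (intro exI[of _ F] exI[of _ "\<lambda>z. m (Q z)"] conjI allI impI)
    show "F \<subseteq> E" using rep by (auto simp: F_def)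
    show "sum (\<lambda>z. m (Q z)) F = m E"
    proof -
      have "(\<Union>z\<in>F. Q z) = E" using rep by (force simp: F_def Q_def)
      then show ?thesis using sumw[of F] by simp
    qed
    fix x r assume r: "\<delta> \<le> r"
    have "(\<Union>z\<in>F \<inter> cball x r. Q z) \<subseteq> cball x (3 * r)"
    proof
      fix z' assume "z' \<in> (\<Union>z\<in>F \<inter> cball x r. Q z)"
      then obtain z where z: "dist x z \<le> r" "lab z' = lab z" by (auto simp: Q_def)
      have "dist x z' \<le> dist x z + (dist (y (lab z)) z + dist (y (lab z')) z')"
        unfolding z(2) by (metis add_left_mono dist_commute dist_triangle3 dist_triangle_le)
      also have "\<dots> \<le> 3 * r" using z(1) lab(2)[of z] lab(2)[of z'] r by linarith
      finally show "z' \<in> cball x (3 * r)" by simp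
    qed
    then show "sum (\<lambda>z. m (Q z)) (F \<inter> cball x r) \<le> m (cball x (3 * r))"
      using sumw[of "F \<inter> cball x r"] mono by simp
  qed (use finF nonneg in auto)
qed

lemma mass_system_of_hausdorff_measure:
  assumes K: "compact (UNIV :: 'a::metric_space set)"
    and s: "0 < s" "hausdorff_measure s (UNIV :: 'a set) \<noteq> 0"
  shows "\<exists>(P :: nat \<Rightarrow> nat \<Rightarrow> 'a set) N F w C. mass_system s P N F w C"
proof -
  obtain m :: "'a set \<Rightarrow> real" and C where m: "m UNIV = 1" "\<And>A. 0 \<le> m A"
    "\<And>A B. A \<inter> B = {} \<Longrightarrow> m (A \<union> B) = m A + m B"
    "\<And>x r. 0 < r \<Longrightarrow> m (cball x r) \<le> C * r powr s"
    using frostman_finitely_additive[OF K s] by blast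
  interpret finitely_additive m by unfold_locales (use m in auto)
  \<comment> \<open>The radius at which the growth bound \<open>r powr s\<close> equals
    \<open>(1/2) ^ l\<close>, the order of mass allowed for a piece of level
    \<open>l\<close>.\<close>
  define R where "R l = (1/2) powr (real l / s)" for l
  have R: "0 < R l" "R l powr s = (1/2) ^ l" for l
    using s by (auto simp: R_def powr_powr powr_realpow)
  have R_anti: "R n \<le> R l" if "l \<le> n" for l n
    unfolding R_def using that s by (intro powr_mono') (auto simp: divide_right_mono)
  define Q where "Q l P N x \<longleftrightarrow> (\<forall>i. closed (P i)) \<and> (\<forall>i j. i \<noteq> j \<longrightarrow> P i \<inter> P j = {}) \<and>
    (\<forall>i. P i \<subseteq> cball (x i) (R l)) \<and> m (- (\<Union>i<N. P i)) \<le> (1/2) ^ (l + 2)"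
    for l N and P :: "nat \<Rightarrow> 'a set" and x
  have "\<exists>P N x. Q l P N x" for l
    unfolding Q_def by (rule disjoint_closed_pieces[OF K R(1) _ finitely_additive_axioms]) simp
  then obtain P N x where "\<And>l. Q l (P l) (N l) (x l)" by metis
  then have P: "\<And>l i. closed (P l i)" "\<And>l i j. i \<noteq> j \<Longrightarrow> P l i \<inter> P l j = {}"
    "\<And>l i. P l i \<subseteq> cball (x l i) (R l)" "\<And>l. m (- (\<Union>i<N l. P l i)) \<le> (1/2) ^ (l + 2)"
    unfolding Q_def by simp_all
  \<comment> \<open>The points having a piece at every level up to \<open>n\<close>. The losses
    \<open>(1/2) ^ (l + 2)\<close> sum to less than 1/2, so at least half of the mass
    remains.\<close>
  define E where "E n = (\<Inter>l\<le>n. \<Union>i<N l. P l i)" for n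
  have E: "1 / 2 \<le> m (E n)" for n
  proof -
    have "m (- E n) \<le> (\<Sum>l\<le>n. m (- (\<Union>i<N l. P l i)))"
      unfolding E_def Compl_INT by (rule subadd_UN) simp
    also have "\<dots> \<le> (\<Sum>l\<le>n. (1/2) ^ (l + 2))" by (intro sum_mono P)
    also have "\<dots> = 1 / 2 - (1/2) ^ (n + 2)" by (induction n) (auto simp: field_simps)
    also have "\<dots> \<le> 1 / 2" by simp
    finally show ?thesis using add[of "E n" "- E n"] m(1) by (simp add: Compl_partition)
  qed
  \<comment> \<open>Fine enough both for balls of radius at least \<open>(1/2) ^ n\<close> and for
    the radii \<open>R l\<close> with \<open>l \<le> n\<close> of the balls containing the
    pieces.\<close>
  define \<delta> where "\<delta> n = min ((1/2) ^ n) (R n)" for n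
  have \<delta>: "0 < \<delta> n" for n using R by (simp add: \<delta>_def)
  define Q' where "Q' n F w \<longleftrightarrow> finite F \<and> F \<subseteq> E n \<and> (\<forall>z. 0 \<le> w z) \<and> sum w F = m (E n) \<and>
    (\<forall>x r. \<delta> n \<le> r \<longrightarrow> sum w (F \<inter> cball x r) \<le> m (cball x (3 * r)))" for n F w
  have "\<exists>F w. Q' n F w" for n
    unfolding Q'_def by (rule finitely_additive_discretization[OF K \<delta>[of n] finitely_additive_axioms])
  then obtain F w where "\<And>n. Q' n (F n) (w n)" by metis
  then have F: "\<And>n. finite (F n)" "\<And>n. F n \<subseteq> E n" "\<And>n z. 0 \<le> w n z" "\<And>n. sum (w n) (F n) = m (E n)"
    "\<And>n x r. \<delta> n \<le> r \<Longrightarrow> sum (w n) (F n \<inter> cball x r) \<le> m (cball x (3 * r))"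
    unfolding Q'_def by simp_all
  have ball: "sum (w n) (F n \<inter> cball x r) \<le> C * 3 powr s * r powr s" if "\<delta> n \<le> r" for n x r
  proof -
    have "0 < r" using \<delta> that by (rule less_le_trans)
    then show ?thesis using F(5)[OF that, of x] m(4)[of "3 * r" x] by (simp add: powr_mult mult.assoc)
  qed
  have "mass_system s P N F w (C * 3 powr s)"
    unfolding mass_system_def
  proof (intro conjI allI impI ballI)
    fix n
    show "sum (w n) (F n) \<le> 1" using F(4) mono[of "E n" UNIV] m(1) by simp
    show "1 / 2 \<le> sum (w n) (F n)" using F(4) E by simp
    show "\<exists>i<N l. z \<in> P l i" if "z \<in> F n" "l \<le> n" for z l
      using that F(2)[of n] by (force simp: E_def)
    show "sum (w n) (F n \<inter> P l i) \<le> C * 3 powr s * (1/2) ^ l" if "l \<le> n" "i < N l" for l i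
    proof -
      have "sum (w n) (F n \<inter> P l i) \<le> sum (w n) (F n \<inter> cball (x l i) (R l))"
        using F(1,3) P(3)[of l i] by (intro sum_mono2) (simp_all, blast)
      also have "\<dots> \<le> C * 3 powr s * R l powr s"
        by (rule ball) (use R_anti[OF that(1)] in \<open>auto simp: \<delta>_def\<close>)
      finally show ?thesis by (simp only: R)
    qed
    show "sum (w n) (F n \<inter> cball x r) \<le> C * 3 powr s * r powr s" if "(1/2) ^ n \<le> r" for x r
      by (rule ball) (use that in \<open>auto simp: \<delta>_def\<close>)
  qed (use P F in auto)
  then show ?thesis by blast
qed

section \<open>Cantor schemes in uncountable compact spaces\<close>

text \<open>Take a condensation point \<open>a\<close>: every ball around \<open>a\<close> meets
  \<open>A\<close> in an uncountable set, while the complements of shrinking balls exhaust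
  \<open>A\<close> up to the point \<open>a\<close>, so one of these is uncountable as well.\<close>

lemma uncountable_compact_split:
  assumes "closed A" "uncountable A" "compact (UNIV :: 'a::metric_space set)"
  obtains B C :: "'a::metric_space set" where "closed B" "closed C" "uncountable B" "uncountable C" "B \<subseteq> A" "C \<subseteq> A" "B \<inter> C = {}"
proof -
  have cond: "\<exists>a\<in>D. \<forall>r>0. uncountable (D \<inter> cball a r)" if D: "closed D" "uncountable D" for D :: "'a set"
  proof (rule ccontr)
    assume "\<not> ?thesis"
    then have "\<forall>a\<in>D. \<exists>r>0. countable (D \<inter> cball a r)" by blast
    then obtain r where r: "\<And>a. a \<in> D \<Longrightarrow> 0 < r a" "\<And>a. a \<in> D \<Longrightarrow> countable (D \<inter> cball a (r a))" by metis
    have "compact D" using compact_Int_closed[OF assms(3) D(1)] by simp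
    then obtain T where T: "T \<subseteq> D" "finite T" "D \<subseteq> (\<Union>a\<in>T. ball a (r a))"
    proof (rule compactE_image[of D D "\<lambda>a. ball a (r a)"])
      show "D \<subseteq> (\<Union>a\<in>D. ball a (r a))" using r(1) by force
    qed (simp_all add: that)
    have "D \<subseteq> (\<Union>a\<in>T. D \<inter> cball a (r a))"
    proof
      fix z assume "z \<in> D"
      then obtain a where "a \<in> T" "z \<in> ball a (r a)" using T(3) by blast
      then show "z \<in> (\<Union>a\<in>T. D \<inter> cball a (r a))" using \<open>z \<in> D\<close> by (auto intro!: bexI[of _ a])
    qed
    moreover have "countable (\<Union>a\<in>T. D \<inter> cball a (r a))"
      using T r(2) by (intro countable_UN[OF countable_finite]) auto
    ultimately show False using D(2) countable_subset by blast
  qed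
  obtain a where a: "a \<in> A" "\<And>r. 0 < r \<Longrightarrow> uncountable (A \<inter> cball a r)"
    using cond[OF assms(1,2)] by blast
  have "\<exists>n. uncountable (A - ball a (1 / Suc n))"
  proof (rule ccontr)
    assume "\<not> ?thesis"
    then have "countable (\<Union>n. A - ball a (1 / Suc n))" by blast
    moreover have "A \<subseteq> insert a (\<Union>n. A - ball a (1 / Suc n))"
    proof
      fix z assume "z \<in> A"
      show "z \<in> insert a (\<Union>n. A - ball a (1 / Suc n))"
      proof (cases "z = a")
        case False
        then obtain n where "1 / real (Suc n) < dist a z"
          using reals_Archimedean[of "dist a z"] by (auto simp: inverse_eq_divide)
        then have "z \<in> A - ball a (1 / Suc n)" using \<open>z \<in> A\<close> by simp
        then show ?thesis by blast
      qed simp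
    qed
    ultimately show False using assms(2) by (metis countable_insert countable_subset)
  qed
  then obtain n where n: "uncountable (A - ball a (1 / Suc n))" by blast
  show ?thesis
  proof (rule that[of "A \<inter> cball a (1 / (2 * Suc n))" "A - ball a (1 / Suc n)"])
    show "closed (A - ball a (1 / Suc n))" using assms(1) by (intro closed_Diff) auto
    show "(A \<inter> cball a (1 / (2 * Suc n))) \<inter> (A - ball a (1 / Suc n)) = {}"
    proof -
      have "1 / (2 * real (Suc n)) < 1 / real (Suc n)" by (simp add: field_simps)
      then show ?thesis by auto
    qed
  qed (use assms(1) a n in auto)
qed

lemma mass_system_of_uncountable:
  assumes K: "compact (UNIV :: 'a::metric_space set)" "uncountable (UNIV :: 'a set)"
  shows "\<exists>(P :: nat \<Rightarrow> nat \<Rightarrow> 'a set) N F w C. mass_system 0 P N F w C"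
proof -
  have "\<forall>A. \<exists>B C. closed A \<and> uncountable (A::'a set) \<longrightarrow>
     closed B \<and> closed C \<and> uncountable B \<and> uncountable C \<and> B \<subseteq> A \<and> C \<subseteq> A \<and> B \<inter> C = {}"
    using uncountable_compact_split[OF _ _ K(1)] by metis
  then obtain f g where fg: "\<And>A::'a set. closed A \<Longrightarrow> uncountable A \<Longrightarrow>
     closed (f A) \<and> closed (g A) \<and> uncountable (f A) \<and> uncountable (g A) \<and> f A \<subseteq> A \<and> g A \<subseteq> A \<and> f A \<inter> g A = {}"
    by metis
  \<comment> \<open>A binary tree of closed uncountable sets: node \<open>i\<close> of level
    \<open>l + 1\<close> is a child of node \<open>i div 2\<close>, and the indices
    \<open>i < 2 ^ l\<close> enumerate level \<open>l\<close>.\<close>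
  define D where "D = rec_nat (\<lambda>i::nat. UNIV :: 'a set) (\<lambda>l S i. if even i then f (S (i div 2)) else g (S (i div 2)))"
  have D0: "D 0 i = UNIV" and DS: "D (Suc l) i = (if even i then f (D l (i div 2)) else g (D l (i div 2)))" for l i
    by (simp_all add: D_def)
  have cu: "closed (D l i) \<and> uncountable (D l i)" for l i
    by (induction l arbitrary: i) (use K fg in \<open>auto simp: D0 DS\<close>)
  have sub: "D (Suc l) i \<subseteq> D l (i div 2)" for l i using fg cu[of l "i div 2"] by (simp add: DS)
  have sub': "D (l + k) i \<subseteq> D l (i div 2 ^ k)" for l k i
  proof (induction k arbitrary: i)
    case (Suc k)
    have "D (l + Suc k) i \<subseteq> D (l + k) (i div 2)" using sub[of "l + k" i] by simp
    also have "\<dots> \<subseteq> D l (i div 2 div 2 ^ k)" by (rule Suc)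
    finally show ?case by (simp add: div_mult2_eq)
  qed simp
  have disj: "D l i \<inter> D l j = {}" if "i < 2 ^ l" "j < 2 ^ l" "i \<noteq> j" for l i j
    using that
  proof (induction l arbitrary: i j)
    case (Suc l)
    show ?case
    proof (cases "i div 2 = j div 2")
      case True
      then have "even i \<noteq> even j" using Suc.prems(3) by (metis div_mult_mod_eq mod2_eq_if)
      then show ?thesis using True fg[of "D l (j div 2)"] cu[of l "j div 2"] by (auto simp: DS Int_commute)
    next
      case False
      then have "D l (i div 2) \<inter> D l (j div 2) = {}" using Suc.prems by (intro Suc.IH) auto
      then show ?thesis using sub[of l i] sub[of l j] by blast
    qed
  qed simp
  define y where "y n i = (SOME z. z \<in> D n i)" for n i
  have y: "y n i \<in> D n i" for n i
    using cu[of n i] unfolding y_def by (metis countable_empty some_in_eq)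
  define F where "F n = y n ` {..<2 ^ n}" for n
  have inj: "inj_on (y n) {..<2 ^ n}" for n
    using disj y by (intro inj_onI) (metis disjoint_iff lessThan_iff)
  have "mass_system 0 D (\<lambda>l. 2 ^ l) F (\<lambda>n z. (1/2) ^ n) 1"
    unfolding mass_system_def
  proof (intro conjI allI impI ballI)
    fix n
    show "finite (F n)" by (simp add: F_def)
    have sumF: "(\<Sum>z\<in>F n. (1/2::real) ^ n) = 1"
      by (simp add: F_def card_image[OF inj] power_one_over)
    show "(\<Sum>z\<in>F n. (1/2::real) ^ n) \<le> 1" "1/2 \<le> (\<Sum>z\<in>F n. (1/2::real) ^ n)" using sumF by simp_all
    have yl: "y n i \<in> D l (i div 2 ^ (n - l))" if "l \<le> n" for l i
      using sub'[of l "n - l" i] y[of n i] that by auto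
    have dl: "i div 2 ^ (n - l) < 2 ^ l" if "l \<le> n" "i < 2 ^ n" for l i :: nat
      using that by (simp add: less_mult_imp_div_less flip: power_add)
    show "\<exists>i<2 ^ l. z \<in> D l i" if zF: "z \<in> F n" and ln: "l \<le> n" for z l
    proof -
      obtain i where "i < 2 ^ n" "z = y n i" using zF by (auto simp: F_def)
      then show ?thesis using yl dl ln by blast
    qed
    show "(\<Sum>z\<in>F n \<inter> D l i. (1/2::real) ^ n) \<le> 1 * (1/2) ^ l" if "l \<le> n" "i < 2 ^ l" for l i
    proof -
      \<comment> \<open>The leaves below node \<open>i\<close> form a block of
        \<open>2 ^ (n - l)\<close> consecutive indices.\<close>
      have "F n \<inter> D l i \<subseteq> y n ` {i * 2 ^ (n - l)..<Suc i * 2 ^ (n - l)}"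
      proof
        fix z assume "z \<in> F n \<inter> D l i"
        then obtain j where j: "j < 2 ^ n" "z = y n j" "z \<in> D l i" by (auto simp: F_def)
        have "j div 2 ^ (n - l) = i"
          using disj[OF dl[OF that(1) j(1)] that(2)] yl[OF that(1), of j] j by blast
        then have "j \<in> {i * 2 ^ (n - l)..<Suc i * 2 ^ (n - l)}"
          by (metis atLeastLessThan_iff dividend_less_div_times div_times_less_eq_dividend mult_Suc pos2 zero_less_power)
        then show "z \<in> y n ` {i * 2 ^ (n - l)..<Suc i * 2 ^ (n - l)}" using j by blast
      qed
      then have "card (F n \<inter> D l i) \<le> card (y n ` {i * 2 ^ (n - l)..<Suc i * 2 ^ (n - l)})"
        by (intro card_mono) auto
      also have "\<dots> \<le> 2 ^ (n - l)" by (rule order_trans[OF card_image_le]) auto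
      finally have "real (card (F n \<inter> D l i)) \<le> 2 ^ (n - l)" by (metis of_nat_le_iff of_nat_numeral of_nat_power)
      then have "(\<Sum>z\<in>F n \<inter> D l i. (1/2::real) ^ n) \<le> 2 ^ (n - l) * (1/2) ^ n" by simp
      also have "\<dots> = (1/2) ^ l" using that(1) by (simp add: power_diff power_one_over field_simps)
      finally show ?thesis by simp
    qed
    show "(\<Sum>z\<in>F n \<inter> cball x r. (1/2::real) ^ n) \<le> 1 * r powr 0" if "(1/2) ^ n \<le> r" for x r
    proof -
      \<comment> \<open>Positivity matters because \<open>0 powr 0 = 0\<close>; for
        \<open>r > 0\<close> the bound at exponent 0 is the total mass 1.\<close>
      have "0 < r" using that by (smt (verit) zero_less_power half_gt_zero_iff)
      have "(\<Sum>z\<in>F n \<inter> cball x r. (1/2::real) ^ n) \<le> (\<Sum>z\<in>F n. (1/2::real) ^ n)"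
        by (rule sum_mono2) (auto simp: F_def)
      also have "\<dots> = 1 * r powr 0" using sumF \<open>0 < r\<close> by (simp del: sum_constant)
      finally show ?thesis .
    qed
  qed (use cu disj in auto)
  then show ?thesis by blast
qed

section \<open>Random continuous maps\<close>

instance bcontfun :: (metric_space, banach) banach ..

lemma urysohn_closed:
  fixes A B :: "'a::metric_space set"
  assumes "closed A" "closed B" "A \<inter> B = {}"
  obtains f :: "'a \<Rightarrow> real" where "continuous_on UNIV f" "\<And>x. 0 \<le> f x" "\<And>x. x \<in> A \<Longrightarrow> f x = 1" "\<And>x. x \<in> B \<Longrightarrow> f x = 0"
proof (cases "A = {} \<or> B = {}")
  case True
  then show ?thesis
  proof
    assume "A = {}"
    then show ?thesis by (intro that[of "\<lambda>x. 0"]) auto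
  next
    assume "B = {}"
    then show ?thesis by (intro that[of "\<lambda>x. 1"]) auto
  qed
next
  case False
  then have z: "infdist x A = 0 \<longleftrightarrow> x \<in> A" "infdist x B = 0 \<longleftrightarrow> x \<in> B" for x
    using assms by (simp_all add: in_closed_iff_infdist_zero)
  have "infdist x A + infdist x B \<noteq> 0" for x
    using z[of x] assms(3) infdist_nonneg[of x A] infdist_nonneg[of x B] by (auto simp: add_nonneg_eq_0_iff)
  then show ?thesis
    using z assms(3) by (intro that[of "\<lambda>x. infdist x B / (infdist x A + infdist x B)"])
      (auto intro!: continuous_intros simp: infdist_nonneg disjoint_iff)
qed

lemma disjoint_closed_bumps:
  fixes P :: "nat \<Rightarrow> 'a::metric_space set"
  assumes "\<And>i. i < N \<Longrightarrow> closed (P i)" "\<And>i j. i < N \<Longrightarrow> j < N \<Longrightarrow> i \<noteq> j \<Longrightarrow> P i \<inter> P j = {}"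
  shows "\<exists>\<psi> :: nat \<Rightarrow> 'a \<Rightarrow> real. (\<forall>i. continuous_on UNIV (\<psi> i)) \<and> (\<forall>i x. 0 \<le> \<psi> i x) \<and> (\<forall>x. (\<Sum>i<N. \<psi> i x) \<le> 1) \<and>
    (\<forall>i<N. \<forall>j<N. \<forall>x\<in>P j. \<psi> i x = (if i = j then 1 else 0))"
proof -
  have "\<exists>f :: 'a \<Rightarrow> real. continuous_on UNIV f \<and> (\<forall>x. 0 \<le> f x) \<and> (i < N \<longrightarrow> (\<forall>x\<in>P i. f x = 1) \<and> (\<forall>j<N. j \<noteq> i \<longrightarrow> (\<forall>x\<in>P j. f x = 0)))" for i
  proof (cases "i < N")
    case True
    have "closed (\<Union>j\<in>{..<N} - {i}. P j)" using assms(1) by (intro closed_UN) auto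
    moreover have "P i \<inter> (\<Union>j\<in>{..<N} - {i}. P j) = {}" using assms(2) True by fastforce
    ultimately obtain f :: "'a \<Rightarrow> real" where "continuous_on UNIV f" "\<And>x. 0 \<le> f x" "\<And>x. x \<in> P i \<Longrightarrow> f x = 1"
      "\<And>x. x \<in> (\<Union>j\<in>{..<N} - {i}. P j) \<Longrightarrow> f x = 0"
      using urysohn_closed[OF assms(1)[OF True]] by blast
    then show ?thesis by (intro exI[of _ f]) auto
  next
    case False
    then show ?thesis by (intro exI[of _ "\<lambda>x. 0"]) auto
  qed
  then obtain f :: "nat \<Rightarrow> 'a \<Rightarrow> real" where f: "\<And>i. continuous_on UNIV (f i)" "\<And>i x. 0 \<le> f i x"
    "\<And>i x. i < N \<Longrightarrow> x \<in> P i \<Longrightarrow> f i x = 1" "\<And>i j x. i < N \<Longrightarrow> j < N \<Longrightarrow> j \<noteq> i \<Longrightarrow> x \<in> P j \<Longrightarrow> f i x = 0"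
    by metis
  \<comment> \<open>Dividing by this maximum caps the sum at 1 and changes nothing on the pieces,
    where exactly one bump is 1 and the others vanish.\<close>
  define S where "S x = max 1 (\<Sum>i<N. f i x)" for x
  have S: "0 < S x" for x by (simp add: S_def)
  show ?thesis
  proof (intro exI[of _ "\<lambda>i x. f i x / S x"] conjI allI impI ballI)
    show "continuous_on UNIV (\<lambda>x. f i x / S x)" for i
      using f(1) S unfolding S_def by (intro continuous_intros) (auto simp: less_imp_neq[THEN not_sym])
    show "0 \<le> f i x / S x" for i x using f(2) S[of x] by simp
    show "(\<Sum>i<N. f i x / S x) \<le> 1" for x
      unfolding sum_divide_distrib[symmetric] using S[of x] by (simp add: S_def)
    fix i j x assume ij: "i < N" "j < N" "x \<in> P j"
    have "(\<Sum>i<N. f i x) = (\<Sum>i<N. if i = j then 1 else 0)"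
      by (rule sum.cong) (use f(3,4) ij in auto)
    then have "S x = 1" using ij(2) by (simp add: S_def)
    then show "f i x / S x = (if i = j then 1 else 0)" using f(3,4) ij by auto
  qed
qed

section \<open>Uniform variables in the unit cube and the random series\<close>

text \<open>The identity on the unit cube, which carries \<open>cube_measure\<close>. Truncation
  makes the random series converge uniformly for all choices of the coordinates, not merely almost
  surely, so that its sum is continuous in them.\<close>

definition clip :: "real ^ 'd \<Rightarrow> real ^ 'd" where
  "clip v = (\<chi> i. max 0 (min 1 (v $ i)))"

lemma continuous_on_clip: "continuous_on S (clip :: real ^ 'd \<Rightarrow> _)"
  unfolding clip_def by (intro continuous_intros)

lemma clip_0 [simp]: "clip 0 = 0"
  by (simp add: clip_def vec_eq_iff)

lemma clip_id: "v \<in> cbox 0 1 \<Longrightarrow> clip v = v"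
  by (simp add: clip_def mem_box_cart vec_eq_iff)

lemma norm_clip: "norm (clip (v :: real ^ 'd)) \<le> CARD('d)"
proof -
  have "norm (clip v) \<le> (\<Sum>i\<in>UNIV. \<bar>clip v $ i\<bar>)" by (rule norm_le_l1_cart)
  also have "\<dots> \<le> (\<Sum>i\<in>(UNIV :: 'd set). 1)" by (intro sum_mono) (auto simp: clip_def)
  finally show ?thesis by simp
qed

definition cube_measure :: "(real ^ 'd) measure" where
  "cube_measure = uniform_measure lborel (cbox 0 1)"

lemma emeasure_unit_cube: "emeasure lborel (cbox 0 1 :: (real ^ 'd) set) = 1"
proof -
  have "measure lborel (cbox 0 1 :: (real ^ 'd) set) = 1"
    by (subst content_cbox_cart) (auto simp: mem_box_cart intro!: exI[of _ 0] simp flip: ex_in_conv)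
  then show ?thesis by (simp add: emeasure_eq_measure2)
qed

lemma prob_space_cube_measure: "prob_space (cube_measure :: (real ^ 'd) measure)"
  unfolding cube_measure_def by (intro prob_space_uniform_measure) (simp_all add: emeasure_unit_cube)

lemma sets_cube_measure [simp, measurable_cong]: "sets cube_measure = sets borel"
  by (simp add: cube_measure_def)

text \<open>On the unit cube the condition confines \<open>v\<close> to a cube of side
  \<open>2 * \<rho> / c\<close>, whatever the shift \<open>b\<close>. This uniformity in
  \<open>b\<close> becomes uniformity in the translating function \<open>g\<close>.\<close>

lemma cube_measure_small_ball:
  fixes b :: "real ^ 'd"
  assumes "0 < c" "0 \<le> \<rho>"
  shows "emeasure cube_measure {v. norm (c *\<^sub>R clip v + b) \<le> \<rho>} \<le> ennreal ((2 * \<rho> / c) ^ CARD('d))"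
proof -
  let ?S = "{v :: real ^ 'd. norm (c *\<^sub>R clip v + b) \<le> \<rho>}"
  have cl: "closed ?S" by (intro closed_Collect_le continuous_intros continuous_on_clip)
  then have [measurable]: "?S \<in> sets lborel" by simp
  define lo hi where "lo = (\<chi> i. (- b $ i - \<rho>) / c)" and "hi = (\<chi> i. (- b $ i + \<rho>) / c)"
  have sub: "cbox 0 1 \<inter> ?S \<subseteq> cbox lo hi"
  proof
    fix v assume v: "v \<in> cbox 0 1 \<inter> ?S"
    then have "norm (c *\<^sub>R v + b) \<le> \<rho>" using clip_id[of v] by simp
    then have "\<bar>c * v $ i + b $ i\<bar> \<le> \<rho>" for i
      using component_le_norm_cart[of "c *\<^sub>R v + b" i] by simp
    then have "- b $ i - \<rho> \<le> c * v $ i \<and> c * v $ i \<le> - b $ i + \<rho>" for i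
      by (smt (verit))
    then show "v \<in> cbox lo hi"
      using assms(1) by (simp add: mem_box_cart lo_def hi_def pos_divide_le_eq pos_le_divide_eq mult.commute)
  qed
  have "emeasure cube_measure ?S = emeasure lborel (cbox 0 1 \<inter> ?S)"
    unfolding cube_measure_def using cl
    by (subst emeasure_uniform_measure) (auto simp: emeasure_unit_cube divide_ennreal_def)
  also have "\<dots> \<le> emeasure lborel (cbox lo hi)" by (rule emeasure_mono[OF sub]) simp
  also have "\<dots> = ennreal (measure lborel (cbox lo hi))" by (simp add: emeasure_eq_measure2)
  also have "measure lborel (cbox lo hi) = (2 * \<rho> / c) ^ CARD('d)"
  proof (subst content_cbox_cart)
    show "cbox lo hi \<noteq> {}"
      using assms by (auto simp: mem_box_cart lo_def hi_def divide_right_mono intro!: exI[of _ lo] simp flip: ex_in_conv)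
    show "(\<Prod>i\<in>UNIV. hi $ i - lo $ i) = (2 * \<rho> / c) ^ CARD('d)"
      by (simp add: lo_def hi_def diff_divide_distrib[symmetric])
  qed
  finally show ?thesis .
qed

definition bump_map :: "('a::topological_space \<Rightarrow> real) \<Rightarrow> real ^ 'd \<Rightarrow> ('a \<Rightarrow>\<^sub>C (real ^ 'd))" where
  "bump_map f b = Bcontfun (\<lambda>x. f x *\<^sub>R b)"

definition random_layer :: "(nat \<Rightarrow> nat \<Rightarrow> 'a::topological_space \<Rightarrow> real) \<Rightarrow> (nat \<Rightarrow> nat) \<Rightarrow> nat \<Rightarrow> (nat \<times> nat \<Rightarrow> real ^ 'd) \<Rightarrow> ('a \<Rightarrow>\<^sub>C (real ^ 'd))" where
  "random_layer \<psi> N q u = (\<Sum>i<N q. bump_map (\<psi> q i) (clip (u (q, i))))"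

text \<open>Summable, so that the series converges, yet with a reciprocal polynomial in
  \<open>q\<close>; the reciprocal enters the small-ball bounds to the power
  \<open>CARD('d)\<close>.\<close>

definition layer_weight :: "nat \<Rightarrow> real" where
  "layer_weight q = 1 / (real q + 1) ^ 2"

definition random_map :: "(nat \<Rightarrow> nat \<Rightarrow> 'a::topological_space \<Rightarrow> real) \<Rightarrow> (nat \<Rightarrow> nat) \<Rightarrow> (nat \<times> nat \<Rightarrow> real ^ 'd) \<Rightarrow> ('a \<Rightarrow>\<^sub>C (real ^ 'd))" where
  "random_map \<psi> N u = (\<Sum>q. layer_weight q *\<^sub>R random_layer \<psi> N q u)"

lemma layer_weight_pos: "0 < layer_weight q"
  by (simp add: layer_weight_def)

lemma summable_layer_weight: "summable layer_weight"
proof -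
  have "summable (\<lambda>n. inverse ((real (Suc n))\<^sup>2))"
    using inverse_power_summable[of 2, where 'a=real] by (subst summable_Suc_iff) simp
  then show ?thesis by (simp add: layer_weight_def[abs_def] inverse_eq_divide add.commute)
qed

locale bump_family =
  fixes \<psi> :: "nat \<Rightarrow> nat \<Rightarrow> 'a::metric_space \<Rightarrow> real" and N :: "nat \<Rightarrow> nat"
  assumes cont: "continuous_on UNIV (\<psi> q i)"
    and nonneg: "0 \<le> \<psi> q i x"
    and sum_le_1: "(\<Sum>i<N q. \<psi> q i x) \<le> 1"
begin

lemma le_1: "i < N q \<Longrightarrow> \<psi> q i x \<le> 1"
  using member_le_sum[of i "{..<N q}" "\<lambda>i. \<psi> q i x"] sum_le_1[of q x] nonneg by simp

lemma bump_map_apply: "i < N q \<Longrightarrow> apply_bcontfun (bump_map (\<psi> q i) b) x = \<psi> q i x *\<^sub>R b"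
proof -
  assume i: "i < N q"
  have "(\<lambda>x. \<psi> q i x *\<^sub>R b) \<in> bcontfun"
  proof (rule bcontfun_normI)
    show "continuous_on UNIV (\<lambda>x. \<psi> q i x *\<^sub>R b)" by (intro continuous_intros cont)
    show "norm (\<psi> q i x *\<^sub>R b) \<le> norm b" for x
      using le_1[OF i, of x] nonneg[of q i x] by (simp add: mult_left_le_one_le)
  qed
  then show ?thesis by (simp add: bump_map_def Bcontfun_inverse)
qed

lemma bounded_linear_bump_map: "i < N q \<Longrightarrow> bounded_linear (bump_map (\<psi> q i))"
proof (rule bounded_linear_intro[where K=1])
  assume i: "i < N q"
  show "bump_map (\<psi> q i) (b + b') = bump_map (\<psi> q i) b + bump_map (\<psi> q i) b'" for b b'
    by (rule bcontfun_eqI) (simp add: bump_map_apply i scaleR_add_right)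
  show "bump_map (\<psi> q i) (r *\<^sub>R b) = r *\<^sub>R bump_map (\<psi> q i) b" for r b
    by (rule bcontfun_eqI) (simp add: bump_map_apply i)
  show "norm (bump_map (\<psi> q i) b) \<le> norm b * 1" for b
    by (rule norm_bound) (use le_1[OF i] nonneg in \<open>simp add: bump_map_apply i mult_left_le_one_le\<close>)
qed

lemma sum_bcontfun_apply: "finite I \<Longrightarrow> apply_bcontfun (sum f I) x = (\<Sum>i\<in>I. apply_bcontfun (f i) x)"
  by (induction rule: finite_induct) auto

lemma norm_random_layer: "norm (random_layer \<psi> N q u :: 'a \<Rightarrow>\<^sub>C (real ^ 'd)) \<le> CARD('d)"
proof (rule norm_bound)
  fix x
  have "apply_bcontfun (random_layer \<psi> N q u) x = (\<Sum>i<N q. \<psi> q i x *\<^sub>R clip (u (q, i)))"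
    unfolding random_layer_def by (simp add: sum_bcontfun_apply bump_map_apply)
  then have "norm (apply_bcontfun (random_layer \<psi> N q u) x) \<le> (\<Sum>i<N q. norm (\<psi> q i x *\<^sub>R clip (u (q, i))))"
    by (simp only: norm_sum)
  also have "\<dots> \<le> (\<Sum>i<N q. \<psi> q i x * CARD('d))"
    by (intro sum_mono) (simp add: nonneg mult_left_mono norm_clip)
  also have "\<dots> \<le> CARD('d)"
    unfolding sum_distrib_right[symmetric] using mult_right_mono[OF sum_le_1[of q x], of "real CARD('d)"] by simp
  finally show "norm (apply_bcontfun (random_layer \<psi> N q u) x) \<le> CARD('d)" .
qed

lemma norm_weighted_layer:
  "norm (layer_weight q *\<^sub>R random_layer \<psi> N q u :: 'a \<Rightarrow>\<^sub>C (real ^ 'd)) \<le> layer_weight q * CARD('d)"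
  using norm_random_layer[of q u] layer_weight_pos[of q] by (simp add: mult_left_mono)

lemma summable_weighted_layer:
  "summable (\<lambda>q. layer_weight q *\<^sub>R random_layer \<psi> N q u :: 'a \<Rightarrow>\<^sub>C (real ^ 'd))"
  by (rule summable_comparison_test'[where N=0 and g="\<lambda>q. layer_weight q * CARD('d)"])
     (intro summable_mult2 summable_layer_weight norm_weighted_layer)+

text \<open>Each layer depends on finitely many coordinates and the tails are uniformly small, so
  the sum is continuous from the product topology to the maximum norm.\<close>

lemma continuous_on_random_map:
  "continuous_on UNIV (random_map \<psi> N :: (nat \<times> nat \<Rightarrow> real ^ 'd) \<Rightarrow> ('a \<Rightarrow>\<^sub>C (real ^ 'd)))"
proof -
  have "uniform_limit UNIV (\<lambda>n u. \<Sum>q<n. layer_weight q *\<^sub>R random_layer \<psi> N q u :: 'a \<Rightarrow>\<^sub>C (real ^ 'd))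
     (random_map \<psi> N) sequentially"
    unfolding random_map_def
    by (rule Weierstrass_m_test[where M="\<lambda>q. layer_weight q * CARD('d)"])
       (intro summable_mult2 summable_layer_weight norm_weighted_layer)+
  moreover have "continuous_on UNIV (\<lambda>u. \<Sum>q<n. layer_weight q *\<^sub>R random_layer \<psi> N q u :: 'a \<Rightarrow>\<^sub>C (real ^ 'd))" for n
    unfolding random_layer_def
  proof (intro continuous_intros)
    fix q i assume "i \<in> {..<N q}"
    then have bl: "bounded_linear (bump_map (\<psi> q i) :: real ^ 'd \<Rightarrow> _)" by (intro bounded_linear_bump_map) auto
    show "continuous_on UNIV (\<lambda>u. bump_map (\<psi> q i) (clip (u (q, i) :: real ^ 'd)))"
      by (rule bounded_linear.continuous_on[OF bl])
         (intro continuous_on_compose2[OF continuous_on_clip[of UNIV]] continuous_on_product_coordinates, auto)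
  qed
  ultimately show ?thesis
    by (intro uniform_limit_theorem[rotated]) auto
qed

lemma random_map_upd:
  assumes "i < N q"
  shows "(random_map \<psi> N (u((q, i) := v)) :: 'a \<Rightarrow>\<^sub>C (real ^ 'd)) =
    random_map \<psi> N (u((q, i) := 0)) + layer_weight q *\<^sub>R bump_map (\<psi> q i) (clip v)"
proof -
  define f where "f w q' = (layer_weight q' *\<^sub>R random_layer \<psi> N q' (u((q, i) := w)) :: 'a \<Rightarrow>\<^sub>C (real ^ 'd))" for w q'
  have "random_map \<psi> N (u((q, i) := v)) - random_map \<psi> N (u((q, i) := 0)) = (\<Sum>q'. f v q' - f 0 q')"
    unfolding random_map_def f_def by (intro suminf_diff summable_weighted_layer)
  also have "\<dots> = (\<Sum>q'\<in>{q}. f v q' - f 0 q')"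
    by (rule suminf_finite) (auto simp: f_def random_layer_def)
  also have "\<dots> = layer_weight q *\<^sub>R (random_layer \<psi> N q (u((q, i) := v)) - random_layer \<psi> N q (u((q, i) := 0)))"
    by (simp add: f_def scaleR_diff_right)
  also have "random_layer \<psi> N q (u((q, i) := v)) - random_layer \<psi> N q (u((q, i) := 0)) =
    (\<Sum>j<N q. if j = i then bump_map (\<psi> q i) (clip v) else 0)"
    unfolding random_layer_def sum_subtractf[symmetric]
    using bounded_linear.linear[OF bounded_linear_bump_map[OF assms], THEN linear_0]
    by (intro sum.cong) auto
  also have "\<dots> = bump_map (\<psi> q i) (clip v)" using assms by simp
  finally show ?thesis unfolding diff_eq_eq by (simp only: add.commute)
qed

text \<open>The index set is countable, so the product sigma-algebra is the Borel one of the product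
  topology, and continuity gives measurability.\<close>

lemma random_map_measurable:
  "random_map \<psi> N \<in> measurable (PiM UNIV (\<lambda>_. cube_measure :: (real ^ 'd) measure)) borel"
proof -
  have "random_map \<psi> N \<in> borel_measurable (borel :: (nat \<times> nat \<Rightarrow> real ^ 'd) measure)"
    by (rule borel_measurable_continuous_onI[OF continuous_on_random_map])
  moreover have "sets (PiM UNIV (\<lambda>_. cube_measure :: (real ^ 'd) measure)) = sets (borel :: (nat \<times> nat \<Rightarrow> real ^ 'd) measure)"
    using sets_PiM_cong[OF refl sets_cube_measure] sets_PiM_equal_borel by metis
  ultimately show ?thesis by (simp cong: measurable_cong_sets)
qed

end

lemma continuous_on_bcontfun_eval: "continuous_on UNIV (\<lambda>f :: 'a::topological_space \<Rightarrow>\<^sub>C 'b::metric_space. apply_bcontfun f x)"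
proof (rule continuous_onI)
  fix f :: "'a \<Rightarrow>\<^sub>C 'b" and e :: real assume "0 < e"
  then show "\<exists>d>0. \<forall>g\<in>UNIV. dist g f < d \<longrightarrow> dist (apply_bcontfun g x) (apply_bcontfun f x) \<le> e"
    using dist_bounded[of _ x f] by (intro exI[of _ e]) (auto intro: order_trans less_imp_le)
qed

abbreviation cubes_measure :: "(nat \<times> nat \<Rightarrow> real ^ 'd) measure" where
  "cubes_measure \<equiv> PiM UNIV (\<lambda>_. cube_measure)"

lemma prob_space_cubes_measure: "prob_space (cubes_measure :: (nat \<times> nat \<Rightarrow> real ^ 'd) measure)"
  by (intro prob_space_PiM prob_space_cube_measure)

text \<open>Fubini over the coordinate \<open>(q, i)\<close>: with all others fixed, the increment
  between \<open>z\<close> and \<open>x\<close> is a constant plus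
  \<open>layer_weight q *\<^sub>R clip v\<close>, because the bump is 1 at \<open>x\<close> and 0 at
  \<open>z\<close>.\<close>

lemma (in bump_family) random_map_small_ball:
  fixes g :: "'a \<Rightarrow>\<^sub>C (real ^ 'd)"
  assumes i: "i < N q" and xz: "\<psi> q i x = 1" "\<psi> q i z = 0" and "0 \<le> \<rho>"
  shows "emeasure cubes_measure {u. dist (apply_bcontfun (random_map \<psi> N u + g) x) (apply_bcontfun (random_map \<psi> N u + g) z) \<le> \<rho>}
     \<le> ennreal ((2 * \<rho> / layer_weight q) ^ CARD('d))"
proof -
  interpret P: prob_space "cubes_measure :: (nat \<times> nat \<Rightarrow> real ^ 'd) measure" by (rule prob_space_cubes_measure)
  interpret C: prob_space "cube_measure :: (real ^ 'd) measure" by (rule prob_space_cube_measure)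
  interpret pair_sigma_finite "cube_measure :: (real ^ 'd) measure" "cubes_measure :: (nat \<times> nat \<Rightarrow> real ^ 'd) measure" ..
  let ?C = "cube_measure :: (real ^ 'd) measure" and ?P = "cubes_measure :: (nat \<times> nat \<Rightarrow> real ^ 'd) measure"
  let ?S = "{u. dist (apply_bcontfun (random_map \<psi> N u + g) x) (apply_bcontfun (random_map \<psi> N u + g) z) \<le> \<rho>}"
  have "closed {f :: 'a \<Rightarrow>\<^sub>C (real ^ 'd). dist (apply_bcontfun (f + g) x) (apply_bcontfun (f + g) z) \<le> \<rho>}"
    unfolding plus_bcontfun.rep_eq by (intro closed_Collect_le continuous_intros continuous_on_bcontfun_eval)
  then have "random_map \<psi> N -` {f. dist (apply_bcontfun (f + g) x) (apply_bcontfun (f + g) z) \<le> \<rho>} \<inter> space ?P \<in> sets ?P"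
    by (intro measurable_sets[OF random_map_measurable]) simp
  moreover have "space ?P = UNIV" by (simp add: space_PiM cube_measure_def)
  ultimately have S: "?S \<in> sets ?P" by (simp add: vimage_def)
  \<comment> \<open>Overwriting one coordinate by an independent sample preserves the product
    measure and exposes that coordinate as a separate factor.\<close>
  have d: "distr (?C \<Otimes>\<^sub>M ?P) ?P (\<lambda>(v, u). u((q, i) := v)) = ?P"
    using distr_pair_PiM_eq_PiM[of UNIV "\<lambda>_. ?C" "(q, i)"] prob_space_cube_measure by simp
  have m: "(\<lambda>(v, u). u((q, i) := v)) \<in> measurable (?C \<Otimes>\<^sub>M ?P) ?P"
    using measurable_fun_upd[of UNIV UNIV "(q,i)" snd "?C \<Otimes>\<^sub>M ?P" "\<lambda>_. ?C" fst] by (simp add: case_prod_unfold)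
  let ?A = "(\<lambda>(v, u). u((q, i) := v)) -` ?S \<inter> space (?C \<Otimes>\<^sub>M ?P)"
  have A: "?A \<in> sets (?C \<Otimes>\<^sub>M ?P)" by (rule measurable_sets[OF m S])
  have "emeasure ?P ?S = emeasure (?C \<Otimes>\<^sub>M ?P) ?A"
    by (subst d[symmetric], rule emeasure_distr[OF m S])
  also have "\<dots> = (\<integral>\<^sup>+u. emeasure ?C ((\<lambda>v. (v, u)) -` ?A) \<partial>?P)"
    by (rule emeasure_pair_measure_alt2[OF A])
  also have "\<dots> \<le> (\<integral>\<^sup>+u. ennreal ((2 * \<rho> / layer_weight q) ^ CARD('d)) \<partial>?P)"
  proof (rule nn_integral_mono)
    fix u :: "nat \<times> nat \<Rightarrow> real ^ 'd"
    let ?h = "random_map \<psi> N (u((q, i) := 0)) + g"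
    let ?b = "apply_bcontfun ?h x - apply_bcontfun ?h z"
    have "apply_bcontfun (random_map \<psi> N (u((q, i) := v)) + g) x - apply_bcontfun (random_map \<psi> N (u((q, i) := v)) + g) z
      = layer_weight q *\<^sub>R clip v + ?b" for v
      unfolding random_map_upd[OF i, of u v] by (simp add: bump_map_apply[OF i] xz)
    note eq = this
    have "(\<lambda>v. (v, u)) -` ?A \<subseteq> {v. norm (layer_weight q *\<^sub>R clip v + ?b) \<le> \<rho>}"
    proof
      fix v assume "v \<in> (\<lambda>v. (v, u)) -` ?A"
      then have "dist (apply_bcontfun (random_map \<psi> N (u((q, i) := v)) + g) x)
          (apply_bcontfun (random_map \<psi> N (u((q, i) := v)) + g) z) \<le> \<rho>"
        by (simp only: vimage_eq Int_iff mem_Collect_eq prod.case)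
      then show "v \<in> {v. norm (layer_weight q *\<^sub>R clip v + ?b) \<le> \<rho>}"
        unfolding dist_norm eq[of v] by (rule CollectI)
    qed
    moreover have "closed {v. norm (layer_weight q *\<^sub>R clip v + b) \<le> \<rho>}" for b :: "real ^ 'd"
      by (intro closed_Collect_le continuous_intros continuous_on_clip)
    then have "{v. norm (layer_weight q *\<^sub>R clip v + ?b) \<le> \<rho>} \<in> sets ?C"
      unfolding sets_cube_measure by (rule borel_closed)
    ultimately have "emeasure ?C ((\<lambda>v. (v, u)) -` ?A) \<le> emeasure ?C {v. norm (layer_weight q *\<^sub>R clip v + ?b) \<le> \<rho>}"
      by (rule emeasure_mono)
    also have "\<dots> \<le> ennreal ((2 * \<rho> / layer_weight q) ^ CARD('d))"
      by (rule cube_measure_small_ball[OF layer_weight_pos assms(4)])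
    finally show "emeasure ?C ((\<lambda>v. (v, u)) -` ?A) \<le> ennreal ((2 * \<rho> / layer_weight q) ^ CARD('d))" .
  qed
  also have "\<dots> = ennreal ((2 * \<rho> / layer_weight q) ^ CARD('d))"
    by (simp add: P.emeasure_space_1)
  finally show ?thesis .
qed

section \<open>Energies of graphs\<close>

text \<open>A dyadic form of the \<open>t\<close>-energy of the measure lifted to the graph, the
  double integral of the distance to the power \<open>- t\<close>, cut off at scale
  \<open>(1/2) ^ n\<close> so that the diagonal stays finite. The factor 4 fits the balls of radius
  \<open>2 * (1/2) ^ k\<close> into which covering sets are enlarged.\<close>

definition pair_energy :: "real \<Rightarrow> nat \<Rightarrow> 'a::metric_space set \<Rightarrow> ('a \<Rightarrow> real) \<Rightarrow> ('a \<Rightarrow> 'b::metric_space) \<Rightarrow> real" where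
  "pair_energy t n F w f = (\<Sum>k\<le>n. \<Sum>x\<in>F. \<Sum>z\<in>F. 2 powr (real k * t) * (w x * w z) *
     of_bool (dist x z \<le> 4 * (1/2) ^ k \<and> dist (f x) (f z) \<le> 4 * (1/2) ^ k))"

lemma half_power_powr: "((1/2 :: real) ^ k) powr t = 1 / 2 powr (real k * t)"
proof -
  have "(1/2 :: real) ^ k = 2 powr (- real k)"
    by (simp add: powr_minus_divide powr_realpow power_one_over)
  then have "((1/2 :: real) ^ k) powr t = 2 powr (- (real k * t))" by (simp only: powr_powr mult_minus_left)
  then show ?thesis by (simp only: powr_minus_divide)
qed

lemma dyadic_scale:
  fixes r :: real
  assumes "0 < r" "r \<le> 1"
  obtains k where "r \<le> (1/2) ^ k" "(1/2) ^ k < 2 * r"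
proof -
  obtain n where "(1/2 :: real) ^ n < r" using real_arch_pow_inv[OF assms(1), of "1/2"] by auto
  then have n: "(1/2 :: real) ^ (LEAST n. (1/2) ^ n < r) < r" by (rule LeastI)
  show ?thesis
  proof (cases "LEAST n. (1/2 :: real) ^ n < r")
    case 0
    then show ?thesis using n assms by simp
  next
    case (Suc k)
    then have "\<not> (1/2 :: real) ^ k < r" using not_less_Least[of k "\<lambda>n. (1/2 :: real) ^ n < r"] by simp
    then show ?thesis using n unfolding Suc by (intro that[of k]) auto
  qed
qed

text \<open>Mass distribution principle: by Markov's inequality the points of potential at most
  \<open>4 * A\<close> keep mass at least 1/4, and a covering set of size \<open>r\<close> contains
  only a multiple of \<open>A * r powr t\<close> of it.\<close>

lemma hausdorff_pre_measure_graph_nonzero: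
  fixes f :: "'a::metric_space \<Rightarrow> 'b::metric_space"
  assumes K: "compact (UNIV :: 'a set)" and f: "continuous_on UNIV f" and t: "0 < t" and A: "0 < A"
    and F: "\<And>n. finite (F n)" "\<And>n z. 0 \<le> w n z" "\<And>n. 1 / 2 \<le> sum (w n) (F n)"
    and e: "\<And>n0. \<exists>n\<ge>n0. pair_energy t n (F n) (w n) f \<le> A"
  shows "hausdorff_pre_measure t 1 (function_graph f) \<noteq> 0"
proof
  assume z: "hausdorff_pre_measure t 1 (function_graph f) = 0"
  \<comment> \<open>Chosen so that the final bound
    \<open>4 * A * 2 powr t * (\<epsilon> * 3)\<close> equals 1/8, below the mass 1/4 of
    \<open>G\<close>.\<close>
  define \<epsilon> where "\<epsilon> = 1 / (96 * A * 2 powr t)"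
  have \<epsilon>: "0 < \<epsilon>" using A by (simp add: \<epsilon>_def)
  have "hausdorff_pre_measure t 1 (function_graph f) < ennreal \<epsilon>" using z \<epsilon> by simp
  then obtain U :: "nat \<Rightarrow> ('a \<times> 'b) set" where U: "function_graph f \<subseteq> (\<Union>i. U i)" "\<And>i. bounded (U i)" "\<And>i. diameter (U i) \<le> 1"
    "(\<Sum>i. diam_pow t (U i)) < ennreal \<epsilon>"
    using hausdorff_pre_measure_less_obtain by metis
  have "\<exists>r. 0 < r \<and> r \<le> 1 \<and> diameter (U i) \<le> r \<and> ennreal (r powr t) \<le> diam_pow t (U i) + ennreal (\<epsilon> * (1/2) ^ i)" for i
  proof -
    have "0 < \<epsilon> * (1/2) ^ i" using \<epsilon> by simp
    from diam_pow_radius[OF U(2)[of i] U(3)[of i] t this zero_less_one] show ?thesis by blast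
  qed
  then obtain r where r: "\<And>i. 0 < r i" "\<And>i. r i \<le> 1" "\<And>i. diameter (U i) \<le> r i"
    "\<And>i. ennreal (r i powr t) \<le> diam_pow t (U i) + ennreal (\<epsilon> * (1/2) ^ i)" by metis
  have "\<exists>k. r i \<le> (1/2) ^ k \<and> (1/2) ^ k < 2 * r i" for i
    using dyadic_scale[OF r(1,2)[of i]] by metis
  then obtain \<kappa> where \<kappa>: "\<And>i. r i \<le> (1/2) ^ \<kappa> i" "\<And>i. (1/2) ^ \<kappa> i < 2 * r i" by metis
  define p where "p i = (SOME p. p \<in> U i)" for i
  \<comment> \<open>Open enlargements allow a finite subcover of the compact graph. Only finitely
    many scales \<open>\<kappa> i\<close> then occur, and a single \<open>n\<close> beyond all of
    them with bounded energy is enough.\<close>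
  define V where "V i = ball (p i) (2 * (1/2) ^ \<kappa> i)" for i
  have UV: "U i \<subseteq> V i" for i
  proof
    fix q assume q: "q \<in> U i"
    then have "p i \<in> U i" unfolding p_def by (rule someI)
    then have "dist (p i) q \<le> (1/2) ^ \<kappa> i"
      using diameter_bounded_bound[OF U(2)[of i] _ q] r(3)[of i] \<kappa>(1)[of i] by fastforce
    also have "\<dots> < 2 * (1/2) ^ \<kappa> i" by simp
    finally show "q \<in> V i" by (simp add: V_def)
  qed
  have "function_graph f = (\<lambda>x. (x, f x)) ` UNIV" by (auto simp: function_graph_def)
  then have cg: "compact (function_graph f)"
    using K f by (auto intro!: compact_continuous_image continuous_intros)
  have "function_graph f \<subseteq> (\<Union>i\<in>UNIV. V i)" using U(1) UV by blast
  then obtain I where I: "finite I" "function_graph f \<subseteq> (\<Union>i\<in>I. V i)"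
    by (rule compactE_image[OF cg, of UNIV V, rotated]) (auto simp: V_def)
  obtain n where nM: "Max (\<kappa> ` I) \<le> n" and ne: "pair_energy t n (F n) (w n) f \<le> A"
    using e by blast
  have n: "\<kappa> i \<le> n" if "i \<in> I" for i
    using nM I(1) that by (meson Max_ge finite_imageI imageI order_trans)
  define cl where "cl k x z \<longleftrightarrow> dist x z \<le> 4 * (1/2) ^ k \<and> dist (f x) (f z) \<le> 4 * (1/2) ^ k" for k x z
  define pot where "pot x = (\<Sum>k\<le>n. 2 powr (real k * t) * (\<Sum>z\<in>F n. w n z * of_bool (cl k x z)))" for x
  have pot0: "0 \<le> pot x" for x unfolding pot_def using F(2) by (intro sum_nonneg mult_nonneg_nonneg) auto
  have en: "pair_energy t n (F n) (w n) f = (\<Sum>x\<in>F n. w n x * pot x)"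
  proof -
    have "pair_energy t n (F n) (w n) f = (\<Sum>x\<in>F n. \<Sum>k\<le>n. \<Sum>z\<in>F n. 2 powr (real k * t) * (w n x * w n z) * of_bool (cl k x z))"
      unfolding pair_energy_def cl_def by (rule sum.swap)
    also have "\<dots> = (\<Sum>x\<in>F n. w n x * pot x)"
      by (simp add: pot_def sum_distrib_left mult.assoc mult.left_commute)
    finally show ?thesis .
  qed
  define G where "G = {x \<in> F n. pot x \<le> 4 * A}"
  have "(\<Sum>x\<in>F n - G. w n x) * (4 * A) \<le> (\<Sum>x\<in>F n - G. w n x * pot x)"
    unfolding sum_distrib_right using F(2) by (intro sum_mono mult_left_mono) (auto simp: G_def)
  also have "\<dots> \<le> (\<Sum>x\<in>F n. w n x * pot x)"
    using F pot0 by (intro sum_mono2) auto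
  also have "\<dots> \<le> A" using ne en by simp
  finally have "(\<Sum>x\<in>F n - G. w n x) \<le> 1 / 4" using A by (simp add: field_simps)
  moreover have "sum (w n) (F n) = sum (w n) G + (\<Sum>x\<in>F n - G. w n x)"
    using F(1) by (subst sum.subset_diff[of G]) (auto simp: G_def)
  ultimately have G: "1 / 4 \<le> sum (w n) G" using F(3)[of n] by linarith
  have finG: "finite G" using F(1)[of n] by (simp add: G_def)
  define W where "W i = (\<Sum>x\<in>G. w n x * of_bool ((x, f x) \<in> V i))" for i
  have "sum (w n) G \<le> (\<Sum>x\<in>G. \<Sum>i\<in>I. w n x * of_bool ((x, f x) \<in> V i))"
  proof (rule sum_mono)
    fix x assume "x \<in> G"
    obtain i where i: "i \<in> I" "(x, f x) \<in> V i" using I(2) by (auto simp: function_graph_def)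
    then have "w n x = w n x * of_bool ((x, f x) \<in> V i)" by simp
    also have "\<dots> \<le> (\<Sum>i\<in>I. w n x * of_bool ((x, f x) \<in> V i))"
      by (rule member_le_sum[OF i(1) _ I(1)]) (simp add: F(2))
    finally show "w n x \<le> (\<Sum>i\<in>I. w n x * of_bool ((x, f x) \<in> V i))" .
  qed
  also have "\<dots> = (\<Sum>i\<in>I. W i)" unfolding W_def by (rule sum.swap)
  finally have GW: "sum (w n) G \<le> (\<Sum>i\<in>I. W i)" .
  have W: "W i \<le> 4 * A * 2 powr t * r i powr t" if i: "i \<in> I" for i
  proof (cases "\<exists>x. x \<in> G \<and> (x, f x) \<in> V i")
    case False
    then have "W i = 0" unfolding W_def by (intro sum.neutral) auto
    then show ?thesis using A by simp
  next
    case True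
    then obtain x where x: "x \<in> G" "(x, f x) \<in> V i" by blast
    have cls: "cl (\<kappa> i) x z" if "(z, f z) \<in> V i" for z
    proof -
      have "dist (x, f x) (z, f z) \<le> 4 * (1/2) ^ \<kappa> i"
        using x(2) that dist_triangle2[of "(x, f x)" "(z, f z)" "p i"] unfolding V_def by (simp add: dist_commute)
      then show ?thesis
        using dist_fst_le[of "(x, f x)" "(z, f z)"] dist_snd_le[of "(x, f x)" "(z, f z)"] by (simp add: cl_def)
    qed
    have "W i \<le> (\<Sum>z\<in>G. w n z * of_bool (cl (\<kappa> i) x z))"
      unfolding W_def by (intro sum_mono mult_left_mono F(2)) (use cls in auto)
    also have "\<dots> \<le> (\<Sum>z\<in>F n. w n z * of_bool (cl (\<kappa> i) x z))"
      using F by (intro sum_mono2) (auto simp: G_def)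
    finally have "2 powr (real (\<kappa> i) * t) * W i \<le> 2 powr (real (\<kappa> i) * t) * (\<Sum>z\<in>F n. w n z * of_bool (cl (\<kappa> i) x z))"
      by (intro mult_left_mono) auto
    also have "\<dots> \<le> pot x"
      unfolding pot_def using F n[OF i]
      by (intro member_le_sum[of "\<kappa> i" _ "\<lambda>k. 2 powr (real k * t) * (\<Sum>z\<in>F n. w n z * of_bool (cl k x z))"])
        (auto intro!: mult_nonneg_nonneg sum_nonneg)
    also have "\<dots> \<le> 4 * A" using x(1) by (simp add: G_def)
    finally have "W i \<le> 4 * A / 2 powr (real (\<kappa> i) * t)" by (simp add: field_simps)
    also have "\<dots> = 4 * A * ((1/2) ^ \<kappa> i) powr t"
      unfolding half_power_powr by simp
    also have "\<dots> \<le> 4 * A * (2 * r i) powr t"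
      using \<kappa>(2)[of i] t A by (intro mult_left_mono powr_mono2) auto
    also have "\<dots> = 4 * A * 2 powr t * r i powr t" using r(1)[of i] by (simp add: powr_mult)
    finally show ?thesis .
  qed
  have "ennreal (\<Sum>i\<in>I. r i powr t) = (\<Sum>i\<in>I. ennreal (r i powr t))" by (rule sum_ennreal[symmetric]) simp
  also have "\<dots> \<le> (\<Sum>i\<in>I. diam_pow t (U i) + ennreal (\<epsilon> * (1/2) ^ i))" by (intro sum_mono r(4))
  also have "\<dots> \<le> (\<Sum>i. diam_pow t (U i) + ennreal (\<epsilon> * (1/2) ^ i))" by (intro sum_le_suminf I(1)) auto
  also have "\<dots> = (\<Sum>i. diam_pow t (U i)) + (\<Sum>i. ennreal (\<epsilon> * (1/2) ^ i))"
    by (rule suminf_add[symmetric]) auto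
  also have "(\<Sum>i. ennreal (\<epsilon> * (1/2)^i)) = ennreal (\<epsilon> * 2)"
    using \<epsilon> geometric_sums[of "1/2::real"] by (intro suminf_ennreal_eq sums_mult) auto
  also have "(\<Sum>i. diam_pow t (U i)) + ennreal (\<epsilon> * 2) \<le> ennreal \<epsilon> + ennreal (\<epsilon> * 2)"
    using U(4) by (intro add_right_mono) auto
  also have "\<dots> = ennreal (\<epsilon> * 3)" using \<epsilon> by (simp flip: ennreal_plus)
  finally have "(\<Sum>i\<in>I. r i powr t) \<le> \<epsilon> * 3" using \<epsilon> by (simp add: ennreal_le_iff)
  then have "4 * A * 2 powr t * (\<Sum>i\<in>I. r i powr t) \<le> 4 * A * 2 powr t * (\<epsilon> * 3)"
    using A by (intro mult_left_mono) auto
  also have "\<dots> = 1 / 8" using A by (simp add: \<epsilon>_def)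
  finally have "4 * A * 2 powr t * (\<Sum>i\<in>I. r i powr t) \<le> 1 / 8" .
  moreover have "(\<Sum>i\<in>I. W i) \<le> 4 * A * 2 powr t * (\<Sum>i\<in>I. r i powr t)"
    unfolding sum_distrib_left by (intro sum_mono W)
  ultimately show False using G GW by linarith
qed

section \<open>Expected energies of random graphs\<close>

text \<open>Since \<open>prod_encode (k, l) + 1 \<le> (k + l + 1) ^ 2\<close>, the second factor is
  at most a polynomial of degree \<open>4 * d\<close> in \<open>l\<close>, whereas the first decays
  geometrically.\<close>

lemma summable_layer_sum:
  assumes "0 < \<epsilon>"
  shows "summable (\<lambda>l. ((1/2) ^ l) powr \<epsilon> * (1 / layer_weight (prod_encode (k, l))) ^ d)"
proof -
  \<comment> \<open>The polynomial is bounded through \<open>1 + v \<le> exp v\<close> at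
    \<open>v = \<eta> * (k + l)\<close>. This \<open>\<eta>\<close> lets the \<open>4 * d\<close>-th
    power use up at most half of the decay rate \<open>\<epsilon> * ln 2\<close>; the other half
    gives the ratio \<open>y\<close>.\<close>
  define \<eta> where "\<eta> = min 1 (\<epsilon> * ln 2 / (8 * (real d + 1)))"
  have \<eta>: "0 < \<eta>" "\<eta> \<le> 1" using assms by (auto simp: \<eta>_def)
  have "4 * real d * \<eta> \<le> 4 * real d * (\<epsilon> * ln 2 / (8 * (real d + 1)))"
    by (intro mult_left_mono) (auto simp: \<eta>_def)
  also have "\<dots> \<le> \<epsilon> * ln 2 / 2" using assms by (simp add: field_simps)
  finally have d\<eta>: "4 * real d * \<eta> \<le> \<epsilon> * ln 2 / 2" .
  define y where "y = exp (- (\<epsilon> * ln 2 / 2))"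
  define c where "c = exp (\<epsilon> * ln 2 / 2 * k) / \<eta> ^ (4 * d)"
  have y: "0 \<le> y" "y < 1" using assms by (auto simp: y_def)
  have bound: "((1/2) ^ l) powr \<epsilon> * (1 / layer_weight (prod_encode (k, l))) ^ d \<le> c * y ^ l" for l
  proof -
    have "prod_encode (k, l) + 1 \<le> (k + l + 1) ^ 2"
      by (simp add: prod_encode_def triangle_def power2_eq_square)
    then have "real (prod_encode (k, l)) + 1 \<le> (real (k + l) + 1) ^ 2"
      by (metis (mono_tags, lifting) Num.of_nat_simps(4) of_nat_1 of_nat_le_iff of_nat_power)
    then have "(real (prod_encode (k, l)) + 1) ^ 2 \<le> ((real (k + l) + 1) ^ 2) ^ 2"
      by (rule power_mono) simp
    then have "1 / layer_weight (prod_encode (k, l)) \<le> ((real (k + l) + 1) ^ 2) ^ 2"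
      by (simp only: layer_weight_def div_by_1 divide_divide_eq_right mult_1)
    then have "(1 / layer_weight (prod_encode (k, l))) ^ d \<le> (((real (k + l) + 1) ^ 2) ^ 2) ^ d"
      by (intro power_mono) (auto simp: layer_weight_def)
    also have "\<dots> = (real (k + l) + 1) ^ (4 * d)" by (simp flip: power_mult)
    also have "\<dots> \<le> (exp (\<eta> * real (k + l)) / \<eta>) ^ (4 * d)"
    proof (intro power_mono)
      have "(real (k + l) + 1) * \<eta> \<le> 1 + \<eta> * real (k + l)" using \<eta> by (simp add: algebra_simps)
      also have "\<dots> \<le> exp (\<eta> * real (k + l))" by (rule exp_ge_add_one_self)
      finally show "real (k + l) + 1 \<le> exp (\<eta> * real (k + l)) / \<eta>" using \<eta> by (simp add: field_simps)
    qed simp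
    also have "\<dots> = exp (4 * real d * \<eta> * real (k + l)) / \<eta> ^ (4 * d)"
      by (simp add: power_divide exp_of_nat_mult[symmetric] mult.assoc)
    also have "\<dots> \<le> exp (\<epsilon> * ln 2 / 2 * real (k + l)) / \<eta> ^ (4 * d)"
      using mult_right_mono[OF d\<eta>, of "real (k + l)"] \<eta>(1)
      by (intro divide_right_mono exp_le_cancel_iff[THEN iffD2]) simp_all
    finally have "exp (- (\<epsilon> * ln 2 * l)) * (1 / layer_weight (prod_encode (k, l))) ^ d
      \<le> exp (- (\<epsilon> * ln 2 * l)) * (exp (\<epsilon> * ln 2 / 2 * real (k + l)) / \<eta> ^ (4 * d))"
      by (intro mult_left_mono) auto
    also have "exp (- (\<epsilon> * ln 2 * l)) * (exp (\<epsilon> * ln 2 / 2 * real (k + l)) / \<eta> ^ (4 * d)) = c * y ^ l"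
    proof -
      have "y ^ l = exp (real l * (- (\<epsilon> * ln 2 / 2)))" unfolding y_def by (rule exp_of_nat_mult[symmetric])
      moreover have "- (\<epsilon> * ln 2 * l) + \<epsilon> * ln 2 / 2 * real (k + l) = \<epsilon> * ln 2 / 2 * k + real l * (- (\<epsilon> * ln 2 / 2))"
        by (simp add: field_simps)
      then have "exp (- (\<epsilon> * ln 2 * l)) * exp (\<epsilon> * ln 2 / 2 * real (k + l)) = exp (\<epsilon> * ln 2 / 2 * k) * exp (real l * (- (\<epsilon> * ln 2 / 2)))"
        unfolding exp_add[symmetric] by (rule arg_cong)
      ultimately show ?thesis unfolding c_def by (simp only: times_divide_eq_right times_divide_eq_left)
    qed
    also have "exp (- (\<epsilon> * ln 2 * l)) = ((1/2::real) ^ l) powr \<epsilon>"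
      by (simp add: powr_def ln_realpow ln_div mult.commute)
    finally show ?thesis .
  qed
  have "summable (\<lambda>l. c * y ^ l)" using y by (intro summable_mult summable_geometric) auto
  then show ?thesis
  proof (rule summable_comparison_test'[where N=0])
    fix l
    have "0 \<le> ((1/2) ^ l) powr \<epsilon> * (1 / layer_weight (prod_encode (k, l))) ^ d"
      by (simp add: layer_weight_def)
    then show "norm (((1/2) ^ l) powr \<epsilon> * (1 / layer_weight (prod_encode (k, l))) ^ d) \<le> c * y ^ l"
      using bound[of l] by simp
  qed
qed

lemma mass_systemD:
  assumes "mass_system s P N F w C"
  shows "i < N l \<Longrightarrow> closed (P l i)"
    and "i < N l \<Longrightarrow> j < N l \<Longrightarrow> i \<noteq> j \<Longrightarrow> P l i \<inter> P l j = {}"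
    and "finite (F n)" and "0 \<le> w n z" and "1 / 2 \<le> sum (w n) (F n)" and "sum (w n) (F n) \<le> 1"
    and "z \<in> F n \<Longrightarrow> l \<le> n \<Longrightarrow> \<exists>i<N l. z \<in> P l i"
    and "l \<le> n \<Longrightarrow> i < N l \<Longrightarrow> sum (w n) (F n \<inter> P l i) \<le> C * (1/2) ^ l"
    and "(1/2) ^ n \<le> r \<Longrightarrow> sum (w n) (F n \<inter> cball x r) \<le> C * r powr s"
  using assms unfolding mass_system_def by simp_all

text \<open>The points near \<open>x\<close> are sorted by the first level \<open>l\<close> at which they lie in another piece than
  \<open>x\<close>; both the distance and the common piece at level \<open>l - 1\<close> bound their mass, and the geometric
  mean of the two bounds leaves a factor decaying in \<open>l\<close>.\<close>

lemma mass_system_pair_sum: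
  assumes ms: "mass_system s P N F w C" and x: "x \<in> F m"
    and \<epsilon>: "0 < \<epsilon>" "\<epsilon> < 1" and s: "0 \<le> s" and \<rho>: "(1/2) ^ m \<le> \<rho>"
    and pr: "\<And>z. 0 \<le> pr z" "\<And>z. pr z \<le> 1"
    and sep: "\<And>l i j z. l \<le> m \<Longrightarrow> i < N l \<Longrightarrow> j < N l \<Longrightarrow> i \<noteq> j \<Longrightarrow> x \<in> P l i \<Longrightarrow> z \<in> P l j \<Longrightarrow> pr z \<le> b l"
    and b: "\<And>l. 0 \<le> b l"
  shows "(\<Sum>z\<in>F m. w m z * (of_bool (dist x z \<le> \<rho>) * pr z)) \<le>
    2 * max C 1 * \<rho> powr (s * (1 - \<epsilon>)) * (\<Sum>l\<le>m. ((1/2) ^ l) powr \<epsilon> * b l) + max C 1 * (1/2) ^ m"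
proof -
  note msD = mass_systemD[OF ms]
  define D where "D = max C 1"
  have D: "1 \<le> D" "C \<le> D" by (auto simp: D_def)
  have \<rho>0: "0 < \<rho>" by (rule less_le_trans[OF _ \<rho>]) simp
  define A where "A l = {z \<in> F m. dist x z \<le> \<rho> \<and> (\<forall>l'<l. \<exists>i<N l'. x \<in> P l' i \<and> z \<in> P l' i)}" for l
  have finA: "finite (A l)" for l using msD(3) by (simp add: A_def)
  \<comment> \<open>For \<open>l > 0\<close> the points of \<open>A l\<close> share the piece of
    \<open>x\<close> at level \<open>l - 1\<close>, whence the factor 2.\<close>
  have m1: "sum (w m) (A l) \<le> 2 * D * (1/2) ^ l" if lm: "l \<le> Suc m" for l
  proof (cases l)
    case 0
    have "sum (w m) (A l) \<le> sum (w m) (F m)"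
      by (rule sum_mono2) (use msD(3,4) in \<open>auto simp: A_def\<close>)
    then show ?thesis using msD(6)[of m] D 0 by simp
  next
    case (Suc l')
    obtain i where i: "i < N l'" "x \<in> P l' i" using msD(7)[OF x, of l'] lm Suc by auto
    have "A l \<subseteq> F m \<inter> P l' i"
    proof
      fix z assume z: "z \<in> A l"
      then obtain j where j: "j < N l'" "x \<in> P l' j" "z \<in> P l' j" by (auto simp: A_def Suc)
      then have "j = i" using msD(2)[OF i(1) j(1)] i(2) by blast
      then show "z \<in> F m \<inter> P l' i" using z j by (simp add: A_def)
    qed
    then have "sum (w m) (A l) \<le> sum (w m) (F m \<inter> P l' i)"
      by (rule sum_mono2[rotated]) (use msD(3,4) in auto)
    also have "\<dots> \<le> C * (1/2) ^ l'" using that Suc i by (intro msD(8)) auto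
    also have "\<dots> \<le> D * (1/2) ^ l'" using D by (intro mult_right_mono) auto
    finally show ?thesis by (simp add: Suc)
  qed
  have m2: "sum (w m) (A l) \<le> 2 * D * \<rho> powr s" for l
  proof -
    have "sum (w m) (A l) \<le> sum (w m) (F m \<inter> cball x \<rho>)"
      by (rule sum_mono2) (use msD(3,4) in \<open>auto simp: A_def\<close>)
    also have "\<dots> \<le> C * \<rho> powr s" by (rule msD(9)[OF \<rho>])
    also have "\<dots> \<le> 2 * D * \<rho> powr s" using D by (intro mult_right_mono) auto
    finally show ?thesis .
  qed
  have m: "sum (w m) (A l) \<le> 2 * D * (((1/2) ^ l) powr \<epsilon> * \<rho> powr (s * (1 - \<epsilon>)))" if "l \<le> Suc m" for l
  proof -
    let ?a = "sum (w m) (A l)"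
    have a0: "0 \<le> ?a" by (rule sum_nonneg) (rule msD(4))
    have "?a = ?a powr \<epsilon> * ?a powr (1 - \<epsilon>)" using a0 by (simp add: powr_add[symmetric])
    also have "\<dots> \<le> (2 * D * (1/2) ^ l) powr \<epsilon> * (2 * D * \<rho> powr s) powr (1 - \<epsilon>)"
      using \<epsilon> a0 m1[OF that] m2[of l] by (intro mult_mono powr_mono2) auto
    also have "\<dots> = (2 * D) powr \<epsilon> * (2 * D) powr (1 - \<epsilon>) * (((1/2) ^ l) powr \<epsilon> * \<rho> powr (s * (1 - \<epsilon>)))"
      using D by (simp only: powr_mult powr_powr mult_ac)
    also have "(2 * D) powr \<epsilon> * (2 * D) powr (1 - \<epsilon>) = 2 * D" using D by (simp add: powr_add[symmetric])
    finally show ?thesis .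
  qed
  \<comment> \<open>A point first separated from \<open>x\<close> at level \<open>l \<le> m\<close>
    is paid for by \<open>b l\<close>. The nearby points never separated up to level
    \<open>m\<close> form \<open>A (Suc m)\<close>; there \<open>pr z \<le> 1\<close> is used, which
    produces the additional term with \<open>(1/2) ^ m\<close>.\<close>
  have pt: "w m z * (of_bool (dist x z \<le> \<rho>) * pr z) \<le> (\<Sum>l\<le>m. w m z * of_bool (z \<in> A l) * b l) + w m z * of_bool (z \<in> A (Suc m))"
    if z: "z \<in> F m" for z
  proof (cases "dist x z \<le> \<rho>")
    case False
    then show ?thesis using msD(4) b by (auto intro!: add_nonneg_nonneg sum_nonneg)
  next
    case dist: True
    have nn: "0 \<le> (\<Sum>l\<le>m. w m z * of_bool (z \<in> A l) * b l)" "0 \<le> w m z * of_bool (z \<in> A (Suc m))"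
      using msD(4) b by (auto intro!: sum_nonneg)
    show ?thesis
    proof (cases "z \<in> A (Suc m)")
      case True
      have "w m z * pr z \<le> w m z * 1" using pr msD(4) by (intro mult_left_mono) auto
      then show ?thesis using True dist nn by simp
    next
      case False
      let ?S = "\<lambda>l. \<not> (\<exists>i<N l. x \<in> P l i \<and> z \<in> P l i)"
      from False obtain l0 where l0: "l0 < Suc m" "?S l0" using z dist by (auto simp: A_def)
      define l where "l = (LEAST l. ?S l)"
      have l: "?S l" unfolding l_def by (rule LeastI[of ?S, OF l0(2)])
      have "l \<le> l0" unfolding l_def by (rule Least_le[of ?S, OF l0(2)])
      then have lm: "l \<le> m" using l0 by simp
      have "\<exists>i<N l'. x \<in> P l' i \<and> z \<in> P l' i" if "l' < l" for l'
        using not_less_Least[of l' ?S] that unfolding l_def by blast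
      then have zA: "z \<in> A l" using z dist by (simp add: A_def)
      obtain i j where ij: "i < N l" "x \<in> P l i" "j < N l" "z \<in> P l j"
        using msD(7)[OF x lm] msD(7)[OF z lm] by blast
      then have "i \<noteq> j" using l by blast
      then have "pr z \<le> b l" using sep[OF lm ij(1,3)] ij by blast
      then have "w m z * (of_bool (dist x z \<le> \<rho>) * pr z) \<le> w m z * of_bool (z \<in> A l) * b l"
        using dist zA msD(4) by (simp add: mult_left_mono)
      also have "\<dots> \<le> (\<Sum>l\<le>m. w m z * of_bool (z \<in> A l) * b l)"
        by (rule member_le_sum) (use lm msD(4) b in auto)
      finally show ?thesis using nn by linarith
    qed
  qed
  have ind: "(\<Sum>z\<in>F m. w m z * of_bool (z \<in> A l)) = sum (w m) (A l)" for l
  proof -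
    have "(\<Sum>z\<in>F m. w m z * of_bool (z \<in> A l)) = (\<Sum>z\<in>A l. w m z * of_bool (z \<in> A l))"
      by (rule sum.mono_neutral_right) (use msD(3) in \<open>auto simp: A_def\<close>)
    then show ?thesis by simp
  qed
  have "(\<Sum>z\<in>F m. w m z * (of_bool (dist x z \<le> \<rho>) * pr z)) \<le>
    (\<Sum>z\<in>F m. (\<Sum>l\<le>m. w m z * of_bool (z \<in> A l) * b l) + w m z * of_bool (z \<in> A (Suc m)))"
    by (rule sum_mono) (rule pt)
  also have "\<dots> = (\<Sum>l\<le>m. \<Sum>z\<in>F m. w m z * of_bool (z \<in> A l) * b l) + sum (w m) (A (Suc m))"
    unfolding sum.distrib ind by (subst sum.swap) (rule refl)
  also have "(\<Sum>l\<le>m. \<Sum>z\<in>F m. w m z * of_bool (z \<in> A l) * b l) = (\<Sum>l\<le>m. sum (w m) (A l) * b l)"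
    unfolding sum_distrib_right[symmetric] ind ..
  also have "\<dots> \<le> (\<Sum>l\<le>m. 2 * D * (((1/2) ^ l) powr \<epsilon> * \<rho> powr (s * (1 - \<epsilon>))) * b l)"
    by (intro sum_mono mult_right_mono m b) simp
  also have "\<dots> = 2 * D * \<rho> powr (s * (1 - \<epsilon>)) * (\<Sum>l\<le>m. ((1/2) ^ l) powr \<epsilon> * b l)"
    unfolding sum_distrib_left by (rule sum.cong) (auto simp: mult_ac)
  also have "sum (w m) (A (Suc m)) \<le> D * (1/2) ^ m" using m1[of "Suc m"] by simp
  finally show ?thesis unfolding D_def by simp
qed

text \<open>Apart from the unseparated pairs, scale \<open>j\<close> contributes a multiple of
  \<open>2 powr (j * (t - a))\<close> with \<open>a = s * (1 - \<epsilon>) + CARD('d) > t\<close>: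
  the first part of \<open>a\<close> comes from the growth of the masses, the second from the
  small-ball probabilities. The bound depends neither on \<open>n\<close> nor on the shift
  \<open>g\<close>.\<close>

lemma pair_energy_expectation:
  fixes \<psi> :: "nat \<Rightarrow> nat \<Rightarrow> 'a::metric_space \<Rightarrow> real" and t :: real and p :: nat
  assumes bf: "bump_family \<psi> N'" and ms: "mass_system s P N F w C" and s: "0 \<le> s"
    and t: "0 < t" "t < s + CARD('d)" and p: "t + 1 \<le> p"
    and N': "\<And>l. N' (prod_encode (k, l)) = N l"
    and \<psi>: "\<And>l i j x. i < N l \<Longrightarrow> j < N l \<Longrightarrow> x \<in> P l j \<Longrightarrow> \<psi> (prod_encode (k, l)) i x = (if i = j then 1 else 0)"
  obtains A :: real where "\<And>n (g :: 'a \<Rightarrow>\<^sub>C (real ^ 'd)).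
    (\<integral>\<^sup>+u. ennreal (pair_energy t n (F (p * n)) (w (p * n)) (apply_bcontfun (random_map \<psi> N' u + g))) \<partial>cubes_measure) \<le> ennreal A"
proof -
  interpret bump_family \<psi> N' by fact
  note msD = mass_systemD[OF ms]
  let ?P = "cubes_measure :: (nat \<times> nat \<Rightarrow> real ^ 'd) measure"
  let ?d = "CARD('d)"
  interpret Pr: prob_space ?P by (rule prob_space_cubes_measure)
  define D where "D = max C 1"
  have D: "1 \<le> D" by (simp add: D_def)
  \<comment> \<open>Small enough for \<open>s * \<epsilon> < s + ?d - t\<close>; the denominator
    \<open>s + 1\<close> covers \<open>s = 0\<close> as well.\<close>
  define \<epsilon> where "\<epsilon> = min (1/2) ((s + ?d - t) / 2 / (s + 1))"
  have \<epsilon>: "0 < \<epsilon>" "\<epsilon> < 1" using s t by (auto simp: \<epsilon>_def)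
  define a where "a = s * (1 - \<epsilon>) + ?d"
  have "s * \<epsilon> < s + ?d - t"
  proof -
    have "s * \<epsilon> \<le> (s + 1) * \<epsilon>" using \<epsilon> by (intro mult_right_mono) auto
    also have "\<dots> \<le> (s + 1) * ((s + ?d - t) / 2 / (s + 1))"
      using s by (intro mult_left_mono) (auto simp: \<epsilon>_def)
    also have "\<dots> = (s + ?d - t) / 2"
    proof -
      have "u * (v / u) = v" if "u \<noteq> 0" for u v :: real using that by simp
      then show ?thesis using s by (metis add_nonneg_eq_0_iff zero_le_one zero_neq_one)
    qed
    also have "\<dots> < s + ?d - t" using t by simp
    finally show ?thesis .
  qed
  then have at: "t < a" by (simp add: a_def algebra_simps)
  define H where "H = (\<Sum>l. ((1/2) ^ l) powr \<epsilon> * (1 / layer_weight (prod_encode (k, l))) ^ ?d)"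
  have H: "(\<Sum>l\<le>m. ((1/2) ^ l) powr \<epsilon> * (1 / layer_weight (prod_encode (k, l))) ^ ?d) \<le> H" for m
    unfolding H_def using summable_layer_sum[OF \<epsilon>(1), of k ?d]
    by (intro sum_le_suminf) (auto simp: less_imp_le layer_weight_pos)
  have H0: "0 \<le> H" using order_trans[OF _ H[of 0]] by (simp add: less_imp_le layer_weight_pos)
  define y where "y = 2 powr (t - a)"
  have y: "0 < y" "y < 1" using at by (auto simp: y_def powr_less_one)
  define B where "B = 2 * D * 2 ^ ?d * H * 4 powr a"
  have B: "0 \<le> B" using D H0 by (simp add: B_def)
  show ?thesis
  proof (rule that[of "B / (1 - y) + D"])
    fix n and g :: "'a \<Rightarrow>\<^sub>C (real ^ 'd)"
    let ?f = "\<lambda>u. apply_bcontfun (random_map \<psi> N' u + g)"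
    \<comment> \<open>Masses are taken at a finer level than the energy. Unseparated pairs
      contribute at most \<open>D * (1/2) ^ m\<close> times \<open>2 powr (n * t)\<close> per scale,
      and \<open>t + 1 \<le> p\<close> turns this into at most \<open>D * (1/2) ^ n\<close> for each
      of the \<open>n + 1\<close> scales.\<close>
    define m where "m = p * n"
    define \<rho> where "\<rho> j = 4 * (1/2 :: real) ^ j" for j :: nat
    define S where "S j x z = {u. dist (?f u x) (?f u z) \<le> \<rho> j}" for j x z
    have S: "S j x z \<in> sets ?P" for j x z
    proof -
      have "closed {f :: 'a \<Rightarrow>\<^sub>C (real ^ 'd). dist (apply_bcontfun (f + g) x) (apply_bcontfun (f + g) z) \<le> \<rho> j}"
        unfolding plus_bcontfun.rep_eq by (intro closed_Collect_le continuous_intros continuous_on_bcontfun_eval)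
      then have "random_map \<psi> N' -` {f. dist (apply_bcontfun (f + g) x) (apply_bcontfun (f + g) z) \<le> \<rho> j} \<inter> space ?P \<in> sets ?P"
        by (intro measurable_sets[OF random_map_measurable]) simp
      moreover have "space ?P = UNIV" by (simp add: space_PiM cube_measure_def)
      ultimately show ?thesis by (simp add: S_def vimage_def)
    qed
    define c where "c j x z = 2 powr (real j * t) * (w m x * w m z) * of_bool (dist x z \<le> \<rho> j)" for j x z
    have c: "0 \<le> c j x z" for j x z unfolding c_def using msD(4) by (intro mult_nonneg_nonneg) auto
    have en: "ennreal (pair_energy t n (F m) (w m) (?f u)) = (\<Sum>j\<le>n. \<Sum>x\<in>F m. \<Sum>z\<in>F m. ennreal (c j x z) * indicator (S j x z) u)" for u
    proof -
      have "pair_energy t n (F m) (w m) (?f u) = (\<Sum>j\<le>n. \<Sum>x\<in>F m. \<Sum>z\<in>F m. c j x z * indicator (S j x z) u)"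
        unfolding pair_energy_def c_def S_def \<rho>_def by (intro sum.cong refl) (auto simp: indicator_def)
      also have "ennreal \<dots> = (\<Sum>j\<le>n. \<Sum>x\<in>F m. \<Sum>z\<in>F m. ennreal (c j x z * indicator (S j x z) u))"
        using c by (simp add: sum_ennreal sum_nonneg)
      finally show ?thesis by (simp add: ennreal_mult' c ennreal_indicator)
    qed
    have "(\<integral>\<^sup>+u. ennreal (pair_energy t n (F m) (w m) (?f u)) \<partial>?P)
      = (\<Sum>j\<le>n. \<Sum>x\<in>F m. \<Sum>z\<in>F m. ennreal (c j x z) * emeasure ?P (S j x z))"
      unfolding en using S by (simp add: nn_integral_sum nn_integral_cmult_indicator)
    also have "\<dots> = ennreal (\<Sum>j\<le>n. \<Sum>x\<in>F m. \<Sum>z\<in>F m. c j x z * measure ?P (S j x z))"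
      using c by (simp add: Pr.emeasure_eq_measure sum_ennreal sum_nonneg flip: ennreal_mult)
    also have "\<dots> \<le> ennreal (B / (1 - y) + D)"
    proof (rule ennreal_leI)
      have inner: "(\<Sum>z\<in>F m. w m z * (of_bool (dist x z \<le> \<rho> j) * measure ?P (S j x z))) \<le>
        2 * D * 2 ^ ?d * H * \<rho> j powr a + D * (1/2) ^ m" if x: "x \<in> F m" and j: "j \<le> n" for x j
      proof -
        have \<rho>0: "0 < \<rho> j" by (simp add: \<rho>_def)
        have "1 \<le> p" using p t by linarith
        then have "n \<le> m" by (simp add: m_def)
        then have "(1/2 :: real) ^ m \<le> (1/2) ^ j" using j by (intro power_decreasing) auto
        also have "\<dots> \<le> \<rho> j" by (simp add: \<rho>_def)
        finally have \<rho>m: "(1/2) ^ m \<le> \<rho> j" .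
        let ?b = "\<lambda>l. (2 * \<rho> j / layer_weight (prod_encode (k, l))) ^ ?d"
        have "(\<Sum>z\<in>F m. w m z * (of_bool (dist x z \<le> \<rho> j) * measure ?P (S j x z))) \<le>
          2 * max C 1 * \<rho> j powr (s * (1 - \<epsilon>)) * (\<Sum>l\<le>m. ((1/2) ^ l) powr \<epsilon> * ?b l) + max C 1 * (1/2) ^ m"
        proof (rule mass_system_pair_sum[OF ms x \<epsilon> s \<rho>m])
          fix l i i' z assume *: "l \<le> m" "i < N l" "i' < N l" "i \<noteq> i'" "x \<in> P l i" "z \<in> P l i'"
          have "emeasure ?P (S j x z) \<le> ennreal (?b l)"
            unfolding S_def
          proof (rule random_map_small_ball)
            show "i < N' (prod_encode (k, l))" using * N' by simp
            show "\<psi> (prod_encode (k, l)) i x = 1" using \<psi>[of i l i x] * by simp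
            show "\<psi> (prod_encode (k, l)) i z = 0" using \<psi>[of i l i' z] * by simp
          qed (use \<rho>0 in simp)
          then show "measure ?P (S j x z) \<le> ?b l"
            using \<rho>0 layer_weight_pos by (simp add: Pr.emeasure_eq_measure less_imp_le)
        qed (use \<rho>0 layer_weight_pos in \<open>auto simp: less_imp_le\<close>)
        also have "(\<Sum>l\<le>m. ((1/2) ^ l) powr \<epsilon> * ?b l) =
          2 ^ ?d * \<rho> j powr ?d * (\<Sum>l\<le>m. ((1/2) ^ l) powr \<epsilon> * (1 / layer_weight (prod_encode (k, l))) ^ ?d)"
          unfolding sum_distrib_left using \<rho>0
          by (intro sum.cong) (auto simp: power_divide power_mult_distrib powr_realpow)
        also have "2 * max C 1 * \<rho> j powr (s * (1 - \<epsilon>)) * (2 ^ ?d * \<rho> j powr ?d * (\<Sum>l\<le>m. ((1/2) ^ l) powr \<epsilon> * (1 / layer_weight (prod_encode (k, l))) ^ ?d))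
          \<le> 2 * D * \<rho> j powr (s * (1 - \<epsilon>)) * (2 ^ ?d * \<rho> j powr ?d * H)"
          unfolding D_def by (intro mult_left_mono H) auto
        also have "\<dots> = 2 * D * 2 ^ ?d * H * \<rho> j powr a"
          by (simp add: a_def powr_add)
        finally show ?thesis by (simp add: D_def)
      qed
      have "(\<Sum>j\<le>n. \<Sum>x\<in>F m. \<Sum>z\<in>F m. c j x z * measure ?P (S j x z)) =
        (\<Sum>j\<le>n. 2 powr (real j * t) * (\<Sum>x\<in>F m. w m x * (\<Sum>z\<in>F m. w m z * (of_bool (dist x z \<le> \<rho> j) * measure ?P (S j x z)))))"
        unfolding c_def sum_distrib_left by (simp only: mult_ac)
      also have "\<dots> \<le> (\<Sum>j\<le>n. 2 powr (real j * t) * (\<Sum>x\<in>F m. w m x * (2 * D * 2 ^ ?d * H * \<rho> j powr a + D * (1/2) ^ m)))"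
        by (intro sum_mono mult_left_mono inner msD(4)) auto
      also have "\<dots> \<le> (\<Sum>j\<le>n. 2 powr (real j * t) * (2 * D * 2 ^ ?d * H * \<rho> j powr a + D * (1/2) ^ m))"
      proof (intro sum_mono mult_left_mono)
        fix j
        show "(\<Sum>x\<in>F m. w m x * (2 * D * 2 ^ ?d * H * \<rho> j powr a + D * (1/2) ^ m)) \<le> 2 * D * 2 ^ ?d * H * \<rho> j powr a + D * (1/2) ^ m"
          unfolding sum_distrib_right[symmetric] using msD(6)[of m] D H0
          by (intro mult_left_le_one_le sum_nonneg msD(4)) auto
      qed auto
      also have "\<dots> = (\<Sum>j\<le>n. B * y ^ j) + (\<Sum>j\<le>n. 2 powr (real j * t) * (D * (1/2) ^ m))"
      proof -
        have "2 powr (real j * t) * (2 * D * 2 ^ ?d * H * \<rho> j powr a) = B * y ^ j" for j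
        proof -
          have "y ^ j = 2 powr (real j * (t - a))" by (simp add: y_def powr_power mult.commute)
          also have "\<dots> = 2 powr (real j * t) / 2 powr (real j * a)" by (simp add: right_diff_distrib powr_diff)
          finally have "y ^ j = 2 powr (real j * t) * ((1/2) ^ j) powr a" unfolding half_power_powr by simp
          moreover have "\<rho> j powr a = 4 powr a * ((1/2) ^ j) powr a" unfolding \<rho>_def by (subst powr_mult) auto
          ultimately show ?thesis unfolding B_def by (simp only: mult_ac)
        qed
        then show ?thesis unfolding distrib_left sum.distrib by (intro arg_cong2[of _ _ _ _ "(+)"] sum.cong) auto
      qed
      also have "(\<Sum>j\<le>n. B * y ^ j) \<le> B / (1 - y)"
      proof -
        have "(\<Sum>j\<le>n. y ^ j) \<le> (\<Sum>j. y ^ j)" using y by (intro sum_le_suminf summable_geometric) auto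
        also have "\<dots> = 1 / (1 - y)" using y by (intro suminf_geometric) auto
        finally show ?thesis using B mult_left_mono[of _ "1 / (1 - y)" B] by (simp add: sum_distrib_left[symmetric])
      qed
      also have "(\<Sum>j\<le>n. 2 powr (real j * t) * (D * (1/2) ^ m)) \<le> D"
      proof -
        have "(\<Sum>j\<le>n. 2 powr (real j * t) * (D * (1/2) ^ m)) \<le> (\<Sum>j\<le>n. D * (1/2) ^ n)"
        proof (rule sum_mono)
          fix j assume "j \<in> {..n}"
          then have "real j * t \<le> real n * t" using t by (intro mult_right_mono) auto
          also have "\<dots> \<le> real n * (real p - 1)" using p by (intro mult_left_mono) auto
          finally have "2 powr (real j * t) \<le> 2 powr (real n * (real p - 1))" by (intro powr_mono) auto
          also have "\<dots> = 2 powr (real m - real n)" by (simp add: m_def algebra_simps)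
          also have "\<dots> = 2 ^ m / 2 ^ n" by (simp add: powr_diff powr_realpow)
          finally have "2 powr (real j * t) * (D * (1/2) ^ m) \<le> 2 ^ m / 2 ^ n * (D * (1/2) ^ m)"
            using D by (intro mult_right_mono) auto
          also have "\<dots> = D * (1/2) ^ n" by (simp add: power_one_over field_simps)
          finally show "2 powr (real j * t) * (D * (1/2) ^ m) \<le> D * (1/2) ^ n" .
        qed
        also have "\<dots> = D * (real (Suc n) / 2 ^ n)" by (simp add: power_divide)
        also have "\<dots> \<le> D * 1"
        proof (intro mult_left_mono)
          have "Suc n \<le> 2 ^ n" by (induction n) auto
          then have "real (Suc n) \<le> 2 ^ n" by (metis of_nat_le_iff of_nat_numeral of_nat_power)
          then show "real (Suc n) / 2 ^ n \<le> 1" by simp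
        qed (use D in simp)
        finally show ?thesis by simp
      qed
      finally show "(\<Sum>j\<le>n. \<Sum>x\<in>F m. \<Sum>z\<in>F m. c j x z * measure ?P (S j x z)) \<le> B / (1 - y) + D" by simp
    qed
    finally show "(\<integral>\<^sup>+u. ennreal (pair_energy t n (F (p * n)) (w (p * n)) (?f u)) \<partial>?P) \<le> ennreal (B / (1 - y) + D)"
      unfolding m_def .
  qed
qed

section \<open>Prevalence\<close>

lemma pair_energy_measurable:
  "(\<lambda>f :: 'a::metric_space \<Rightarrow>\<^sub>C 'b::metric_space. pair_energy t n F w (apply_bcontfun f)) \<in> borel_measurable borel"
  unfolding pair_energy_def
proof (intro borel_measurable_sum borel_measurable_times borel_measurable_const)
  fix k x z
  have "closed {f :: 'a \<Rightarrow>\<^sub>C 'b. dist (apply_bcontfun f x) (apply_bcontfun f z) \<le> 4 * (1/2) ^ k}"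
    by (intro closed_Collect_le continuous_intros continuous_on_bcontfun_eval)
  then have "indicat_real {f :: 'a \<Rightarrow>\<^sub>C 'b. dist (apply_bcontfun f x) (apply_bcontfun f z) \<le> 4 * (1/2) ^ k} \<in> borel_measurable borel"
    by simp
  then have "(\<lambda>f. of_bool (dist x z \<le> 4 * (1/2) ^ k) * indicat_real {f :: 'a \<Rightarrow>\<^sub>C 'b. dist (apply_bcontfun f x) (apply_bcontfun f z) \<le> 4 * (1/2) ^ k} f) \<in> borel_measurable borel"
    by (intro borel_measurable_times borel_measurable_const)
  then show "(\<lambda>f :: 'a \<Rightarrow>\<^sub>C 'b. of_bool (dist x z \<le> 4 * (1/2) ^ k \<and> dist (apply_bcontfun f x) (apply_bcontfun f z) \<le> 4 * (1/2) ^ k) :: real) \<in> borel_measurable borel"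
    by (rule measurable_cong[THEN iffD1, rotated]) (auto simp: indicator_def)
qed

lemma prevalent_hausdorff_pre_measure_nonzero:
  fixes T :: "nat \<Rightarrow> real"
  assumes K: "compact (UNIV :: 'a::metric_space set)"
    and T: "\<And>k. 0 < T k"
    and sys: "\<And>k. \<exists>(s::real) (P :: nat \<Rightarrow> nat \<Rightarrow> 'a set) N F w C. 0 \<le> s \<and> T k < s + CARD('d) \<and> mass_system s P N F w C"
  shows "prevalent {f :: 'a \<Rightarrow>\<^sub>C (real ^ 'd). \<forall>k. hausdorff_pre_measure (T k) 1 (function_graph (apply_bcontfun f)) \<noteq> 0}"
proof -
  let ?P = "cubes_measure :: (nat \<times> nat \<Rightarrow> real ^ 'd) measure"
  define Q where "Q k s P N F w C \<longleftrightarrow> 0 \<le> s \<and> T k < s + CARD('d) \<and> mass_system s P N F w C"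
    for k w C and s :: real and N and P :: "nat \<Rightarrow> nat \<Rightarrow> 'a set" and F
  have "\<exists>s P N F w C. Q k s P N F w C" for k
    using sys[of k] unfolding Q_def .
  then obtain s P N F w C where "\<And>k. Q k (s k) (P k) (N k) (F k) (w k) (C k)" by metis
  then have s: "\<And>k. 0 \<le> s k" "\<And>k. T k < s k + CARD('d)" and ms: "\<And>k. mass_system (s k) (P k) (N k) (F k) (w k) (C k)"
    unfolding Q_def by simp_all
  define R where "R q \<psi> \<longleftrightarrow> (case prod_decode q of (k, l) \<Rightarrow>
    (\<forall>i. continuous_on UNIV (\<psi> i)) \<and> (\<forall>i x. 0 \<le> \<psi> i x) \<and> (\<forall>x. (\<Sum>i<N k l. \<psi> i x) \<le> 1) \<and>
    (\<forall>i<N k l. \<forall>j<N k l. \<forall>x\<in>P k l j. \<psi> i x = (if i = j then 1 else 0)))" for q and \<psi> :: "nat \<Rightarrow> 'a \<Rightarrow> real"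
  have "\<exists>\<psi>. R q \<psi>" for q
  proof -
    obtain k l where kl: "prod_decode q = (k, l)" by fastforce
    show ?thesis unfolding R_def kl prod.case
      by (rule disjoint_closed_bumps) (use mass_systemD(1,2)[OF ms[of k]] in auto)
  qed
  then obtain \<psi> where \<psi>: "\<And>q. R q (\<psi> q)" by metis
  define N' where "N' q = (case prod_decode q of (k, l) \<Rightarrow> N k l)" for q
  \<comment> \<open>Level \<open>l\<close> of the \<open>k\<close>-th system is layer \<open>prod_encode (k, l)\<close>, so a single random map serves all \<open>k\<close>.\<close>
  have N': "N' (prod_encode (k, l)) = N k l" for k l by (simp add: N'_def)
  have bf: "bump_family \<psi> N'"
  proof
    fix q i and x :: 'a
    show "continuous_on UNIV (\<psi> q i)" "0 \<le> \<psi> q i x" "(\<Sum>i<N' q. \<psi> q i x) \<le> 1"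
      using \<psi>[of q] by (auto simp: R_def N'_def split: prod.splits)
  qed
  interpret bump_family \<psi> N' by fact
  have \<psi>P: "\<psi> (prod_encode (k, l)) i x = (if i = j then 1 else 0)" if "i < N k l" "j < N k l" "x \<in> P k l j" for k l i j x
    using \<psi>[of "prod_encode (k, l)"] that by (simp add: R_def)
  define p where "p k = nat \<lceil>T k + 1\<rceil>" for k
  have p: "T k + 1 \<le> p k" for k unfolding p_def by linarith
  define E where "E k n f = ennreal (pair_energy (T k) n (F k (p k * n)) (w k (p k * n)) (apply_bcontfun f))"
    for k n and f :: "'a \<Rightarrow>\<^sub>C (real ^ 'd)"
  have E_meas [measurable]: "E k n \<in> borel_measurable borel" for k n
    unfolding E_def using pair_energy_measurable by (intro measurable_compose[OF _ measurable_ennreal]) auto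
  \<comment> \<open>Fatou's lemma turns the bound on expected energies, uniform in \<open>n\<close>,
    into an almost surely finite lower limit, that is, energies bounded along infinitely many
    \<open>n\<close>, as the covering argument requires.\<close>
  define L where "L k f = liminf (\<lambda>n. E k n f)" for k f
  have L_meas [measurable]: "L k \<in> borel_measurable borel" for k
    unfolding L_def by measurable
  define B where "B = (\<Union>k. {f. L k f = \<infinity>})"
  have B: "B \<in> sets borel"
  proof -
    have "{f. L k f = \<infinity>} \<in> sets borel" for k
    proof -
      have "L k -` {\<infinity>} \<inter> space borel \<in> sets borel" by (rule measurable_sets[OF L_meas]) simp
      then show ?thesis by (simp add: vimage_def)
    qed
    then show ?thesis unfolding B_def by (intro sets.countable_UN image_subsetI)
  qed
  have good: "\<forall>k. hausdorff_pre_measure (T k) 1 (function_graph (apply_bcontfun f)) \<noteq> 0" if "f \<notin> B" for f :: "'a \<Rightarrow>\<^sub>C (real ^ 'd)"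
  proof
    fix k
    have "L k f < \<infinity>" using that by (simp add: B_def less_top[symmetric])
    then obtain A :: real where A: "0 \<le> A" "L k f = ennreal A" by (cases "L k f") auto
    have lt: "liminf (\<lambda>n. E k n f) < ennreal (A + 1)" using A unfolding L_def by (simp add: ennreal_less_iff)
    show "hausdorff_pre_measure (T k) 1 (function_graph (apply_bcontfun f)) \<noteq> 0"
    proof (rule hausdorff_pre_measure_graph_nonzero[OF K _ T, of _ "A + 1" "\<lambda>n. F k (p k * n)" "\<lambda>n. w k (p k * n)"])
      fix n0
      show "\<exists>n\<ge>n0. pair_energy (T k) n (F k (p k * n)) (w k (p k * n)) (apply_bcontfun f) \<le> A + 1"
      proof (rule ccontr)
        assume "\<not> ?thesis"
        then have "ennreal (A + 1) \<le> E k n f" if "n0 \<le> n" for n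
          unfolding E_def using that by (intro ennreal_leI) (meson linear)
        then have "ennreal (A + 1) \<le> liminf (\<lambda>n. E k n f)"
          by (intro Liminf_bounded) (auto simp: eventually_sequentially)
        then show False using lt by simp
      qed
    qed (use A(1) mass_systemD(3,4,5)[OF ms[of k]] in auto)
  qed
  define \<nu> where "\<nu> = distr ?P borel (random_map \<psi> N' :: (nat \<times> nat \<Rightarrow> real ^ 'd) \<Rightarrow> ('a \<Rightarrow>\<^sub>C (real ^ 'd)))"
  interpret Pr: prob_space ?P by (rule prob_space_cubes_measure)
  have AE: "AE u in ?P. random_map \<psi> N' u + g \<notin> B" for g :: "'a \<Rightarrow>\<^sub>C (real ^ 'd)"
  proof -
    have shift: "(\<lambda>u. random_map \<psi> N' u + g) \<in> measurable ?P borel"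
      by (rule measurable_compose[OF random_map_measurable])
         (intro borel_measurable_continuous_onI continuous_intros)
    have "AE u in ?P. L k (random_map \<psi> N' u + g) \<noteq> \<infinity>" for k
    proof -
      obtain A where A: "\<And>n (g :: 'a \<Rightarrow>\<^sub>C (real ^ 'd)).
        (\<integral>\<^sup>+u. ennreal (pair_energy (T k) n (F k (p k * n)) (w k (p k * n)) (apply_bcontfun (random_map \<psi> N' u + g))) \<partial>cubes_measure) \<le> ennreal A"
        by (rule pair_energy_expectation[OF bf ms[of k] s(1) T s(2) p N' \<psi>P]) blast+
      have "(\<integral>\<^sup>+u. L k (random_map \<psi> N' u + g) \<partial>?P) \<le> liminf (\<lambda>n. \<integral>\<^sup>+u. E k n (random_map \<psi> N' u + g) \<partial>?P)"
        unfolding L_def by (rule nn_integral_liminf) (intro measurable_compose[OF shift] E_meas)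
      also have "\<dots> \<le> liminf (\<lambda>n. ennreal A)"
        by (intro Liminf_mono always_eventually allI) (use A in \<open>simp add: E_def\<close>)
      also have "\<dots> = ennreal A" by (simp add: Liminf_const)
      finally have "(\<integral>\<^sup>+u. L k (random_map \<psi> N' u + g) \<partial>?P) \<noteq> \<infinity>" by (auto simp: top_unique)
      then show ?thesis
        by (intro nn_integral_noteq_infinite measurable_compose[OF shift] L_meas)
    qed
    then show ?thesis by (simp add: B_def AE_all_countable)
  qed
  have "shy (- {f :: 'a \<Rightarrow>\<^sub>C (real ^ 'd). \<forall>k. hausdorff_pre_measure (T k) 1 (function_graph (apply_bcontfun f)) \<noteq> 0})"
    unfolding shy_def
  proof (intro exI[of _ B] exI[of _ \<nu>] conjI allI)
    show "- {f :: 'a \<Rightarrow>\<^sub>C (real ^ 'd). \<forall>k. hausdorff_pre_measure (T k) 1 (function_graph (apply_bcontfun f)) \<noteq> 0} \<subseteq> B"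
      using good by blast
    show "prob_space \<nu>" unfolding \<nu>_def by (rule Pr.prob_space_distr[OF random_map_measurable])
    show "sets \<nu> = sets borel" by (simp add: \<nu>_def)
    fix x :: "'a \<Rightarrow>\<^sub>C (real ^ 'd)"
    \<comment> \<open>Translating \<open>B\<close> by \<open>x\<close> amounts to shifting the
      random map by \<open>- x\<close>, so the almost sure statement applies with
      \<open>g = - x\<close>.\<close>
    have tr: "(\<lambda>b. b + x) ` B = (\<lambda>f. f + - x) -` B"
      by (force simp: image_iff)
    have "(\<lambda>f. f + - x) -` B \<inter> space borel \<in> sets borel"
      by (rule measurable_sets[OF _ B]) (intro borel_measurable_continuous_onI continuous_intros)
    then have Bx: "(\<lambda>b. b + x) ` B \<in> sets borel" by (simp add: tr)
    have "emeasure \<nu> ((\<lambda>b. b + x) ` B) = emeasure ?P (random_map \<psi> N' -` ((\<lambda>b. b + x) ` B) \<inter> space ?P)"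
      unfolding \<nu>_def by (rule emeasure_distr[OF random_map_measurable Bx])
    also have "\<dots> = 0"
    proof (rule emeasure_eq_0_AE[THEN trans[rotated]])
      show "AE u in ?P. \<not> random_map \<psi> N' u + - x \<in> B" by (rule AE)
      show "emeasure ?P (random_map \<psi> N' -` ((\<lambda>b. b + x) ` B) \<inter> space ?P) = emeasure ?P {u \<in> space ?P. random_map \<psi> N' u + - x \<in> B}"
        unfolding tr by (rule arg_cong[where f="emeasure ?P"]) auto
    qed
    finally show "emeasure \<nu> ((\<lambda>b. b + x) ` B) = 0" .
  qed (rule B)
  then show ?thesis unfolding prevalent_def .
qed

lemma prevalent_mono: "prevalent A \<Longrightarrow> A \<subseteq> B \<Longrightarrow> prevalent B"
  unfolding prevalent_def shy_def by (meson Compl_anti_mono order_trans)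

text \<open>Two regimes: for \<open>t < CARD('d)\<close> separation suffices and the Cantor scheme
  with \<open>s = 0\<close> serves; otherwise \<open>s\<close> is taken strictly between
  \<open>t - CARD('d)\<close> and the dimension, which makes it positive with nonzero Hausdorff
  measure.\<close>

lemma mass_system_below_dim:
  assumes K: "compact (UNIV :: 'a::metric_space set)" "uncountable (UNIV :: 'a set)"
    and t: "0 < t" "ennreal t < hausdorff_dim (UNIV :: 'a set) + of_nat CARD('d::finite)"
  shows "\<exists>(s::real) (P :: nat \<Rightarrow> nat \<Rightarrow> 'a set) N F w C. 0 \<le> s \<and> t < s + CARD('d) \<and> mass_system s P N F w C"
proof (cases "t < CARD('d)")
  case True
  obtain P :: "nat \<Rightarrow> nat \<Rightarrow> 'a set" and N F w C where "mass_system 0 P N F w C"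
    using mass_system_of_uncountable[OF K] by metis
  with True show ?thesis by (intro exI[of _ "0::real"] exI[of _ P] exI[of _ N] exI[of _ F] exI[of _ w] exI[of _ C]) simp
next
  case False
  then have "ennreal (t - CARD('d)) + of_nat CARD('d) < hausdorff_dim (UNIV :: 'a set) + of_nat CARD('d)"
    using t by (simp add: ennreal_of_nat_eq_real_of_nat flip: ennreal_plus)
  then have "ennreal (t - CARD('d)) < hausdorff_dim (UNIV :: 'a set)"
    by (meson add_right_mono not_le)
  \<comment> \<open>Being strictly below the dimension, \<open>c\<close> is finite even if the
    dimension is not.\<close>
  then obtain c where c: "ennreal (t - CARD('d)) < c" "c < hausdorff_dim (UNIV :: 'a set)" by (rule dense[THEN exE]) auto
  then obtain s where s: "0 \<le> s" "c = ennreal s" by (cases c) auto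
  have ts: "t - CARD('d) < s" using c(1) s False by (simp add: ennreal_less_iff)
  have "hausdorff_measure s (UNIV :: 'a set) \<noteq> 0"
  proof
    assume "hausdorff_measure s (UNIV :: 'a set) = 0"
    then have "hausdorff_dim (UNIV :: 'a set) \<le> ennreal s"
      unfolding hausdorff_dim_def using s(1) by (intro Inf_lower) auto
    then show False using c(2) s(2) by simp
  qed
  then obtain P :: "nat \<Rightarrow> nat \<Rightarrow> 'a set" and N F w C where "mass_system s P N F w C"
    using mass_system_of_hausdorff_measure[OF K(1), of s] ts False by fastforce
  then show ?thesis using s ts by (intro exI[of _ s] exI[of _ P] exI[of _ N] exI[of _ F] exI[of _ w] exI[of _ C]) simp
qed

theorem theorem7p5:
  assumes "compact (UNIV :: 'a::metric_space set)"
    and "uncountable (UNIV :: 'a set)"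
  shows "prevalent {f :: 'a \<Rightarrow>\<^sub>C (real ^ 'd).
           hausdorff_dim (function_graph (apply_bcontfun f)) =
           hausdorff_dim (UNIV :: 'a set) + of_nat CARD('d)}"
proof -
  let ?D = "hausdorff_dim (UNIV :: 'a set) + of_nat CARD('d)"
  \<comment> \<open>Rational exponents form a countable family with supremum \<open>?D\<close>,
    finite or not. It contains 1/2, so \<open>from_nat_into\<close> enumerates it.\<close>
  define Q where "Q = {t :: real. t \<in> \<rat> \<and> 0 < t \<and> ennreal t < ?D}"
  have "countable Q" unfolding Q_def by (rule countable_subset[OF _ countable_rat]) auto
  have "ennreal (1/2) < 1" by (subst ennreal_1[symmetric], subst ennreal_less_iff) auto
  also have "1 \<le> (of_nat CARD('d) :: ennreal)" by (metis One_nat_def Suc_leI of_nat_1 of_nat_mono zero_less_card_finite)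
  also have "\<dots> \<le> ?D" by (simp add: add_increasing)
  finally have "1/2 \<in> Q" by (auto simp: Q_def)
  then have "Q \<noteq> {}" by blast
  define T where "T = from_nat_into Q"
  have TQ: "T k \<in> Q" for k unfolding T_def by (rule from_nat_into[OF \<open>Q \<noteq> {}\<close>])
  have "prevalent {f :: 'a \<Rightarrow>\<^sub>C (real ^ 'd). \<forall>k. hausdorff_pre_measure (T k) 1 (function_graph (apply_bcontfun f)) \<noteq> 0}"
  proof (rule prevalent_hausdorff_pre_measure_nonzero[OF assms(1)])
    fix k
    show "0 < T k" using TQ[of k] by (simp add: Q_def)
    show "\<exists>(s::real) (P :: nat \<Rightarrow> nat \<Rightarrow> 'a set) N F w C. 0 \<le> s \<and> T k < s + CARD('d) \<and> mass_system s P N F w C"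
      using TQ[of k] by (intro mass_system_below_dim assms) (auto simp: Q_def)
  qed
  then show ?thesis
  proof (rule prevalent_mono, intro subsetI CollectI antisym)
    fix f :: "'a \<Rightarrow>\<^sub>C (real ^ 'd)"
    have "bounded (range (apply_bcontfun f))" using apply_bcontfun[of f] by (simp add: bcontfun_def)
    then show "hausdorff_dim (function_graph (apply_bcontfun f)) \<le> ?D" by (rule hausdorff_dim_graph_le)
    assume "f \<in> {f. \<forall>k. hausdorff_pre_measure (T k) 1 (function_graph (apply_bcontfun f)) \<noteq> 0}"
    then have nz: "hausdorff_pre_measure t 1 (function_graph (apply_bcontfun f)) \<noteq> 0" if "t \<in> Q" for t
      using that from_nat_into_surj[OF \<open>countable Q\<close>] by (auto simp: T_def)
    show "?D \<le> hausdorff_dim (function_graph (apply_bcontfun f))"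
      unfolding hausdorff_dim_def[of "function_graph _"]
    proof (rule Inf_greatest)
      fix b assume "b \<in> {ennreal s |s. 0 \<le> s \<and> hausdorff_measure s (function_graph (apply_bcontfun f)) = 0}"
      then obtain s where s: "b = ennreal s" "0 \<le> s" "hausdorff_measure s (function_graph (apply_bcontfun f)) = 0" by blast
      show "?D \<le> b"
      proof (rule ccontr)
        assume "\<not> ?D \<le> b"
        then have "ennreal s < ?D" using s by simp
        \<comment> \<open>A finite intermediate \<open>c\<close> covers an infinite
          \<open>?D\<close>. A rational \<open>t\<close> between \<open>s\<close> and
          \<open>c\<close> lies in \<open>Q\<close>, and monotonicity in the exponent then
          contradicts \<open>nz\<close>.\<close>
        then obtain c where c: "ennreal s < c" "c < ?D" by (rule dense[THEN exE]) auto
        then obtain c' where c': "0 \<le> c'" "c = ennreal c'" by (cases c) auto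
        then have "s < c'" using c s(2) by (simp add: ennreal_less_iff)
        then obtain t where t: "t \<in> \<rat>" "s < t" "t < c'" using Rats_dense_in_real by blast
        have "ennreal t < c" using t s(2) c' by (simp add: ennreal_less_iff)
        then have "t \<in> Q" using t s(2) c(2) by (auto simp: Q_def)
        then have "hausdorff_pre_measure t 1 (function_graph (apply_bcontfun f)) \<noteq> 0" by (rule nz)
        moreover have "hausdorff_pre_measure t 1 (function_graph (apply_bcontfun f)) \<le> hausdorff_pre_measure s 1 (function_graph (apply_bcontfun f))"
          using t s(2) by (intro hausdorff_pre_measure_antimono) auto
        moreover have "hausdorff_pre_measure s 1 (function_graph (apply_bcontfun f)) \<le> 0"
          using hausdorff_pre_measure_le_measure[of 1 s "function_graph (apply_bcontfun f)"] s(3) by simp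
        ultimately show False by simp
      qed
    qed
  qed
qed

end
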